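(* Let $\mathcal{P}$ be an independently marked stationary point process on $\mathbb{R}^d$ with unit intensity and with marks following the law $\mathbb{Q}_{\mathbb{M}}$, let $\eta$ be the homogeneous marked Poisson point process on $\mathbb{R}^d\times\mathbb{M}$ whose unmarked process has rate $1$ and whose marks follow the law $\mathbb{Q}_{\mathbb{M}}$, let $h:\mathbf{F}^d\to\mathbb{R}$ be translation invariant, and let $M_{\mathbf 0}$ be a random mark distributed according to $\mathbb{Q}_{\mathbb{M}}$ (independent of $\eta$). (i) For every $\lambda>0$, the statistic $H^{\rho}_\lambda(\mathcal{P})$ is an unbiased estimator of $\mathbb{E}\,h(K^\rho_{\mathbf 0}(\mathcal{P}))$, i.e. $\mathbb{E}\,H^\rho_\lambda(\mathcal{P})=\mathbb{E}\,h(K^\rho_{\mathbf 0}(\mathcal{P}))$. (ii) If $\xi^\rho$ satisfies the $p$-moment condition with respect to $\eta$ for some $p\in(1,\infty)$, and if the cell $C^\rho((\mathbf 0,M_{\mathbf 0}),\eta)$ has a diameter with an exponentially decaying tail, then $H^\rho_\lambda(\eta\cap\hat W_\lambda)$, $\hat H^\rho_\lambda(\eta)$ and $\hat H^\rho_\lambda(\eta\cap\hat W_\lambda)$ are asymptotically unbiased estimators of $\mathbb{E}\,h(K^\rho_{\mathbf 0}(\eta))$, i.e. their expectations converge to $\mathbb{E}\,h(K^\rho_{\mathbf 0}(\eta))$ as $\lambda\to\infty$. (iii) If, in addition to the conditions of (ii), $\xi^\rho$ is stabilizing with respect to $\eta$, then $H^\rho_\lambda(\eta)$, $H^\rho_\lambda(\eta\cap\hat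 W_\lambda)$, $\hat H^\rho_\lambda(\eta)$ and $\hat H^\rho_\lambda(\eta\cap\hat W_\lambda)$ are (weakly) consistent estimators of $\mathbb{E}\,h(K^\rho_{\mathbf 0}(\eta))$, i.e. each converges in probability to $\mathbb{E}\,h(K^\rho_{\mathbf 0}(\eta))$ as $\lambda\to\infty$.
   Context: Setting. Fix $d\ge 1$, $\mu\in[0,\infty)$ and the mark space $\mathbb{M}=[0,\mu]$ with a probability law $\mathbb{Q}_{\mathbb{M}}$. Elements of $\mathbb{R}^d\times\mathbb{M}$ are written $\hat x=(x,m_x)$. $\mathbf{N}$ is the set of locally finite marked point configurations on $\mathbb{R}^d\times\mathbb{M}$, treated as sets. Independently marked means that the marks are i.i.d. with law $\mathbb{Q}_{\mathbb{M}}$ and independent of the unmarked process. $\mathbf{F}^d$ is the space of closed subsets of $\mathbb{R}^d$; $\mathbf 0$ is the origin; $\mathrm{Vol}$ is Lebesgue measure; $B_r(y)$ is the closed Euclidean ball of radius $r$ centered at $y$ and $\hat B_r(y):=B_r(y)\times\mathbb{M}$. Cells. A weight function is a map $\rho:\mathbb{R}^d\times(\mathbb{R}^d\times\mathbb{M})\to\mathbb{R}$; it is assumed measurable, continuous in its first argument (so cells are closed) and translation covariant: $\rho(y+z,(x+z,m))=\rho(y,(x,m))$. The main examples are $\rho_1(y,\hat x)=\|x-y\|$ (Voronoi), $\rho_2(y,\hat x)=\|x-y\|^2-m_x^2$ (Laguerre), $\rho_3(y,\hat x)=\|x-y\|-m_x$ (Johnson--Mehl). The cell of $\hat x$ in $\mathcal{A}\in\mathbf{N}$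 is $C^\rho(\hat x,\mathcal{A}):=\{y\in\mathbb{R}^d:\rho(y,\hat x)\le\rho(y,\hat z)\text{ for all }\hat z\in\mathcal{A}\}$. $h:\mathbf{F}^d\to\mathbb{R}$ is measurable; translation invariant means $h(K+x)=h(K)$. By convention $h(\emptyset)=0$. Typical cell. $K^\rho_{\mathbf 0}=K^\rho_{\mathbf 0}(\mathcal{P})$ is the typical cell of the tessellation generated by $\mathcal{P}$, seen from its generating point: its law is determined by $\mathbb{E}\sum_{\hat x\in\mathcal{P}}f(x,C^\rho(\hat x,\mathcal{P})-x)=\int_{\mathbb{R}^d}\mathbb{E}f(x,K^\rho_{\mathbf 0})\,dx$ for all nonnegative measurable $f$. In the Poisson case $K^\rho_{\mathbf 0}(\eta)$ has the law of $C^\rho((\mathbf 0,M_{\mathbf 0}),\eta)$, with $M_{\mathbf 0}\sim\mathbb{Q}_{\mathbb{M}}$ independent of $\eta$. It is understood that $\mathbb{E}\,h(K^\rho_{\mathbf 0})$ exists. Estimators. $W_\lambda:=[-\lambda^{1/d}/2,\lambda^{1/d}/2]^d$, $\hat W_\lambda:=W_\lambda\times\mathbb{M}$, $A\ominus B:=\{x\in\mathbb{R}^d:B+x\subseteq A\}$. For a marked point process $\mathcal{P}$, $$H^\rho_\lambda(\mathcal{P}):=\sum_{\hat x\in\mathcal{P}}\frac{h(C^\rho(\hat x,\mathcal{P}))}{\mathrm{Vol}(W_\lambda\ominus C^\rho(\hat x,\mathcal{P}))}\mathbf 1\{C^\rho(\hat x,\mathcal{P})\subseteq W_\lambda\},$$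 $$\hat H^\rho_\lambda(\mathcal{P}):=\sum_{\hat x\in\mathcal{P}}\frac{h(C^\rho(\hat x,\mathcal{P}))\mathbf 1\{C^\rho(\hat x,\mathcal{P})\subseteq W_\lambda\}}{\mathrm{Vol}(W_\lambda\ominus C^\rho(\hat x,\mathcal{P}))}\mathbf 1\{\mathrm{Vol}(W_\lambda\ominus C^\rho(\hat x,\mathcal{P}))\ge\lambda/2\},$$ and $H^\rho_\lambda(\mathcal{P}\cap\hat W_\lambda)$, $\hat H^\rho_\lambda(\mathcal{P}\cap\hat W_\lambda)$ are defined by the same formulas with the sum restricted to $\hat x\in\mathcal{P}\cap\hat W_\lambda$ (the cells are still those generated by the whole $\mathcal{P}$). Terms whose indicator vanishes, and terms with empty cell, are $0$. Score. $\xi^\rho(\hat x,\mathcal{A}):=h(C^\rho(\hat x,\mathcal{A}))\mathbf 1\{C^\rho(\hat x,\mathcal{A})\text{ is bounded}\}$, and $\xi^\rho(\hat x,\mathcal{A}):=\xi^\rho(\hat x,\mathcal{A}\cup\{\hat x\})$ if $\hat x\notin\mathcal{A}$. $p$-moment condition with respect to $\eta$: $\sup_{\hat x,\hat y\in\mathbb{R}^d\times\mathbb{M}}\mathbb{E}|\xi^\rho(\hat x,\eta\cup\{\hat y\})|^p<\infty$. Exponentially decaying diameter tail: there are a constant $c_{diam}\in(0,\infty)$ and an almost surely finite random variable $D$ with $C^\rho((\mathbf 0,M_{\mathbf 0}),\eta)\subseteq B_D(\mathbf 0)$ and $\mathbb{P}(D\ge t)\le c_{diam}\exp(-t^d/c_{diam})$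 for all $t\ge0$. Stabilizing with respect to $\eta$: for every $\hat x=(x,m_x)\in\eta$ there is an almost surely finite random variable $R_{\hat x}=R_{\hat x}(\eta)$ (radius of stabilization) such that $\xi^\rho(\hat x,(\eta\cup\mathcal{A})\cap\hat B_{R_{\hat x}}(x))=\xi^\rho(\hat x,\eta\cup\mathcal{A})$ for all $\mathcal{A}\subset\mathbb{R}^d\times\mathbb{M}$ with $\mathrm{card}(\mathcal{A})\le 7$. As usual for a Poisson process, statements about $\hat x\in\eta$ are read as statements about every fixed $\hat x\in\mathbb{R}^d\times\mathbb{M}$ added to $\eta$.
   Formalization: In (i), with K the typical cell of P, equality is claimed only if a.s. Vol(W_λ⊖K)>0 whenever h(K)≠0; for every λ>0 one has E H_λ(P)=E[h(K)1{Vol(W_λ⊖K)>0}], since cells too large for W_λ are never counted (e.g. d=1, Poisson-Voronoi, h=length of bounded cells). *)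

theory Defs
  imports "HOL-Probability.Probability"
begin

section \<open>Random closed sets and point configurations\<close>

text \<open>Closed sets (the empty set included) with the Borel \<open>\<sigma>\<close>-algebra of the Fell topology,
  which is generated by the sets of all closed sets hitting a given compact set.\<close>

definition closed_sets_space :: "'a::topological_space set measure" where
  "closed_sets_space =
     sigma {F. closed F} {{F. closed F \<and> F \<inter> K \<noteq> {}} | K. compact K}"

definition configurations :: "'a::metric_space set \<Rightarrow> 'a set set" where
  "configurations E = {A. A \<subseteq> E \<and> (\<forall>B. bounded B \<longrightarrow> finite (A \<inter> B))}"

text \<open>Only the \<open>\<sigma>\<close>-algebra of the argument \<open>S\<close> matters here.\<close>

definition config_space :: "'a::metric_space measure \<Rightarrow> 'a set measure" where
  "config_space S =
     sigma (configurations (space S))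
       {{A \<in> configurations (space S). card (A \<inter> B) = n} | B n. B \<in> sets S \<and> bounded B}"

definition mark_law :: "real \<Rightarrow> real measure \<Rightarrow> bool" where
  "mark_law \<mu> Q \<longleftrightarrow> prob_space Q \<and> sets Q = sets (restrict_space borel {0..\<mu>})"

text \<open>A marked point process is a random element of \<open>config_space (borel \<Otimes>\<^sub>M Q)\<close>; for a mark law \<open>Q\<close>
  on \<open>[0, \<mu>]\<close> the underlying space is \<open>UNIV \<times> {0..\<mu>}\<close>.  Its unmarked process
  is the image under \<^const>\<open>fst\<close>.\<close>

definition unmarked :: "('w \<Rightarrow> ('a \<times> real) set) \<Rightarrow> 'w \<Rightarrow> 'a set" where
  "unmarked P \<omega> = fst ` P \<omega>"

definition stationary :: "'w measure \<Rightarrow> ('w \<Rightarrow> 'a::euclidean_space set) \<Rightarrow> bool" where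
  "stationary M \<Phi> \<longleftrightarrow>
     (\<forall>z. distr M (config_space borel) (\<lambda>\<omega>. (\<lambda>x. x + z) ` \<Phi> \<omega>)
        = distr M (config_space borel) \<Phi>)"

definition unit_intensity :: "'w measure \<Rightarrow> ('w \<Rightarrow> 'a::euclidean_space set) \<Rightarrow> bool" where
  "unit_intensity M \<Phi> \<longleftrightarrow> (\<integral>\<^sup>+\<omega>. of_nat (card (\<Phi> \<omega> \<inter> cbox 0 One)) \<partial>M) = 1"

definition measurable_enumeration :: "(nat \<Rightarrow> 'a::euclidean_space set \<Rightarrow> 'a) \<Rightarrow> bool" where
  "measurable_enumeration e \<longleftrightarrow>
     (\<forall>i. e i \<in> config_space borel \<rightarrow>\<^sub>M borel) \<and>
     (\<forall>A \<in> configurations UNIV. bij_betw (\<lambda>i. e i A) {i. finite A \<longrightarrow> i < card A} A)"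

text \<open>The marks, listed along an enumeration of the points that depends on the unmarked process
  only, are i.i.d. with law \<open>Q\<close> and independent of the unmarked process.  As there are only as many
  marks as points, the joint law of the first \<open>k\<close> marks is prescribed on the event
  that there are at least \<open>k\<close> points.\<close>

definition independently_marked ::
    "'w measure \<Rightarrow> real measure \<Rightarrow> ('w \<Rightarrow> ('a::euclidean_space \<times> real) set) \<Rightarrow> bool" where
  "independently_marked M Q P \<longleftrightarrow>
     (AE \<omega> in M. inj_on fst (P \<omega>)) \<and>
     (\<exists>e. measurable_enumeration e \<and>
       (\<forall>k. \<forall>\<A> \<in> sets (config_space borel). \<forall>B. (\<forall>i<k. B i \<in> sets Q) \<longrightarrow>
          measure M {\<omega> \<in> space M. unmarked P \<omega> \<in> \<A>
              \<and> (finite (unmarked P \<omega>) \<longrightarrow> k \<le> card (unmarked P \<omega>))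
              \<and> (\<forall>i<k. \<exists>m \<in> B i. (e i (unmarked P \<omega>), m) \<in> P \<omega>)}
          = measure M {\<omega> \<in> space M. unmarked P \<omega> \<in> \<A>
              \<and> (finite (unmarked P \<omega>) \<longrightarrow> k \<le> card (unmarked P \<omega>))}
            * (\<Prod>i<k. measure Q (B i))))"

definition poisson_process ::
    "'w measure \<Rightarrow> 'a::metric_space measure \<Rightarrow> ('w \<Rightarrow> 'a set) \<Rightarrow> bool" where
  "poisson_process M \<Lambda> \<eta> \<longleftrightarrow>
     \<eta> \<in> M \<rightarrow>\<^sub>M config_space \<Lambda> \<and>
     (\<forall>B \<in> sets \<Lambda>. bounded B \<longrightarrow>
        (\<forall>n. measure M {\<omega> \<in> space M. card (\<eta> \<omega> \<inter> B) = n}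
             = measure \<Lambda> B ^ n / fact n * exp (- measure \<Lambda> B))) \<and>
     (\<forall>k (B :: nat \<Rightarrow> 'a set).
        (\<forall>i<k. B i \<in> sets \<Lambda> \<and> bounded (B i)) \<and> disjoint_family_on B {..<k} \<longrightarrow>
        prob_space.indep_vars M (\<lambda>_. count_space UNIV) (\<lambda>i \<omega>. card (\<eta> \<omega> \<inter> B i)) {..<k})"


section \<open>Cells\<close>

definition weight_function ::
    "real \<Rightarrow> (real ^ 'd \<Rightarrow> (real ^ 'd) \<times> real \<Rightarrow> real) \<Rightarrow> bool" where
  "weight_function \<mu> \<rho> \<longleftrightarrow>
     (\<lambda>(y, x). \<rho> y x) \<in> borel_measurable (borel \<Otimes>\<^sub>M (borel \<Otimes>\<^sub>M restrict_space borel {0..\<mu>})) \<and>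
     (\<forall>x \<in> UNIV \<times> {0..\<mu>}. continuous_on UNIV (\<lambda>y. \<rho> y x)) \<and>
     (\<forall>y x z. \<forall>m \<in> {0..\<mu>}. \<rho> (y + z) (x + z, m) = \<rho> y (x, m))"

definition cell ::
    "(real ^ 'd \<Rightarrow> (real ^ 'd) \<times> real \<Rightarrow> real) \<Rightarrow> (real ^ 'd) \<times> real
      \<Rightarrow> ((real ^ 'd) \<times> real) set \<Rightarrow> (real ^ 'd) set" where
  "cell \<rho> x A = {y. \<forall>z \<in> A. \<rho> y x \<le> \<rho> y z}"

text \<open>\<open>\<kappa>\<close> is the law of the typical cell of the tessellation generated by \<open>P\<close>.\<close>

definition typical_cell_law ::
    "'w measure \<Rightarrow> (real ^ 'd \<Rightarrow> (real ^ 'd) \<times> real \<Rightarrow> real)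
      \<Rightarrow> ('w \<Rightarrow> ((real ^ 'd) \<times> real) set) \<Rightarrow> (real ^ 'd) set measure \<Rightarrow> bool" where
  "typical_cell_law M \<rho> P \<kappa> \<longleftrightarrow>
     prob_space \<kappa> \<and> sets \<kappa> = sets closed_sets_space \<and>
     (\<forall>f :: (real ^ 'd) \<times> (real ^ 'd) set \<Rightarrow> ennreal.
        f \<in> borel_measurable (borel \<Otimes>\<^sub>M closed_sets_space) \<longrightarrow>
        (\<integral>\<^sup>+\<omega>. (\<Sum>\<^sub>\<infinity>x \<in> P \<omega>. f (fst x, (\<lambda>y. y - fst x) ` cell \<rho> x (P \<omega>))) \<partial>M)
        = (\<integral>\<^sup>+x. (\<integral>\<^sup>+K. f (x, K) \<partial>\<kappa>) \<partial>lborel))"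


section \<open>Estimators\<close>

definition window :: "real \<Rightarrow> (real ^ 'd) set" where
  "window L = {x. \<forall>i. \<bar>x $ i\<bar> \<le> L powr (1 / real CARD('d)) / 2}"

definition marked_window :: "real \<Rightarrow> real \<Rightarrow> ((real ^ 'd) \<times> real) set" where
  "marked_window \<mu> L = window L \<times> {0..\<mu>}"

definition erosion :: "'a::plus set \<Rightarrow> 'a set \<Rightarrow> 'a set" where
  "erosion A B = {x. (\<lambda>y. y + x) ` B \<subseteq> A}"

text \<open>The set \<open>S\<close> of points summed over is kept separate from the configuration \<open>A\<close> that generates
  the cells: \<open>H\<^sub>\<lambda>(P)\<close> is the case \<open>S = A = P\<close>, and \<open>H\<^sub>\<lambda>(P \<inter> W)\<close> for the marked window
  \<open>W\<close> is the case \<open>S = P \<inter> W\<close>, \<open>A = P\<close>.  Terms with an empty cell vanish when \<open>h {} = 0\<close>.\<close>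

definition H_est ::
    "(real ^ 'd \<Rightarrow> (real ^ 'd) \<times> real \<Rightarrow> real) \<Rightarrow> ((real ^ 'd) set \<Rightarrow> real) \<Rightarrow> real
      \<Rightarrow> ((real ^ 'd) \<times> real) set \<Rightarrow> ((real ^ 'd) \<times> real) set \<Rightarrow> real" where
  "H_est \<rho> h L S A =
     (\<Sum>\<^sub>\<infinity>x \<in> S. if cell \<rho> x A \<subseteq> window L
        then h (cell \<rho> x A) / measure lborel (erosion (window L) (cell \<rho> x A)) else 0)"

definition H_hat_est ::
    "(real ^ 'd \<Rightarrow> (real ^ 'd) \<times> real \<Rightarrow> real) \<Rightarrow> ((real ^ 'd) set \<Rightarrow> real) \<Rightarrow> real
      \<Rightarrow> ((real ^ 'd) \<times> real) set \<Rightarrow> ((real ^ 'd) \<times> real) set \<Rightarrow> real" where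
  "H_hat_est \<rho> h L S A =
     (\<Sum>\<^sub>\<infinity>x \<in> S. if cell \<rho> x A \<subseteq> window L
          \<and> measure lborel (erosion (window L) (cell \<rho> x A)) \<ge> L / 2
        then h (cell \<rho> x A) / measure lborel (erosion (window L) (cell \<rho> x A)) else 0)"


section \<open>Scores and conditions on them\<close>

definition score ::
    "(real ^ 'd \<Rightarrow> (real ^ 'd) \<times> real \<Rightarrow> real) \<Rightarrow> ((real ^ 'd) set \<Rightarrow> real)
      \<Rightarrow> (real ^ 'd) \<times> real \<Rightarrow> ((real ^ 'd) \<times> real) set \<Rightarrow> real" where
  "score \<rho> h x A =
     (if bounded (cell \<rho> x (insert x A)) then h (cell \<rho> x (insert x A)) else 0)"

definition moment_condition ::
    "'w measure \<Rightarrow> real \<Rightarrow> (real ^ 'd \<Rightarrow> (real ^ 'd) \<times> real \<Rightarrow> real) \<Rightarrow> ((real ^ 'd) set \<Rightarrow> real)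
      \<Rightarrow> ('w \<Rightarrow> ((real ^ 'd) \<times> real) set) \<Rightarrow> real \<Rightarrow> bool" where
  "moment_condition M \<mu> \<rho> h \<eta> p \<longleftrightarrow>
     (SUP x \<in> UNIV \<times> {0..\<mu>}. SUP y \<in> UNIV \<times> {0..\<mu>}.
        \<integral>\<^sup>+\<omega>. ennreal (\<bar>score \<rho> h x (insert y (\<eta> \<omega>))\<bar> powr p) \<partial>M) < \<infinity>"

definition exp_diameter_tail ::
    "'w measure \<Rightarrow> (real ^ 'd \<Rightarrow> (real ^ 'd) \<times> real \<Rightarrow> real)
      \<Rightarrow> ('w \<Rightarrow> ((real ^ 'd) \<times> real) set) \<Rightarrow> ('w \<Rightarrow> real) \<Rightarrow> bool" where
  "exp_diameter_tail M \<rho> \<eta> M0 \<longleftrightarrow>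
     (\<exists>c>0. \<exists>D \<in> borel_measurable M.
        (AE \<omega> in M. cell \<rho> (0, M0 \<omega>) (\<eta> \<omega>) \<subseteq> cball 0 (D \<omega>)) \<and>
        (\<forall>t\<ge>0. measure M {\<omega> \<in> space M. t \<le> D \<omega>} \<le> c * exp (- (t ^ CARD('d)) / c)))"

text \<open>The explicit \<^const>\<open>finite\<close> is needed because \<^const>\<open>card\<close> is \<open>0\<close> on infinite sets.\<close>

definition stabilizing ::
    "'w measure \<Rightarrow> real \<Rightarrow> (real ^ 'd \<Rightarrow> (real ^ 'd) \<times> real \<Rightarrow> real) \<Rightarrow> ((real ^ 'd) set \<Rightarrow> real)
      \<Rightarrow> ('w \<Rightarrow> ((real ^ 'd) \<times> real) set) \<Rightarrow> bool" where
  "stabilizing M \<mu> \<rho> h \<eta> \<longleftrightarrow>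
     (\<forall>x \<in> UNIV \<times> {0..\<mu>}. \<exists>R \<in> borel_measurable M. AE \<omega> in M. 0 \<le> R \<omega> \<and>
        (\<forall>A. A \<subseteq> UNIV \<times> {0..\<mu>} \<and> finite A \<and> card A \<le> 7 \<longrightarrow>
           score \<rho> h x ((\<eta> \<omega> \<union> A) \<inter> (cball (fst x) (R \<omega>) \<times> {0..\<mu>}))
           = score \<rho> h x (\<eta> \<omega> \<union> A)))"


section \<open>Modes of convergence of estimators\<close>

definition asymptotically_unbiased ::
    "'w measure \<Rightarrow> (real \<Rightarrow> 'w \<Rightarrow> real) \<Rightarrow> real \<Rightarrow> bool" where
  "asymptotically_unbiased M X c \<longleftrightarrow>
     (\<forall>L>0. integrable M (X L)) \<and> ((\<lambda>L. \<integral>\<omega>. X L \<omega> \<partial>M) \<longlongrightarrow> c) at_top"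

definition weakly_consistent ::
    "'w measure \<Rightarrow> (real \<Rightarrow> 'w \<Rightarrow> real) \<Rightarrow> real \<Rightarrow> bool" where
  "weakly_consistent M X c \<longleftrightarrow>
     (\<forall>L>0. X L \<in> borel_measurable M) \<and>
     (\<forall>\<epsilon>>0. ((\<lambda>L. measure M {\<omega> \<in> space M. \<epsilon> < \<bar>X L \<omega> - c\<bar>}) \<longlongrightarrow> 0) at_top)"

end

theory Submission
  imports Defs
begin

text \<open>By Campbell's formula for the typical cell, a sum over the points \<open>x\<close> of \<open>h\<close> of the
  centred cell times a weight \<open>u(x, K)\<close> has expectation \<open>\<integral>h(K) \<integral>u(x, K) dx \<kappa>(dK)\<close>; for the
  weight of the estimator the inner integral is \<open>1\<close>, which gives unbiasedness.  In the Poisson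
  case the estimators are compared in \<open>L\<^sup>1\<close> with the average over the window of the spatial shifts of
  the sum over the points in a unit cube.  This average is again a weighted sum, and the two weights
  become close in \<open>L\<^sup>1(dx)\<close> for every bounded \<open>K\<close>; that the typical cell is bounded follows from the
  Mecke formula and the tail condition.  The averages themselves converge in \<open>L\<^sup>1\<close> by the ergodic
  theorem for the Poisson process: it is a variance bound for the events that a bounded set
  contains no point, and these form a generating \<open>\<pi>\<close>-system.  The resulting \<open>L\<^sup>1\<close> convergence of
  the estimators gives both asymptotic unbiasedness and consistency.\<close>

section \<open>Configurations\<close>

text \<open>The typical cell is known only through Campbell's formula, whereas the tail condition
  speaks of the cell of a point placed at the origin. The Mecke formula bridges the two; it is
  applied to the event that a cell is unbounded, so indicators and a bounded region suffice. The
  weights of the estimators depend on the cell, so the estimators are not ergodic averages. The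
  window means of the unit cube sum are, and Fubini turns them into sums with a weight that depends
  on the position only. For a fixed bounded nonempty cell both weights are close to the uniform
  density on the window. The variance bound concerns events of finite range. It reaches every
  integrable function because averaging over shifts that preserve the law is a contraction in L^1,
  which makes mean ergodicity a closed linear condition; hence all comparisons take place in L^1.
  The weight of the estimator has mass one only for cells that fit into the window for a set of
  translations of positive volume. For a fixed window the expectation is restricted to these cells;
  as the window grows, every bounded nonempty cell becomes one.\<close>

definition void :: "'a::metric_space measure \<Rightarrow> 'a set \<Rightarrow> 'a set set" where
  "void S V = {A \<in> configurations (space S). A \<inter> V = {}}"

definition voids :: "'a::metric_space measure \<Rightarrow> 'a set set set" where
  "voids S = {void S V | V. V \<in> sets S \<and> bounded V}"

lemma space_config_space: "space (config_space S) = configurations (space S)"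
  unfolding config_space_def by (rule space_measure_of) auto

lemma sets_config_space:
  "sets (config_space S) = sigma_sets (configurations (space S))
     {{A \<in> configurations (space S). card (A \<inter> B) = n} | B n. B \<in> sets S \<and> bounded B}"
  unfolding config_space_def by (rule sets_measure_of) auto

lemma config_finite: "A \<in> configurations E \<Longrightarrow> bounded B \<Longrightarrow> finite (A \<inter> B)"
  by (simp add: configurations_def)

lemma config_subset: "A \<in> configurations E \<Longrightarrow> A \<subseteq> E"
  by (simp add: configurations_def)

lemma config_countable:
  fixes A :: "'a::metric_space set"
  assumes "A \<in> configurations E"
  shows "countable A"
proof -
  fix x0 :: 'a
  have "A = (\<Union>n::nat. A \<inter> cball x0 (real n))"
  proof (rule set_eqI)
    fix x
    obtain n :: nat where "dist x0 x \<le> real n" using real_arch_simple by blast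
    then show "x \<in> A \<longleftrightarrow> x \<in> (\<Union>n::nat. A \<inter> cball x0 (real n))" by auto
  qed
  moreover have "countable (\<Union>n::nat. A \<inter> cball x0 (real n))"
    by (rule countable_UN) (auto intro!: countable_finite config_finite[OF assms])
  ultimately show ?thesis by simp
qed

lemma voids_subset: "voids S \<subseteq> Pow (configurations (space S))"
  by (auto simp: voids_def void_def)

text \<open>Two regions are free of points exactly when their union is. Void events thus form a
  pi-system, on which laws can be compared and from which ergodicity is extended.\<close>

lemma Int_stable_voids: "Int_stable (voids S)"
proof (rule Int_stableI)
  fix a b assume "a \<in> voids S" "b \<in> voids S"
  then obtain V W where "a = void S V" "b = void S W" and VW: "V \<in> sets S" "W \<in> sets S" "bounded V" "bounded W"
    by (auto simp: voids_def)
  then have "a \<inter> b = void S (V \<union> W)" by (auto simp: void_def)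
  with VW show "a \<inter> b \<in> voids S"
    unfolding voids_def by (intro CollectI exI[of _ "V \<union> W"]) auto
qed

lemma void_in_config_space:
  assumes "V \<in> sets S" "bounded V"
  shows "void S V \<in> sets (config_space S)"
proof -
  \<comment> \<open>\<open>card\<close> is also 0 on infinite sets; local finiteness on the bounded
    set \<open>V\<close> rules this out.\<close>
  have "void S V = {A \<in> configurations (space S). card (A \<inter> V) = 0}"
    using config_finite[OF _ assms(2)] by (auto simp: void_def)
  then show ?thesis unfolding sets_config_space using assms by blast
qed

text \<open>Finitely many points of a Hausdorff space have pairwise disjoint neighbourhoods, which
  can be shrunk to members of the base; conversely, one point chosen from each of \<open>n\<close>
  disjoint sets gives an injection. With a countable base the right side becomes a countable
  combination of hitting events, which is how counts are expressed through voids.\<close>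

lemma card_ge_iff_separated:
  assumes B: "topological_basis \<B>" and F: "finite (F :: 'a::t2_space set)"
  shows "n \<le> card F \<longleftrightarrow>
    (\<exists>\<U>. \<U> \<subseteq> \<B> \<and> finite \<U> \<and> card \<U> = n \<and> disjoint \<U> \<and> (\<forall>U\<in>\<U>. F \<inter> U \<noteq> {}))"
proof
  assume "n \<le> card F"
  then obtain G where G: "G \<subseteq> F" "card G = n" "finite G"
    using F by (meson obtain_subset_with_card_n)
  have "\<exists>w. \<forall>x\<in>G. open (w x) \<and> x \<in> w x \<and> (\<forall>y\<in>G. x \<noteq> y \<longrightarrow> w x \<inter> w y = {})"
  proof -
    have "\<forall>p :: 'a \<times> 'a. \<exists>q. fst p \<noteq> snd p \<longrightarrow>
        open (fst q) \<and> open (snd q) \<and> fst p \<in> fst q \<and> snd p \<in> snd q \<and> fst q \<inter> snd q = {}"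
    proof
      fix p :: "'a \<times> 'a"
      show "\<exists>q. fst p \<noteq> snd p \<longrightarrow>
        open (fst q) \<and> open (snd q) \<and> fst p \<in> fst q \<and> snd p \<in> snd q \<and> fst q \<inter> snd q = {}"
        using hausdorff[of "fst p" "snd p"] by (cases "fst p = snd p") auto
    qed
    from choice[OF this] obtain q where q: "\<And>x y :: 'a. x \<noteq> y \<Longrightarrow>
        open (fst (q (x, y))) \<and> open (snd (q (x, y))) \<and> x \<in> fst (q (x, y)) \<and> y \<in> snd (q (x, y)) \<and>
        fst (q (x, y)) \<inter> snd (q (x, y)) = {}" by (metis fst_conv snd_conv)
    define u v where "u x y = fst (q (x, y))" and "v x y = snd (q (x, y))" for x y
    have uv: "open (u x y) \<and> open (v x y) \<and> x \<in> u x y \<and> y \<in> v x y \<and> u x y \<inter> v x y = {}"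
      if "x \<noteq> y" for x y :: 'a using q[OF that] by (simp add: u_def v_def)
    \<comment> \<open>Both \<open>u x y\<close> and \<open>v y x\<close> contain \<open>x\<close>.
      Intersecting the two kinds over all other points puts \<open>w x\<close> into
      \<open>u x y\<close> and \<open>w y\<close> into \<open>v x y\<close> for either order of a
      pair, and these sets are disjoint.\<close>
    define w where "w x = (\<Inter>y\<in>G-{x}. u x y \<inter> v y x)" for x
    have "open (w x) \<and> x \<in> w x \<and> (\<forall>y\<in>G. x \<noteq> y \<longrightarrow> w x \<inter> w y = {})" if "x \<in> G" for x
    proof (intro conjI ballI impI)
      show "open (w x)" unfolding w_def using uv G(3) by (intro open_INT open_Int ballI) auto
      have "x \<in> u x y \<inter> v y x" if "y \<in> G - {x}" for y
        using uv[of x y] uv[of y x] that by auto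
      then show "x \<in> w x" unfolding w_def by blast
      fix y assume "y \<in> G" "x \<noteq> y"
      then have "w x \<subseteq> u x y" "w y \<subseteq> v x y" using that by (auto simp: w_def)
      then show "w x \<inter> w y = {}" using uv[OF \<open>x \<noteq> y\<close>] by blast
    qed
    then show ?thesis by blast
  qed
  then obtain w where w: "\<And>x. x \<in> G \<Longrightarrow> open (w x)" "\<And>x. x \<in> G \<Longrightarrow> x \<in> w x"
      "\<And>x y. x \<in> G \<Longrightarrow> y \<in> G \<Longrightarrow> x \<noteq> y \<Longrightarrow> w x \<inter> w y = {}" by blast
  have "\<exists>U. U \<in> \<B> \<and> x \<in> U \<and> U \<subseteq> w x" if "x \<in> G" for x
    using topological_basisE[OF B w(1)[OF that] w(2)[OF that]] by metis
  then obtain U where U: "\<And>x. x \<in> G \<Longrightarrow> U x \<in> \<B> \<and> x \<in> U x \<and> U x \<subseteq> w x" by metis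
  have disj: "U x \<inter> U y = {}" if "x \<in> G" "y \<in> G" "x \<noteq> y" for x y
    using U w(3) that by blast
  have inj: "inj_on U G" using disj U by (metis disjoint_iff inj_onI)
  show "\<exists>\<U>. \<U> \<subseteq> \<B> \<and> finite \<U> \<and> card \<U> = n \<and> disjoint \<U> \<and> (\<forall>U\<in>\<U>. F \<inter> U \<noteq> {})"
  proof (intro exI[of _ "U ` G"] conjI)
    show "disjoint (U ` G)" using disj by (auto simp: disjoint_def)
    show "card (U ` G) = n" using inj G by (simp add: card_image)
  qed (use U G in auto)
next
  assume "\<exists>\<U>. \<U> \<subseteq> \<B> \<and> finite \<U> \<and> card \<U> = n \<and> disjoint \<U> \<and> (\<forall>U\<in>\<U>. F \<inter> U \<noteq> {})"
  then obtain \<U> where \<U>: "finite \<U>" "card \<U> = n" "disjoint \<U>" "\<forall>U\<in>\<U>. F \<inter> U \<noteq> {}" by blast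
  then have "\<forall>U\<in>\<U>. \<exists>y. y \<in> F \<inter> U" by blast
  from bchoice[OF this] obtain p where p: "\<And>U. U \<in> \<U> \<Longrightarrow> p U \<in> F \<inter> U" by blast
  have "inj_on p \<U>"
  proof (rule inj_onI, rule ccontr)
    fix U V assume UV: "U \<in> \<U>" "V \<in> \<U>" "p U = p V" "U \<noteq> V"
    then have "U \<inter> V = {}" using \<U>(3) by (auto simp: disjoint_def)
    then show False using p[OF UV(1)] p[OF UV(2)] UV(3) by auto
  qed
  moreover have "p ` \<U> \<subseteq> F" using p by auto
  ultimately show "n \<le> card F" using \<U>(2) F by (metis card_image card_mono)
qed

text \<open>Configurations are sets, so a finite configuration has at least \<open>n\<close> points iff it hits \<open>n\<close>
  disjoint members of a countable base; hence the events that a bounded set contains no point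
  generate everything.\<close>

lemma sets_config_space_voids:
  fixes S :: "'a::{metric_space, second_countable_topology} measure"
  assumes op: "\<And>U. open U \<Longrightarrow> U \<inter> space S \<in> sets S"
  shows "sets (config_space S) = sigma_sets (configurations (space S)) (voids S)"
proof
  let ?C = "configurations (space S)"
  show "sigma_sets ?C (voids S) \<subseteq> sets (config_space S)"
  proof (rule sets.sigma_sets_subset[of "voids S" "config_space S", unfolded space_config_space])
    show "voids S \<subseteq> sets (config_space S)" using void_in_config_space by (auto simp: voids_def)
  qed
  interpret V: sigma_algebra ?C "sigma_sets ?C (voids S)"
    by (rule sigma_algebra_sigma_sets[OF voids_subset])
  obtain \<B> :: "'a set set" where \<B>: "countable \<B>" "topological_basis \<B>"
    using ex_countable_basis by blast
  have ge: "{A \<in> ?C. n \<le> card (A \<inter> B)} \<in> sigma_sets ?C (voids S)" if B: "B \<in> sets S" "bounded B" for B n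
  proof -
    let ?I = "{\<U>. \<U> \<subseteq> \<B> \<and> finite \<U> \<and> card \<U> = n \<and> disjoint \<U>}"
    have "{A \<in> ?C. n \<le> card (A \<inter> B)} = {A \<in> ?C. \<exists>\<U>\<in>?I. \<forall>U\<in>\<U>. A \<inter> (B \<inter> U) \<noteq> {}}"
    proof (rule Collect_cong, rule conj_cong[OF refl])
      fix A assume "A \<in> ?C"
      then have "finite (A \<inter> B)" by (rule config_finite[OF _ B(2)])
      from card_ge_iff_separated[OF \<B>(2) this, of n]
      show "n \<le> card (A \<inter> B) \<longleftrightarrow> (\<exists>\<U>\<in>?I. \<forall>U\<in>\<U>. A \<inter> (B \<inter> U) \<noteq> {})"
        by (simp add: Int_assoc Bex_def conj_assoc)
    qed
    \<comment> \<open>For \<open>n = 0\<close> the only family is empty and its intersection is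
      \<open>UNIV\<close>; the explicit factor \<open>?C\<close> keeps the set inside the
      space.\<close>
    also have "\<dots> = (\<Union>\<U>\<in>?I. ?C \<inter> (\<Inter>U\<in>\<U>. ?C - void S (B \<inter> U)))"
    proof (rule set_eqI)
      fix A
      have "A \<in> (\<Inter>U\<in>\<U>. ?C - void S (B \<inter> U)) \<longleftrightarrow> (\<forall>U\<in>\<U>. A \<inter> (B \<inter> U) \<noteq> {})" if "A \<in> ?C" for \<U>
        using that by (simp add: void_def)
      then show "A \<in> {A \<in> ?C. \<exists>\<U>\<in>?I. \<forall>U\<in>\<U>. A \<inter> (B \<inter> U) \<noteq> {}}
        \<longleftrightarrow> A \<in> (\<Union>\<U>\<in>?I. ?C \<inter> (\<Inter>U\<in>\<U>. ?C - void S (B \<inter> U)))"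
        by (cases "A \<in> ?C") (simp_all only: mem_Collect_eq UN_iff Int_iff simp_thms bex_simps, blast?)
    qed
    also have "\<dots> \<in> sigma_sets ?C (voids S)"
    proof (rule V.countable_UN')
      show "countable ?I"
        by (rule countable_subset[OF _ countable_Collect_finite_subset[OF \<B>(1)]]) auto
      show "(\<lambda>\<U>. ?C \<inter> (\<Inter>U\<in>\<U>. ?C - void S (B \<inter> U))) ` ?I \<subseteq> sigma_sets ?C (voids S)"
      proof clarify
        fix \<U> assume \<U>: "\<U> \<subseteq> \<B>" "finite \<U>"
        have U: "?C - void S (B \<inter> U) \<in> sigma_sets ?C (voids S)" if "U \<in> \<U>" for U
        proof -
          have "open U" using that \<U> \<B>(2) topological_basis_open by blast
          have "B \<inter> U = B \<inter> (U \<inter> space S)" using sets.sets_into_space[OF B(1)] by blast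
          then have "B \<inter> U \<in> sets S"
            using sets.Int[OF B(1) op[OF \<open>open U\<close>]] by simp
          moreover have "bounded (B \<inter> U)" using B(2) by auto
          ultimately have "void S (B \<inter> U) \<in> voids S" unfolding voids_def by blast
          then show ?thesis by (intro V.compl_sets sigma_sets.Basic)
        qed
        show "?C \<inter> (\<Inter>U\<in>\<U>. ?C - void S (B \<inter> U)) \<in> sigma_sets ?C (voids S)"
        proof (cases "\<U> = {}")
          case False
          then have "(\<Inter>U\<in>\<U>. ?C - void S (B \<inter> U)) \<in> sigma_sets ?C (voids S)"
            using U \<U>(2) by (intro V.finite_INT) auto
          then show ?thesis by (intro V.Int V.top)
        qed (use V.top in simp)
      qed
    qed
    finally show ?thesis .
  qed
  show "sets (config_space S) \<subseteq> sigma_sets ?C (voids S)"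
    unfolding sets_config_space
  proof (rule V.sigma_sets_subset, clarify)
    fix B n assume B: "B \<in> sets S" "bounded B"
    have "{A \<in> ?C. card (A \<inter> B) = n} = {A \<in> ?C. n \<le> card (A \<inter> B)} - {A \<in> ?C. Suc n \<le> card (A \<inter> B)}"
      by auto
    also have "\<dots> \<in> sigma_sets ?C (voids S)" using ge[OF B] by (intro V.Diff)
    finally show "{A \<in> ?C. card (A \<inter> B) = n} \<in> sigma_sets ?C (voids S)" .
  qed
qed

text \<open>Measurability is tested on the generating void events, so that maps such as shifting a
  configuration or inserting a point can be treated without counting.\<close>

lemma measurable_config_spaceI:
  fixes S :: "'a::{metric_space, second_countable_topology} measure"
  assumes op: "\<And>U. open U \<Longrightarrow> U \<inter> space S \<in> sets S"
    and f: "\<And>t. t \<in> space T \<Longrightarrow> f t \<in> configurations (space S)"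
    and v: "\<And>V. V \<in> sets S \<Longrightarrow> bounded V \<Longrightarrow> {t \<in> space T. f t \<inter> V = {}} \<in> sets T"
  shows "f \<in> T \<rightarrow>\<^sub>M config_space S"
proof (rule measurable_sigma_sets[OF sets_config_space_voids[OF op] voids_subset])
  show "f \<in> space T \<rightarrow> configurations (space S)" using f by auto
  fix y assume "y \<in> voids S"
  then obtain V where V: "y = void S V" "V \<in> sets S" "bounded V" by (auto simp: voids_def)
  then have "f -` y \<inter> space T = {t \<in> space T. f t \<inter> V = {}}" using f by (auto simp: void_def)
  then show "f -` y \<inter> space T \<in> sets T" using v V by simp
qed auto

lemma measurable_card_config:
  assumes "a \<in> T \<rightarrow>\<^sub>M config_space S" "B \<in> sets S" "bounded B"
  shows "(\<lambda>t. card (a t \<inter> B)) \<in> T \<rightarrow>\<^sub>M count_space UNIV"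
proof (rule measurable_count_space_eq_countable[THEN iffD2, OF _ conjI])
  show "\<forall>n\<in>UNIV. (\<lambda>t. card (a t \<inter> B)) -` {n} \<inter> space T \<in> sets T"
  proof
    fix n
    have "(\<lambda>t. card (a t \<inter> B)) -` {n} \<inter> space T
        = a -` {A \<in> configurations (space S). card (A \<inter> B) = n} \<inter> space T"
      using measurable_space[OF assms(1)] by (auto simp: space_config_space)
    moreover have "{A \<in> configurations (space S). card (A \<inter> B) = n} \<in> sets (config_space S)"
      unfolding sets_config_space using assms(2,3) by blast
    ultimately show "(\<lambda>t. card (a t \<inter> B)) -` {n} \<inter> space T \<in> sets T"
      using measurable_sets[OF assms(1), of "{A \<in> configurations (space S). card (A \<inter> B) = n}"] by (simp only:)
  qed
qed auto

section \<open>Sums over the points of a random configuration\<close>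

lemma nn_integral_count_space_indicator_bounded:
  assumes "A \<in> configurations E" "bounded B"
  shows "(\<integral>\<^sup>+x. indicator B x * (f x :: ennreal) \<partial>count_space A) = (\<Sum>x\<in>A \<inter> B. f x)"
proof -
  have "(\<integral>\<^sup>+x. indicator B x * f x \<partial>count_space A) = (\<Sum>x\<in>A \<inter> B. indicator B x * f x)"
    by (rule nn_integral_count_space') (use config_finite[OF assms] in \<open>auto simp: indicator_def\<close>)
  also have "\<dots> = (\<Sum>x\<in>A \<inter> B. f x)" by (rule sum.cong) (auto simp: indicator_def)
  finally show ?thesis .
qed

text \<open>A monotone class argument, carried out for the sum truncated to the balls
  \<open>B n\<close>: there it has finitely many terms, so that complements can be handled by
  subtraction. Monotone convergence removes the truncation at the end.\<close>

lemma measurable_nn_integral_config: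
  fixes S :: "'a::metric_space measure"
  assumes ball: "\<And>n::nat. cball x0 (real n) \<inter> space S \<in> sets S"
    and a: "a \<in> T \<rightarrow>\<^sub>M config_space S"
    and F: "(\<lambda>(x, t). F x t) \<in> borel_measurable (S \<Otimes>\<^sub>M T)"
  shows "(\<lambda>t. \<integral>\<^sup>+x. F x t \<partial>count_space (a t)) \<in> borel_measurable T"
proof -
  have conf: "t \<in> space T \<Longrightarrow> a t \<in> configurations (space S)" for t
    using measurable_space[OF a] by (simp add: space_config_space)
  define B where "B n = cball x0 (real n) \<inter> space S" for n :: nat
  have Bm [measurable]: "B n \<in> sets S" and Bb: "bounded (B n)" for n
    using ball by (auto simp: B_def)
  have Binc: "incseq B" by (auto simp: B_def incseq_def)
  have ind: "(\<lambda>t. \<integral>\<^sup>+x. indicator (B n) x * indicator E (x, t) \<partial>count_space (a t)) \<in> borel_measurable T"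
    if "E \<in> sets (S \<Otimes>\<^sub>M T)" for E n
  proof -
    have "E \<in> sigma_sets (space S \<times> space T) {a \<times> b |a b. a \<in> sets S \<and> b \<in> sets T}"
      using that by (simp add: sets_pair_measure)
    with Int_stable_pair_measure_generator pair_measure_closed show ?thesis
    proof (induct rule: sigma_sets_induct_disjoint)
      case (basic E)
      then obtain X Y where XY: "E = X \<times> Y" "X \<in> sets S" "Y \<in> sets T" by blast
      have *: "(\<integral>\<^sup>+x. indicator (B n) x * indicator E (x, t) \<partial>count_space (a t))
          = of_nat (card (a t \<inter> (B n \<inter> X))) * indicator Y t" if "t \<in> space T" for t
      proof -
        have "(\<integral>\<^sup>+x. indicator (B n) x * indicator E (x, t) \<partial>count_space (a t))
          = (\<integral>\<^sup>+x. indicator (B n \<inter> X) x * indicator Y t \<partial>count_space (a t))"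
          by (rule nn_integral_cong) (auto simp: XY indicator_def)
        also have "\<dots> = (\<Sum>x\<in>a t \<inter> (B n \<inter> X). indicator Y t)"
          by (rule nn_integral_count_space_indicator_bounded[OF conf[OF that]]) (use Bb in auto)
        finally show ?thesis by simp
      qed
      have [measurable]: "(\<lambda>t. card (a t \<inter> (B n \<inter> X))) \<in> T \<rightarrow>\<^sub>M count_space UNIV"
        by (rule measurable_card_config[OF a]) (use XY Bb in auto)
      have "(\<lambda>t. of_nat (card (a t \<inter> (B n \<inter> X))) * indicator Y t :: ennreal) \<in> borel_measurable T"
        using XY by measurable
      then show ?case by (rule measurable_cong[THEN iffD1, rotated]) (simp add: *)
    next
      case (compl E)
      let ?s = "\<lambda>E t. \<integral>\<^sup>+x. indicator (B n) x * indicator E (x, t) \<partial>count_space (a t)"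
      let ?u = "\<lambda>t. of_nat (card (a t \<inter> B n)) :: ennreal"
      have *: "?s (space S \<times> space T - E) t = ?u t - ?s E t" if t: "t \<in> space T" for t
      proof -
        have fin: "finite (a t \<inter> B n)" by (rule config_finite[OF conf[OF t] Bb])
        have "?s (space S \<times> space T - E) t + ?s E t = ?u t"
          unfolding nn_integral_count_space_indicator_bounded[OF conf[OF t] Bb] sum.distrib[symmetric]
        proof -
          have "(\<Sum>x\<in>a t \<inter> B n. indicator (space S \<times> space T - E) (x, t) + indicator E (x, t))
            = (\<Sum>x\<in>a t \<inter> B n. 1 :: ennreal)"
            using t config_subset[OF conf[OF t]] by (intro sum.cong) (auto simp: indicator_def)
          then show "(\<Sum>x\<in>a t \<inter> B n. indicator (space S \<times> space T - E) (x, t) + indicator E (x, t))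
            = (of_nat (card (a t \<inter> B n)) :: ennreal)" by simp
        qed
        moreover have "?s E t \<noteq> \<infinity>"
          unfolding nn_integral_count_space_indicator_bounded[OF conf[OF t] Bb]
          using fin by (auto simp: indicator_def)
        ultimately show ?thesis
          using ennreal_add_diff_cancel_right[of "?s E t" "?s (space S \<times> space T - E) t"] by simp
      qed
      have [measurable]: "(\<lambda>t. card (a t \<inter> B n)) \<in> T \<rightarrow>\<^sub>M count_space UNIV"
        by (rule measurable_card_config[OF a]) (use Bb in auto)
      have "(\<lambda>t. ?u t - ?s E t) \<in> borel_measurable T" using compl by measurable
      then show ?case by (rule measurable_cong[THEN iffD1, rotated]) (simp add: *)
    next
      case (union E)
      have "(\<integral>\<^sup>+x. indicator (B n) x * indicator (\<Union>i. E i) (x, t) \<partial>count_space (a t))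
         = (\<Sum>i. \<integral>\<^sup>+x. indicator (B n) x * indicator (E i) (x, t) \<partial>count_space (a t))" for t
        by (subst nn_integral_suminf[symmetric])
          (auto intro!: nn_integral_cong simp: ennreal_suminf_cmult suminf_indicator[OF union(1)])
      then show ?case using union by simp
    qed simp
  qed
  have bd: "(\<lambda>t. \<integral>\<^sup>+x. indicator (B n) x * f (x, t) \<partial>count_space (a t)) \<in> borel_measurable T"
    if "f \<in> borel_measurable (S \<Otimes>\<^sub>M T)" for f :: "_ \<Rightarrow> ennreal" and n
    using that
  proof (induct rule: borel_measurable_induct)
    case (cong f g)
    have "(\<integral>\<^sup>+x. indicator (B n) x * f (x, t) \<partial>count_space (a t))
        = (\<integral>\<^sup>+x. indicator (B n) x * g (x, t) \<partial>count_space (a t))" if "t \<in> space T" for t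
    proof (rule nn_integral_cong)
      fix x assume "x \<in> space (count_space (a t))"
      then have "(x, t) \<in> space (S \<Otimes>\<^sub>M T)"
        using config_subset[OF conf[OF that]] that by (auto simp: space_pair_measure)
      then show "indicator (B n) x * f (x, t) = indicator (B n) x * g (x, t)"
        using cong(3) by simp
    qed
    then show ?case using cong(4) by (subst measurable_cong) auto
  next
    case (set E) then show ?case by (rule ind)
  next
    case (mult u c)
    have "(\<integral>\<^sup>+x. indicator (B n) x * (c * u (x, t)) \<partial>count_space (a t))
       = c * (\<integral>\<^sup>+x. indicator (B n) x * u (x, t) \<partial>count_space (a t))" for t
      by (subst nn_integral_cmult[symmetric]) (auto simp: ac_simps)
    then show ?case using mult by simp
  next
    case (add u v)
    then show ?case by (simp add: distrib_left nn_integral_add)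
  next
    case (seq U)
    have mono: "U i y \<le> U j y" if "i \<le> j" for i j y
      using seq(4) that by (cases y) (simp add: incseq_def le_fun_def)
    have "(\<integral>\<^sup>+x. indicator (B n) x * (SUP i. U i) (x, t) \<partial>count_space (a t))
       = (SUP i. \<integral>\<^sup>+x. indicator (B n) x * U i (x, t) \<partial>count_space (a t))" for t
      by (subst nn_integral_monotone_convergence_SUP[symmetric])
        (auto intro!: nn_integral_cong mult_left_mono mono simp: SUP_mult_left_ennreal[symmetric] incseq_def le_fun_def image_comp)
    then show ?case using seq by simp
  qed
  have "(\<integral>\<^sup>+x. F x t \<partial>count_space (a t)) = (SUP n. \<integral>\<^sup>+x. indicator (B n) x * F x t \<partial>count_space (a t))"
    if t: "t \<in> space T" for t
  proof (subst nn_integral_monotone_convergence_SUP[symmetric])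
    show "incseq (\<lambda>n x. indicator (B n) x * F x t)"
      using Binc by (auto simp: incseq_def le_fun_def indicator_def)
    show "(\<integral>\<^sup>+x. F x t \<partial>count_space (a t)) = (\<integral>\<^sup>+x. (SUP n. indicator (B n) x * F x t) \<partial>count_space (a t))"
    proof (rule nn_integral_cong)
      fix x assume "x \<in> space (count_space (a t))"
      then have x: "x \<in> space S" using config_subset[OF conf[OF t]] by auto
      obtain k :: nat where "dist x0 x \<le> real k" using real_arch_simple by blast
      with x have "x \<in> B k" by (simp add: B_def)
      then have "F x t = indicator (B k) x * F x t" by simp
      then have "F x t \<le> (SUP n. indicator (B n) x * F x t)" by (metis SUP_upper UNIV_I)
      moreover have "(SUP n. indicator (B n) x * F x t) \<le> F x t"
        by (rule SUP_least) (auto simp: indicator_def)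
      ultimately show "F x t = (SUP n. indicator (B n) x * F x t)" by simp
    qed
  qed auto
  then show ?thesis
    using bd[OF F] by (subst measurable_cong) (auto simp: case_prod_beta)
qed

text \<open>Both sides are the supremum of the finite subsums; countability provides an exhausting
  sequence. The law of the typical cell is stated with \<open>infsum\<close>, whereas Fubini and the
  convergence theorems are applied to integrals over the counting measure.\<close>

lemma infsum_ennreal_eq_nn_integral:
  fixes f :: "'a \<Rightarrow> ennreal"
  assumes "countable A"
  shows "infsum f A = (\<integral>\<^sup>+x. f x \<partial>count_space A)"
proof -
  have sup: "infsum f A = (SUP F\<in>{F. finite F \<and> F \<subseteq> A}. sum f F)"
    by (rule nonneg_infsum_complete) auto
  show ?thesis
  proof (rule antisym)
    show "infsum f A \<le> (\<integral>\<^sup>+x. f x \<partial>count_space A)"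
      unfolding sup
    proof (rule SUP_least, clarify)
      fix F assume "finite F" "F \<subseteq> A"
      then have "sum f F = (\<integral>\<^sup>+x. f x * indicator F x \<partial>count_space A)"
        by (subst nn_integral_count_space'[where A=F]) (auto intro!: sum.cong)
      also have "\<dots> \<le> (\<integral>\<^sup>+x. f x \<partial>count_space A)"
        by (rule nn_integral_mono) (auto simp: indicator_def)
      finally show "sum f F \<le> (\<integral>\<^sup>+x. f x \<partial>count_space A)" .
    qed
    show "(\<integral>\<^sup>+x. f x \<partial>count_space A) \<le> infsum f A"
    proof (cases "finite A")
      case True then show ?thesis by (simp add: nn_integral_count_space_finite)
    next
      case False
      with assms have bij: "bij_betw (from_nat_into A) UNIV A" by (rule bij_betw_from_nat_into)
      have "(\<integral>\<^sup>+x. f x \<partial>count_space A) = (\<integral>\<^sup>+n. f (from_nat_into A n) \<partial>count_space UNIV)"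
        by (rule nn_integral_bij_count_space[OF bij, symmetric])
      also have "\<dots> = (SUP n. \<Sum>i<n. f (from_nat_into A i))"
        by (simp add: nn_integral_count_space_nat suminf_eq_SUP)
      also have "\<dots> \<le> infsum f A"
        unfolding sup
      proof (rule SUP_least)
        fix n
        have "(\<Sum>i<n. f (from_nat_into A i)) = sum f (from_nat_into A ` {..<n})"
          using bij by (subst sum.reindex) (auto simp: bij_betw_def intro: inj_on_subset)
        also have "\<dots> \<le> (SUP F\<in>{F. finite F \<and> F \<subseteq> A}. sum f F)"
          using bij by (intro SUP_upper) (auto simp: bij_betw_def)
        finally show "(\<Sum>i<n. f (from_nat_into A i)) \<le> (SUP F\<in>{F. finite F \<and> F \<subseteq> A}. sum f F)" .
      qed
      finally show ?thesis .
    qed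
  qed
qed

section \<open>Random closed sets and cells\<close>

lemma space_closed_sets_space: "space closed_sets_space = {F. closed F}"
  unfolding closed_sets_space_def by (rule space_measure_of) auto

lemma hit_compact_closed_sets_space:
  "compact K \<Longrightarrow> {F. closed F \<and> F \<inter> K \<noteq> {}} \<in> sets closed_sets_space"
  unfolding closed_sets_space_def by (subst sets_measure_of) (auto intro!: sigma_sets.Basic)

lemma measurable_closed_sets_spaceI:
  fixes f :: "'b \<Rightarrow> 'a::topological_space set"
  assumes "\<And>t. t \<in> space T \<Longrightarrow> closed (f t)"
    and "\<And>K. compact K \<Longrightarrow> {t \<in> space T. f t \<inter> K \<noteq> {}} \<in> sets T"
  shows "f \<in> T \<rightarrow>\<^sub>M closed_sets_space"
  unfolding closed_sets_space_def
proof (rule measurable_measure_of)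
  show "f \<in> space T \<rightarrow> {F. closed F}" using assms(1) by auto
  fix y :: "'a set set" assume "y \<in> {{F. closed F \<and> F \<inter> K \<noteq> {}} | K. compact K}"
  then obtain K where K: "y = {F. closed F \<and> F \<inter> K \<noteq> {}}" "compact K" by blast
  then have "f -` y \<inter> space T = {t \<in> space T. f t \<inter> K \<noteq> {}}" using assms(1) by auto
  then show "f -` y \<inter> space T \<in> sets T" using assms(2)[OF K(2)] by simp
qed auto

text \<open>The generator of the \<sigma>-algebra speaks of compact sets, and here the set is moved
  as well. If \<open>k + x\<close> lies in \<open>U\<close>, then \<open>x\<close> carries a whole
  small ball around a point \<open>q\<close> of a countable dense set into \<open>U\<close>, and
  \<open>K\<close> hits this compact ball; the event is thus a countable union of
  rectangles.\<close>

lemma sets_translate_hits_open: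
  fixes U :: "'a::euclidean_space set"
  assumes "open U"
  shows "{(x, K). closed K \<and> (\<lambda>y. y + x) ` K \<inter> U \<noteq> {}} \<in> sets (borel \<Otimes>\<^sub>M closed_sets_space)"
proof -
  obtain D :: "'a set" where D: "countable D" "\<And>X. open X \<Longrightarrow> X \<noteq> {} \<Longrightarrow> \<exists>d\<in>D. d \<in> X"
    using countable_dense_exists by blast
  define r where "r n = inverse (real (Suc n))" for n
  define P where "P q n = {x. \<forall>y\<in>cball q (r n). y + x \<in> U} \<times> {K. closed K \<and> K \<inter> cball q (r n) \<noteq> {}}" for q n
  have "{(x, K). closed K \<and> (\<lambda>y. y + x) ` K \<inter> U \<noteq> {}} = (\<Union>q\<in>D. \<Union>n. P q n)"
  proof (rule equalityI; rule subsetI)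
    fix p assume "p \<in> {(x, K). closed K \<and> (\<lambda>y. y + x) ` K \<inter> U \<noteq> {}}"
    then obtain x K k where p: "p = (x, K)" and K: "closed K" "k \<in> K" "k + x \<in> U" by auto
    obtain e where e: "e > 0" "ball (k + x) e \<subseteq> U" using assms K(3) openE by blast
    obtain n where n: "r n < e / 2" unfolding r_def using reals_Archimedean[of "e/2"] e by auto
    have "r n > 0" by (simp add: r_def)
    then obtain q where q: "q \<in> D" "dist k q < r n" using D(2)[of "ball k (r n)"] by auto
    have "y + x \<in> U" if "y \<in> cball q (r n)" for y
    proof -
      have "dist (k + x) (y + x) = dist k y" by simp
      also have "\<dots> \<le> dist k q + dist q y" by (rule dist_triangle)
      also have "\<dots> < e" using q(2) that n by simp
      finally show ?thesis using e(2) by auto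
    qed
    then have "(x, K) \<in> P q n" using K q by (auto simp: P_def dist_commute intro!: exI[of _ k])
    then show "p \<in> (\<Union>q\<in>D. \<Union>n. P q n)" using q p by blast
  next
    fix p assume "p \<in> (\<Union>q\<in>D. \<Union>n. P q n)"
    then show "p \<in> {(x, K). closed K \<and> (\<lambda>y. y + x) ` K \<inter> U \<noteq> {}}" unfolding P_def by blast
  qed
  moreover have "P q n \<in> sets (borel \<Otimes>\<^sub>M closed_sets_space)" for q n
    unfolding P_def
  proof (rule pair_measureI[OF _ hit_compact_closed_sets_space[OF compact_cball]])
    \<comment> \<open>The excluded translations are the differences of the closed set
      \<open>- U\<close> and the compact ball. They form a closed set, so the admissible
      translations form an open one.\<close>
    have "{x. \<forall>y\<in>cball q (r n). y + x \<in> U} = - (\<Union>u\<in>-U. \<Union>y\<in>cball q (r n). {u - y})"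
    proof (intro set_eqI iffI)
      fix x assume "x \<in> - (\<Union>u\<in>-U. \<Union>y\<in>cball q (r n). {u - y})"
      then have "u \<in> U" if "y \<in> cball q (r n)" "x = u - y" for u y using that by blast
      from this[where u="_ + x"] show "x \<in> {x. \<forall>y\<in>cball q (r n). y + x \<in> U}" by simp
    qed auto
    moreover have "closed (\<Union>u\<in>-U. \<Union>y\<in>cball q (r n). {u - y})"
      using assms by (intro closed_compact_differences) auto
    ultimately show "{x. \<forall>y\<in>cball q (r n). y + x \<in> U} \<in> sets borel"
      by (simp only: open_Compl borel_open)
  qed
  ultimately show ?thesis using D(1) by auto
qed

lemma sets_erosion:
  fixes W :: "'a::euclidean_space set"
  assumes "closed W"
  shows "{(x, K). closed K \<and> x \<in> erosion W K} \<in> sets (borel \<Otimes>\<^sub>M closed_sets_space)"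
proof -
  have "{(x, K). closed K \<and> x \<in> erosion W K}
     = space (borel \<Otimes>\<^sub>M closed_sets_space) - {(x, K). closed K \<and> (\<lambda>y. y + x) ` K \<inter> - W \<noteq> {}}"
    by (auto simp: space_pair_measure space_closed_sets_space erosion_def)
  also have "\<dots> \<in> sets (borel \<Otimes>\<^sub>M closed_sets_space)"
    by (intro sets.compl_sets sets_translate_hits_open) (use assms in auto)
  finally show ?thesis .
qed

lemma measurable_erosion_indicator:
  fixes W :: "'a::euclidean_space set"
  assumes "closed W"
  shows "(\<lambda>(x, K). indicator (erosion W K) x :: 'b::{t2_space, zero_neq_one}) 
    \<in> borel_measurable (borel \<Otimes>\<^sub>M closed_sets_space)"
proof -
  have "indicator {(x, K). closed K \<and> x \<in> erosion W K} \<in> borel_measurable (borel \<Otimes>\<^sub>M closed_sets_space :: ('a \<times> 'a set) measure)"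
    using sets_erosion[OF assms] by (rule borel_measurable_indicator)
  then show ?thesis
    by (rule measurable_cong[THEN iffD1, rotated])
      (auto simp: space_pair_measure space_closed_sets_space indicator_def)
qed

lemma closed_erosion:
  fixes W :: "'a::real_normed_vector set"
  assumes "closed W"
  shows "closed (erosion W K)"
proof -
  have "closed (\<Inter>y\<in>K. (\<lambda>x. y + x) -` W)"
    by (intro closed_INT ballI closed_vimage[OF assms] continuous_intros)
  moreover have "erosion W K = (\<Inter>y\<in>K. (\<lambda>x. y + x) -` W)" by (auto simp: erosion_def)
  ultimately show ?thesis by (simp only:)
qed

lemma measurable_erosion_volume:
  fixes W :: "'a::euclidean_space set"
  assumes "closed W"
  shows "(\<lambda>K. measure lborel (erosion W K)) \<in> borel_measurable closed_sets_space"
proof -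
  have "(\<lambda>(K, x). indicator (erosion W K) x :: ennreal) \<in> borel_measurable (closed_sets_space \<Otimes>\<^sub>M lborel)"
    using measurable_compose[OF measurable_pair_swap' measurable_erosion_indicator[OF assms, where 'b=ennreal]]
    by (simp add: case_prod_beta cong: measurable_cong_sets sets_pair_measure_cong)
  then have "(\<lambda>K. \<integral>\<^sup>+x. indicator (erosion W K) x \<partial>lborel) \<in> borel_measurable closed_sets_space"
    by (rule lborel.borel_measurable_nn_integral)
  then have "(\<lambda>K. emeasure lborel (erosion W K)) \<in> borel_measurable closed_sets_space"
    using closed_erosion[OF assms] by simp
  then show ?thesis unfolding measure_def by measurable
qed

lemma sets_subset_closed:
  fixes W :: "'a::euclidean_space set"
  assumes "closed W"
  shows "{K. closed K \<and> K \<subseteq> W} \<in> sets closed_sets_space"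
proof -
  have "{K. closed K \<and> K \<subseteq> W} = Pair 0 -` {(x, K). closed K \<and> x \<in> erosion W K}"
    by (auto simp: erosion_def)
  then show ?thesis using sets_Pair1[OF sets_erosion[OF assms]] by simp
qed

lemma sets_bounded_closed:
  "{K :: 'a::euclidean_space set. closed K \<and> bounded K} \<in> sets closed_sets_space"
proof -
  have "{K :: 'a set. closed K \<and> bounded K} = (\<Union>n::nat. {K. closed K \<and> K \<subseteq> cball 0 (real n)})"
  proof (intro set_eqI iffI; clarify)
    fix K :: "'a set" assume "closed K" "bounded K"
    then obtain b where b: "\<And>x. x \<in> K \<Longrightarrow> norm x \<le> b" by (auto simp: bounded_iff)
    obtain n :: nat where "b \<le> real n" using real_arch_simple by blast
    with b \<open>closed K\<close> have "K \<in> {K. closed K \<and> K \<subseteq> cball 0 (real n)}" by force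
    then show "K \<in> (\<Union>n::nat. {K. closed K \<and> K \<subseteq> cball 0 (real n)})" by blast
  qed (auto intro: bounded_subset[OF bounded_cball])
  then show ?thesis
    by (simp only:) (intro sets.countable_UN image_subsetI sets_subset_closed closed_cball)
qed

lemma sets_unbounded_closed:
  "{K :: 'a::euclidean_space set. closed K \<and> \<not> bounded K} \<in> sets closed_sets_space"
proof -
  have "{K :: 'a set. closed K \<and> \<not> bounded K} = space closed_sets_space - {K. closed K \<and> bounded K}"
    by (auto simp: space_closed_sets_space)
  then show ?thesis using sets_bounded_closed by auto
qed

section \<open>Shifts of marked configurations and centred cells\<close>

definition config_shift :: "'a::euclidean_space \<Rightarrow> ('a \<times> real) set \<Rightarrow> ('a \<times> real) set" where
  "config_shift z A = (\<lambda>p. p + (z, 0)) ` A"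

definition centred_cell ::
    "(real ^ 'd \<Rightarrow> (real ^ 'd) \<times> real \<Rightarrow> real) \<Rightarrow> (real ^ 'd) \<times> real
      \<Rightarrow> ((real ^ 'd) \<times> real) set \<Rightarrow> (real ^ 'd) set" where
  "centred_cell \<rho> x A = (\<lambda>y. y - fst x) ` cell \<rho> x A"

lemma mark_law_space: "mark_law \<mu> Q \<Longrightarrow> space Q = {0..\<mu>}"
  using sets_eq_imp_space_eq[of Q "restrict_space borel {0..\<mu>}"]
  by (simp add: mark_law_def space_restrict_space)

lemma space_marked: "mark_law \<mu> Q \<Longrightarrow> space (borel \<Otimes>\<^sub>M Q) = UNIV \<times> {0..\<mu>}"
  by (simp add: space_pair_measure mark_law_space)

lemma measurable_mark_inclusion: "mark_law \<mu> Q \<Longrightarrow> (\<lambda>m. m) \<in> Q \<rightarrow>\<^sub>M borel"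
  using measurable_restrict_space1[of "\<lambda>m. m" borel borel "{0..\<mu>}"]
  by (simp add: mark_law_def cong: measurable_cong_sets)

text \<open>Supplies the hypothesis on traces of open sets in the results on configuration spaces:
  the inclusion of the marks into the reals is measurable, and the Borel sets of the product form
  the product \<sigma>-algebra.\<close>

lemma open_in_marked:
  fixes U :: "('a::euclidean_space \<times> real) set"
  assumes Q: "mark_law \<mu> Q" and "open U"
  shows "U \<inter> space (borel \<Otimes>\<^sub>M Q) \<in> sets (borel \<Otimes>\<^sub>M Q)"
proof -
  note [measurable] = measurable_mark_inclusion[OF Q]
  have "(\<lambda>p :: 'a \<times> real. (fst p, snd p)) \<in> borel \<Otimes>\<^sub>M Q \<rightarrow>\<^sub>M borel \<Otimes>\<^sub>M borel"
    by measurable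
  then have "(\<lambda>p :: 'a \<times> real. p) \<in> borel \<Otimes>\<^sub>M Q \<rightarrow>\<^sub>M borel"
    by (simp add: borel_prod)
  from measurable_sets[OF this borel_open[OF \<open>open U\<close>]] show ?thesis by simp
qed

lemma cball_in_marked:
  fixes x :: "'a::euclidean_space \<times> real"
  assumes Q: "mark_law \<mu> Q"
  shows "cball x r \<inter> space (borel \<Otimes>\<^sub>M Q) \<in> sets (borel \<Otimes>\<^sub>M Q)"
proof -
  have "cball x r \<inter> space (borel \<Otimes>\<^sub>M Q) = space (borel \<Otimes>\<^sub>M Q) - (- cball x r) \<inter> space (borel \<Otimes>\<^sub>M Q)" by auto
  also have "\<dots> \<in> sets (borel \<Otimes>\<^sub>M Q)"
    by (intro sets.compl_sets open_in_marked[OF Q]) auto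
  finally show ?thesis .
qed

lemmas measurable_config_marked = measurable_config_spaceI[OF open_in_marked]
lemmas measurable_nn_integral_marked = measurable_nn_integral_config[OF cball_in_marked[where x=0]]

lemma config_shift_configurations:
  assumes "A \<in> configurations (UNIV \<times> E)"
  shows "config_shift z A \<in> configurations (UNIV \<times> E)"
  unfolding configurations_def
proof (intro CollectI conjI allI impI)
  show "config_shift z A \<subseteq> UNIV \<times> E"
    using config_subset[OF assms] by (auto simp: config_shift_def)
  fix B :: "('a \<times> real) set" assume "bounded B"
  then have "bounded ((\<lambda>p. (- z, 0) + p) ` B)" by (rule bounded_translation)
  then have "finite (A \<inter> (\<lambda>p. (- z, 0) + p) ` B)" by (rule config_finite[OF assms])
  moreover have "config_shift z A \<inter> B \<subseteq> (\<lambda>p. p + (z, 0)) ` (A \<inter> (\<lambda>p. (- z, 0) + p) ` B)"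
  proof
    fix q assume "q \<in> config_shift z A \<inter> B"
    then obtain p where p: "p \<in> A" "q = p + (z, 0)" "q \<in> B" by (auto simp: config_shift_def)
    then have "p = (- z, 0) + q" by (cases p) simp
    with p show "q \<in> (\<lambda>p. p + (z, 0)) ` (A \<inter> (\<lambda>p. (- z, 0) + p) ` B)" by blast
  qed
  ultimately show "finite (config_shift z A \<inter> B)" by (meson finite_imageI finite_subset)
qed

lemma nn_integral_count_space_eq_0_iff:
  "(\<integral>\<^sup>+x. f x \<partial>count_space A) = 0 \<longleftrightarrow> (\<forall>x\<in>A. f x = (0::ennreal))"
  by (subst nn_integral_0_iff_AE) (auto simp: AE_count_space)

lemma measurable_config_shift:
  fixes Q :: "real measure"
  assumes Q: "mark_law \<mu> Q"
  shows "(\<lambda>(z :: 'a::euclidean_space, A). config_shift z A)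
    \<in> borel \<Otimes>\<^sub>M config_space (borel \<Otimes>\<^sub>M Q) \<rightarrow>\<^sub>M config_space (borel \<Otimes>\<^sub>M Q)"
proof (rule measurable_config_marked[OF Q])
  let ?S = "borel \<Otimes>\<^sub>M Q :: ('a \<times> real) measure"
  let ?T = "borel \<Otimes>\<^sub>M config_space ?S"
  fix V assume V: "V \<in> sets ?S" "bounded V"
  \<comment> \<open>This sum counts the points that the shift carries into \<open>V\<close>; the
    shifted configuration misses \<open>V\<close> exactly when it is zero.\<close>
  have "(\<lambda>t. \<integral>\<^sup>+x. indicator V (fst x + fst t, snd x) \<partial>count_space (snd t)) \<in> borel_measurable ?T"
  proof (rule measurable_nn_integral_marked[OF Q measurable_snd])
    show "(\<lambda>(x, t). indicator V (fst x + fst t, snd x) :: ennreal) \<in> borel_measurable (?S \<Otimes>\<^sub>M ?T)"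
      using V(1) by measurable
  qed
  then have "{t \<in> space ?T. (\<integral>\<^sup>+x. indicator V (fst x + fst t, snd x) \<partial>count_space (snd t)) = 0} \<in> sets ?T"
    by measurable
  moreover have "(\<integral>\<^sup>+x. indicator V (fst x + fst t, snd x) \<partial>count_space (snd t)) = 0
     \<longleftrightarrow> (case t of (z, A) \<Rightarrow> config_shift z A) \<inter> V = {}" for t
    unfolding nn_integral_count_space_eq_0_iff
    by (cases t) (force simp: config_shift_def indicator_def)
  ultimately show "{t \<in> space ?T. (case t of (z, A) \<Rightarrow> config_shift z A) \<inter> V = {}} \<in> sets ?T"
    by simp
qed (auto simp: space_pair_measure space_config_space mark_law_space[OF Q] config_shift_configurations)

text \<open>Compactness replaces an uncountable existential by countably many conditions. The
  relaxed inequalities for the finitely many \<open>z\<close> in \<open>B n\<close> hold strictly on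
  a neighbourhood of a solution, which meets \<open>D\<close>. Conversely they define nested
  nonempty compact sets, and a common point of these satisfies every inequality because the
  tolerance tends to zero.\<close>

lemma exists_common_nonneg_iff:
  fixes g :: "'b \<Rightarrow> 'a::heine_borel \<Rightarrow> real"
  assumes K: "compact K" and D: "D \<subseteq> K" "K \<subseteq> closure D"
    and g: "\<And>z. z \<in> A \<Longrightarrow> continuous_on UNIV (g z)"
    and A: "A = (\<Union>n. B n)" "incseq B" "\<And>n. finite (B n)"
  shows "(\<exists>y\<in>K. \<forall>z\<in>A. 0 \<le> g z y) \<longleftrightarrow> (\<forall>n. \<exists>y\<in>D. \<forall>z\<in>B n. - inverse (real (Suc n)) < g z y)"
proof
  assume "\<exists>y\<in>K. \<forall>z\<in>A. 0 \<le> g z y"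
  then obtain y where y: "y \<in> K" "\<And>z. z \<in> A \<Longrightarrow> 0 \<le> g z y" by blast
  show "\<forall>n. \<exists>y\<in>D. \<forall>z\<in>B n. - inverse (real (Suc n)) < g z y"
  proof
    fix n
    let ?U = "\<Inter>z\<in>B n. {y. - inverse (real (Suc n)) < g z y}"
    have "open ?U"
      using A g by (intro open_INT ballI open_Collect_less continuous_intros) auto
    moreover have "y \<in> ?U"
    proof
      fix z assume "z \<in> B n"
      then have "0 \<le> g z y" using A y by blast
      moreover have "- inverse (real (Suc n)) < 0" by simp
      ultimately have "- inverse (real (Suc n)) < g z y" by linarith
      then show "y \<in> {y. - inverse (real (Suc n)) < g z y}" by blast
    qed
    moreover have "y \<in> closure D" using D(2) y(1) by blast
    ultimately have "D \<inter> ?U \<noteq> {}" using open_Int_closure_eq_empty[of ?U D] by blast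
    then show "\<exists>y\<in>D. \<forall>z\<in>B n. - inverse (real (Suc n)) < g z y" by blast
  qed
next
  assume *: "\<forall>n. \<exists>y\<in>D. \<forall>z\<in>B n. - inverse (real (Suc n)) < g z y"
  define F where "F n = K \<inter> (\<Inter>z\<in>B n. {y. - inverse (real (Suc n)) \<le> g z y})" for n
  have "\<Inter> (range F) \<noteq> {}"
  proof (rule compact_nest)
    show "compact (F n)" for n
      unfolding F_def using A g
      by (intro compact_Int_closed K closed_INT ballI closed_Collect_le continuous_intros) auto
    show "F n \<noteq> {}" for n
      using *[rule_format, of n] D(1) unfolding F_def by fastforce
    show "F n \<subseteq> F m" if "m \<le> n" for m n
    proof -
      have "inverse (real (Suc n)) \<le> inverse (real (Suc m))" using that by simp
      then have "{y. - inverse (real (Suc n)) \<le> g z y} \<subseteq> {y. - inverse (real (Suc m)) \<le> g z y}" for z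
        by (intro Collect_mono impI) linarith
      moreover have "B m \<subseteq> B n" using A(2) that by (simp add: incseq_def)
      ultimately show ?thesis unfolding F_def by blast
    qed
  qed
  then obtain y where y: "\<And>n. y \<in> F n" by blast
  have "0 \<le> g z y" if z: "z \<in> A" for z
  proof -
    obtain n where n: "z \<in> B n" using z A(1) by blast
    have "- inverse (real (Suc (k + n))) \<le> g z y" for k
    proof -
      have "z \<in> B (k + n)" using n incseqD[OF A(2), of n "k + n"] by auto
      then show ?thesis using y[of "k + n"] by (auto simp: F_def)
    qed
    moreover have "(\<lambda>k. - inverse (real (Suc (k + n)))) \<longlonglongrightarrow> - 0"
      by (intro tendsto_minus LIMSEQ_ignore_initial_segment[OF LIMSEQ_inverse_real_of_nat])
    ultimately show ?thesis using LIMSEQ_le_const2[of _ "- 0" "g z y"] by auto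
  qed
  moreover have "y \<in> K" using y[of 0] by (simp add: F_def)
  ultimately show "\<exists>y\<in>K. \<forall>z\<in>A. 0 \<le> g z y" by blast
qed

lemma weight_functionD:
  assumes "weight_function \<mu> \<rho>"
  shows "(\<lambda>(y, x). \<rho> y x) \<in> borel_measurable (borel \<Otimes>\<^sub>M (borel \<Otimes>\<^sub>M restrict_space borel {0..\<mu>}))"
    and "x \<in> UNIV \<times> {0..\<mu>} \<Longrightarrow> continuous_on UNIV (\<lambda>y. \<rho> y x)"
    and "x \<in> UNIV \<times> {0..\<mu>} \<Longrightarrow> \<rho> (y + z) (x + (z, 0)) = \<rho> y x"
  using assms by (auto simp: weight_function_def)

lemma closed_cell:
  assumes w: "weight_function \<mu> \<rho>" and "x \<in> UNIV \<times> {0..\<mu>}" "A \<subseteq> UNIV \<times> {0..\<mu>}"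
  shows "closed (cell \<rho> x A)"
proof -
  have "cell \<rho> x A = (\<Inter>z\<in>A. {y. \<rho> y x \<le> \<rho> y z})" by (auto simp: cell_def)
  moreover have "closed {y. \<rho> y x \<le> \<rho> y z}" if "z \<in> A" for z
    using that assms by (intro closed_Collect_le weight_functionD(2)[OF w]) auto
  ultimately show ?thesis by auto
qed

text \<open>Translation covariance of the weight function moves the generating point to the origin,
  so that measurability in point and configuration reduces to that of the shift and of cells of
  points at the origin.\<close>

lemma centred_cell_eq:
  assumes w: "weight_function \<mu> \<rho>" and x: "x \<in> UNIV \<times> {0..\<mu>}" and A: "A \<subseteq> UNIV \<times> {0..\<mu>}"
  shows "centred_cell \<rho> x A = cell \<rho> (0, snd x) (config_shift (- fst x) A)"
proof -
  have 1: "\<rho> (y + fst x) x = \<rho> y (0, snd x)" for y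
    using weight_functionD(3)[OF w, of "(0, snd x)" y "fst x"] x by (cases x) auto
  have 2: "\<rho> (y + fst x) z = \<rho> y (z + (- fst x, 0))" if "z \<in> A" for y z
    using weight_functionD(3)[OF w, of "z + (- fst x, 0)" y "fst x"] that A by (cases z) auto
  have "y \<in> centred_cell \<rho> x A \<longleftrightarrow> y + fst x \<in> cell \<rho> x A" for y
    unfolding centred_cell_def by (auto simp: image_iff intro!: bexI[of _ "y + fst x"])
  also have "\<dots>y \<longleftrightarrow> y \<in> cell \<rho> (0, snd x) (config_shift (- fst x) A)" for y
    unfolding cell_def config_shift_def using 1 2 by simp
  finally show ?thesis by blast
qed

text \<open>The cell hits the compact set \<open>K\<close> iff the differences
  \<open>\<rho> y z - \<rho> y (0, m)\<close> are nonnegative for all \<open>z\<close> at a common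
  \<open>y\<close> in \<open>K\<close>. The compactness lemma reduces this to countably many events,
  each about finitely many points of the configuration.\<close>

lemma measurable_cell_origin:
  fixes \<rho> :: "real ^ 'd \<Rightarrow> (real ^ 'd) \<times> real \<Rightarrow> real"
  assumes Q: "mark_law \<mu> Q" and w: "weight_function \<mu> \<rho>"
  shows "(\<lambda>(m, A). cell \<rho> (0, m) A) \<in> Q \<Otimes>\<^sub>M config_space (borel \<Otimes>\<^sub>M Q) \<rightarrow>\<^sub>M closed_sets_space"
proof (rule measurable_closed_sets_spaceI)
  let ?S = "borel \<Otimes>\<^sub>M Q :: ((real ^ 'd) \<times> real) measure"
  let ?T = "Q \<Otimes>\<^sub>M config_space ?S"
  have sp: "m \<in> {0..\<mu>} \<and> A \<in> configurations (UNIV \<times> {0..\<mu>})" if "(m, A) \<in> space ?T" for m A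
    using that by (auto simp: space_pair_measure space_config_space mark_law_space[OF Q])
  show "closed (case t of (m, A) \<Rightarrow> cell \<rho> (0, m) A)" if "t \<in> space ?T" for t
  proof -
    obtain m A where t: "t = (m, A)" by force
    with sp that have "m \<in> {0..\<mu>}" "A \<in> configurations (UNIV \<times> {0..\<mu>})" by auto
    then show ?thesis using t closed_cell[OF w, of "(0, m)" A] config_subset by auto
  qed
  fix K :: "(real ^ 'd) set" assume K: "compact K"
  obtain D where D: "countable D" "D \<subseteq> K" "K \<subseteq> closure D"
    using separable by metis
  have sQ: "sets Q = sets (restrict_space borel {0..\<mu>})" using Q by (simp add: mark_law_def)
  have rho[measurable]: "\<rho> y \<in> borel_measurable ?S" for y
  proof -
    have "(\<lambda>x. (\<lambda>(y, x). \<rho> y x) (y, x)) \<in> borel_measurable (borel \<Otimes>\<^sub>M restrict_space borel {0..\<mu>})"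
      by (rule measurable_Pair2[OF weight_functionD(1)[OF w]]) simp
    then show ?thesis using sQ by (simp cong: measurable_cong_sets sets_pair_measure_cong)
  qed
  let ?R = "\<lambda>n y (m, A). \<forall>z\<in>A \<inter> cball 0 (real n). - inverse (real (Suc n)) < \<rho> y z - \<rho> y (0, m)"
  have R: "{t \<in> space ?T. ?R n y t} \<in> sets ?T" for n y
  proof -
    \<comment> \<open>The points in the ball that violate the relaxed inequality; the condition
      \<open>?R n y t\<close> says that their number is zero.\<close>
    let ?E = "\<lambda>t. {z. z \<in> cball 0 (real n) \<inter> space ?S \<and> - inverse (real (Suc n)) \<ge> \<rho> y z - \<rho> y (0, fst t)}"
    have b[measurable]: "cball 0 (real n) \<inter> space ?S \<in> sets ?S" by (rule cball_in_marked[OF Q])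
    have "(\<lambda>t. \<integral>\<^sup>+z. indicator (?E t) z \<partial>count_space (snd t)) \<in> borel_measurable ?T"
    proof (rule measurable_nn_integral_marked[OF Q measurable_snd])
      have "(\<lambda>(z, t). indicator {t \<in> space (?S \<Otimes>\<^sub>M ?T). fst t \<in> cball 0 (real n) \<inter> space ?S
             \<and> - inverse (real (Suc n)) \<ge> \<rho> y (fst t) - \<rho> y (0, fst (snd t))} (z, t) :: ennreal)
          \<in> borel_measurable (?S \<Otimes>\<^sub>M ?T)"
        by measurable
      then show "(\<lambda>(z, t). indicator (?E t) z :: ennreal) \<in> borel_measurable (?S \<Otimes>\<^sub>M ?T)"
        by (rule measurable_cong[THEN iffD1, rotated]) (auto simp: indicator_def)
    qed
    then have "{t \<in> space ?T. (\<integral>\<^sup>+z. indicator (?E t) z \<partial>count_space (snd t)) = 0} \<in> sets ?T"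
      by measurable
    moreover have "(\<integral>\<^sup>+z. indicator (?E t) z \<partial>count_space (snd t)) = 0 \<longleftrightarrow> ?R n y t"
      if "t \<in> space ?T" for t
    proof -
      obtain m A where t: "t = (m, A)" by force
      with sp that have "A \<subseteq> space ?S" using config_subset space_marked[OF Q] by blast
      then show ?thesis unfolding nn_integral_count_space_eq_0_iff t
        by (auto simp: indicator_def not_le)
    qed
    ultimately show ?thesis by (simp cong: conj_cong)
  qed
  have "{t \<in> space ?T. (case t of (m, A) \<Rightarrow> cell \<rho> (0, m) A) \<inter> K \<noteq> {}}
      = {t \<in> space ?T. \<forall>n. \<exists>y\<in>D. ?R n y t}"
  proof (rule Collect_cong, rule conj_cong[OF refl], clarify)
    fix m A assume mA: "(m, A) \<in> space ?T"
    then have m: "m \<in> {0..\<mu>}" and A: "A \<in> configurations (UNIV \<times> {0..\<mu>})" using sp by auto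
    have "cell \<rho> (0, m) A \<inter> K \<noteq> {} \<longleftrightarrow> (\<exists>y\<in>K. \<forall>z\<in>A. 0 \<le> \<rho> y z - \<rho> y (0, m))"
      by (auto simp: cell_def)
    also have "\<dots> \<longleftrightarrow> (\<forall>n. \<exists>y\<in>D. \<forall>z\<in>A \<inter> cball 0 (real n). - inverse (real (Suc n)) < \<rho> y z - \<rho> y (0, m))"
    proof (rule exists_common_nonneg_iff[OF K D(2,3)])
      show "continuous_on UNIV (\<lambda>y. \<rho> y z - \<rho> y (0, m))" if "z \<in> A" for z
        using config_subset[OF A] that m by (intro continuous_on_diff weight_functionD(2)[OF w]) auto
      show "A = (\<Union>n::nat. A \<inter> cball 0 (real n))"
      proof (rule set_eqI)
        fix x :: "(real ^ 'd) \<times> real"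
        obtain n :: nat where "norm x \<le> real n" using real_arch_simple by blast
        then show "x \<in> A \<longleftrightarrow> x \<in> (\<Union>n::nat. A \<inter> cball 0 (real n))" by auto
      qed
      show "incseq (\<lambda>n::nat. A \<inter> cball 0 (real n))" by (auto simp: incseq_def)
      show "finite (A \<inter> cball 0 (real n))" for n by (rule config_finite[OF A bounded_cball])
    qed
    finally show "cell \<rho> (0, m) A \<inter> K \<noteq> {} \<longleftrightarrow>
      (\<forall>n. \<exists>y\<in>D. \<forall>z\<in>A \<inter> cball 0 (real n). - inverse (real (Suc n)) < \<rho> y z - \<rho> y (0, m))" .
  qed
  also have "\<dots> \<in> sets ?T"
    by (intro sets.sets_Collect_countable_All sets.sets_Collect_countable_Ex'[OF _ D(1)] R)
  finally show "{t \<in> space ?T. (case t of (m, A) \<Rightarrow> cell \<rho> (0, m) A) \<inter> K \<noteq> {}} \<in> sets ?T" .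
qed

lemma measurable_centred_cell:
  fixes \<rho> :: "real ^ 'd \<Rightarrow> (real ^ 'd) \<times> real \<Rightarrow> real"
  assumes Q: "mark_law \<mu> Q" and w: "weight_function \<mu> \<rho>"
  shows "(\<lambda>(x, A). centred_cell \<rho> x A)
    \<in> (borel \<Otimes>\<^sub>M Q) \<Otimes>\<^sub>M config_space (borel \<Otimes>\<^sub>M Q) \<rightarrow>\<^sub>M closed_sets_space"
proof -
  let ?T = "(borel \<Otimes>\<^sub>M Q) \<Otimes>\<^sub>M config_space (borel \<Otimes>\<^sub>M Q) :: (((real ^ 'd) \<times> real) \<times> ((real ^ 'd) \<times> real) set) measure"
  have sh: "(\<lambda>t. config_shift (- fst (fst t)) (snd t)) \<in> ?T \<rightarrow>\<^sub>M config_space (borel \<Otimes>\<^sub>M Q)"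
    using measurable_compose[OF _ measurable_config_shift[OF Q], of "\<lambda>t. (- fst (fst t), snd t)" ?T] by simp
  have "(\<lambda>t. cell \<rho> (0, snd (fst t)) (config_shift (- fst (fst t)) (snd t))) \<in> ?T \<rightarrow>\<^sub>M closed_sets_space"
    using measurable_compose[OF _ measurable_cell_origin[OF Q w],
        of "\<lambda>t. (snd (fst t), config_shift (- fst (fst t)) (snd t))" ?T] sh by simp
  then show ?thesis
  proof (rule measurable_cong[THEN iffD1, rotated])
    fix t assume "t \<in> space ?T"
    then obtain x A where t: "t = (x, A)" "x \<in> UNIV \<times> {0..\<mu>}" "A \<in> configurations (UNIV \<times> {0..\<mu>})"
      by (auto simp: space_pair_measure space_config_space mark_law_space[OF Q])
    then show "cell \<rho> (0, snd (fst t)) (config_shift (- fst (fst t)) (snd t))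
        = (case t of (x, A) \<Rightarrow> centred_cell \<rho> x A)"
      using centred_cell_eq[OF w t(2) config_subset[OF t(3)]] by simp
  qed
qed

section \<open>Campbell's formula and unbiasedness\<close>

lemma summable_on_real_iff_integrable:
  fixes f :: "'a \<Rightarrow> real"
  shows "f summable_on A \<longleftrightarrow> integrable (count_space A) f"
  using summable_on_iff_abs_summable_on_real[of f A] abs_summable_equivalent[of f A]
  unfolding abs_summable_on_def by blast

lemma infsum_eq_integral_count_space:
  fixes f :: "'a \<Rightarrow> real"
  assumes "integrable (count_space A) f"
  shows "infsum f A = (\<integral>x. f x \<partial>count_space A)"
  using infsetsum_infsum[of f A] assms by (simp add: abs_summable_on_def infsetsum_def)

text \<open>\<open>infsum\<close> is 0 on families that are not summable. Making this default
  explicit gives measurability of random sums at every outcome, before anything is known about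
  convergence.\<close>

lemma infsum_real_eq:
  fixes f :: "'a \<Rightarrow> real"
  shows "infsum f A = (if (\<integral>\<^sup>+x. ennreal \<bar>f x\<bar> \<partial>count_space A) < \<infinity>
     then enn2real (\<integral>\<^sup>+x. ennreal (f x) \<partial>count_space A) - enn2real (\<integral>\<^sup>+x. ennreal (- f x) \<partial>count_space A)
     else 0)"
proof -
  have int: "integrable (count_space A) f \<longleftrightarrow> (\<integral>\<^sup>+x. ennreal \<bar>f x\<bar> \<partial>count_space A) < \<infinity>"
    by (simp add: integrable_iff_bounded)
  then show ?thesis
    using infsum_eq_integral_count_space[of A f] real_lebesgue_integral_def[of "count_space A" f]
      infsum_not_exists[of f A] summable_on_real_iff_integrable[of f A] by auto
qed

lemma measurable_infsum_marked:
  fixes F :: "('a::euclidean_space \<times> real) \<Rightarrow> 't \<Rightarrow> real"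
  assumes Q: "mark_law \<mu> Q" and a: "a \<in> T \<rightarrow>\<^sub>M config_space (borel \<Otimes>\<^sub>M Q)"
    and F[measurable]: "(\<lambda>(x, t). F x t) \<in> borel_measurable ((borel \<Otimes>\<^sub>M Q) \<Otimes>\<^sub>M T)"
  shows "(\<lambda>t. \<Sum>\<^sub>\<infinity>x\<in>a t. F x t) \<in> borel_measurable T"
proof -
  have [measurable]: "(\<lambda>t. \<integral>\<^sup>+x. ennreal \<bar>F x t\<bar> \<partial>count_space (a t)) \<in> borel_measurable T"
    "(\<lambda>t. \<integral>\<^sup>+x. ennreal (F x t) \<partial>count_space (a t)) \<in> borel_measurable T"
    "(\<lambda>t. \<integral>\<^sup>+x. ennreal (- F x t) \<partial>count_space (a t)) \<in> borel_measurable T"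
    by (rule measurable_nn_integral_marked[OF Q a], measurable)+
  show ?thesis unfolding infsum_real_eq by measurable
qed

text \<open>The common setting of the general process and of the Poisson process; inside it the name
  \<open>\<eta>\<close> stands for either.\<close>

locale typical_cell = prob_space M
  for M :: "'w measure" +
  fixes \<mu> :: real and Q :: "real measure"
    and \<rho> :: "real ^ 'd \<Rightarrow> (real ^ 'd) \<times> real \<Rightarrow> real"
    and \<eta> :: "'w \<Rightarrow> ((real ^ 'd) \<times> real) set"
    and \<kappa> :: "(real ^ 'd) set measure"
  assumes Q: "mark_law \<mu> Q" and weight: "weight_function \<mu> \<rho>"
    and eta: "\<eta> \<in> M \<rightarrow>\<^sub>M config_space (borel \<Otimes>\<^sub>M Q)"
    and typical: "typical_cell_law M \<rho> \<eta> \<kappa>"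
begin

lemma prob_kappa: "prob_space \<kappa>" and sets_kappa[measurable_cong]: "sets \<kappa> = sets closed_sets_space"
  using typical by (auto simp: typical_cell_law_def)

sublocale kappa: prob_space \<kappa> by (rule prob_kappa)

sublocale lk: pair_sigma_finite lborel \<kappa> ..

lemma space_kappa: "space \<kappa> = {K. closed K}"
  using sets_eq_imp_space_eq[OF sets_kappa] by (simp add: space_closed_sets_space)

lemma eta_conf: "\<omega> \<in> space M \<Longrightarrow> \<eta> \<omega> \<in> configurations (UNIV \<times> {0..\<mu>})"
  using measurable_space[OF eta] by (simp add: space_config_space mark_law_space[OF Q] space_pair_measure)

lemma measurable_cell_functional:
  assumes f: "f \<in> N \<Otimes>\<^sub>M closed_sets_space \<rightarrow>\<^sub>M R" and g: "g \<in> borel \<rightarrow>\<^sub>M N"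
  shows "(\<lambda>(x, A). f (g (fst x), centred_cell \<rho> x A))
    \<in> (borel \<Otimes>\<^sub>M Q) \<Otimes>\<^sub>M config_space (borel \<Otimes>\<^sub>M Q) \<rightarrow>\<^sub>M R"
proof -
  note [measurable] = g measurable_centred_cell[OF Q weight]
  have "(\<lambda>p. (g (fst (fst p)), (\<lambda>(x, A). centred_cell \<rho> x A) p))
     \<in> (borel \<Otimes>\<^sub>M Q) \<Otimes>\<^sub>M config_space (borel \<Otimes>\<^sub>M Q) \<rightarrow>\<^sub>M N \<Otimes>\<^sub>M closed_sets_space"
    by measurable
  from measurable_compose[OF this f] show ?thesis by (simp add: case_prod_beta')
qed

lemma measurable_cell_functional_eta:
  assumes f: "f \<in> borel \<Otimes>\<^sub>M closed_sets_space \<rightarrow>\<^sub>M R"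
  shows "(\<lambda>(x, \<omega>). f (fst x, centred_cell \<rho> x (\<eta> \<omega>))) \<in> (borel \<Otimes>\<^sub>M Q) \<Otimes>\<^sub>M M \<rightarrow>\<^sub>M R"
proof -
  note [measurable] = eta
  have "(\<lambda>p. (fst p, \<eta> (snd p))) \<in> (borel \<Otimes>\<^sub>M Q) \<Otimes>\<^sub>M M
     \<rightarrow>\<^sub>M (borel \<Otimes>\<^sub>M Q) \<Otimes>\<^sub>M config_space (borel \<Otimes>\<^sub>M Q)"
    by measurable
  from measurable_compose[OF this measurable_cell_functional[OF f measurable_ident]]
  show ?thesis by (simp add: case_prod_beta')
qed

lemma campbell_nn:
  fixes f :: "(real ^ 'd) \<times> (real ^ 'd) set \<Rightarrow> ennreal"
  assumes f: "f \<in> borel_measurable (borel \<Otimes>\<^sub>M closed_sets_space)"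
  shows "(\<integral>\<^sup>+\<omega>. (\<integral>\<^sup>+x. f (fst x, centred_cell \<rho> x (\<eta> \<omega>)) \<partial>count_space (\<eta> \<omega>)) \<partial>M)
    = (\<integral>\<^sup>+p. f p \<partial>(lborel \<Otimes>\<^sub>M \<kappa>))"
proof -
  have "(\<integral>\<^sup>+\<omega>. (\<integral>\<^sup>+x. f (fst x, centred_cell \<rho> x (\<eta> \<omega>)) \<partial>count_space (\<eta> \<omega>)) \<partial>M)
    = (\<integral>\<^sup>+\<omega>. (\<Sum>\<^sub>\<infinity>x \<in> \<eta> \<omega>. f (fst x, (\<lambda>y. y - fst x) ` cell \<rho> x (\<eta> \<omega>))) \<partial>M)"
    by (rule nn_integral_cong)
      (simp add: infsum_ennreal_eq_nn_integral[OF config_countable[OF eta_conf]] centred_cell_def)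
  also have "\<dots> = (\<integral>\<^sup>+x. (\<integral>\<^sup>+K. f (x, K) \<partial>\<kappa>) \<partial>lborel)"
    using typical f unfolding typical_cell_law_def by blast
  also have "\<dots> = (\<integral>\<^sup>+p. f p \<partial>(lborel \<Otimes>\<^sub>M \<kappa>))"
    by (rule kappa.nn_integral_fst) (use f in measurable)
  finally show ?thesis .
qed

text \<open>Where the sum does not converge absolutely the value is 0. For integrable
  \<open>f\<close> Campbell's formula makes this a null event.\<close>

definition cell_sum :: "((real ^ 'd) \<times> (real ^ 'd) set \<Rightarrow> real) \<Rightarrow> ((real ^ 'd) \<times> real) set \<Rightarrow> real" where
  "cell_sum f A = (\<Sum>\<^sub>\<infinity>x\<in>A. f (fst x, centred_cell \<rho> x A))"

text \<open>Campbell's formula for nonnegative functions is applied to \<open>\<bar>f\<bar>\<close>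
  and to the positive and negative parts. The first shows that the sum converges absolutely almost
  surely, so that it splits into the other two. The last inequality is what later bounds the
  difference of two estimators in L^1.\<close>

lemma
  fixes f :: "(real ^ 'd) \<times> (real ^ 'd) set \<Rightarrow> real"
  assumes f: "integrable (lborel \<Otimes>\<^sub>M \<kappa>) f"
  shows AE_cell_summable: "AE \<omega> in M. integrable (count_space (\<eta> \<omega>)) (\<lambda>x. f (fst x, centred_cell \<rho> x (\<eta> \<omega>)))"
    and integrable_cell_sum: "integrable M (\<lambda>\<omega>. cell_sum f (\<eta> \<omega>))"
    and integral_cell_sum: "(\<integral>\<omega>. cell_sum f (\<eta> \<omega>) \<partial>M) = (\<integral>p. f p \<partial>(lborel \<Otimes>\<^sub>M \<kappa>))"
    and nn_integral_cell_sum_le: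
      "(\<integral>\<^sup>+\<omega>. ennreal \<bar>cell_sum f (\<eta> \<omega>)\<bar> \<partial>M) \<le> (\<integral>\<^sup>+p. ennreal \<bar>f p\<bar> \<partial>(lborel \<Otimes>\<^sub>M \<kappa>))"
proof -
  have fm[measurable]: "f \<in> borel_measurable (borel \<Otimes>\<^sub>M closed_sets_space)"
    using borel_measurable_integrable[OF f] sets_kappa
    by (simp cong: measurable_cong_sets sets_pair_measure_cong)
  \<comment> \<open>Since \<open>ennreal\<close> maps negative numbers to 0, the identity and
    \<open>uminus\<close> in place of \<open>g\<close> yield the sums of the positive and of the
    negative parts.\<close>
  define s where "s g \<omega> = (\<integral>\<^sup>+x. ennreal (g (f (fst x, centred_cell \<rho> x (\<eta> \<omega>)))) \<partial>count_space (\<eta> \<omega>))"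
    for g :: "real \<Rightarrow> real" and \<omega>
  have s[measurable]: "s g \<in> borel_measurable M" if [measurable]: "g \<in> borel_measurable borel" for g
    unfolding s_def
    by (rule measurable_nn_integral_marked[OF Q eta],
      rule measurable_cell_functional_eta[where f="\<lambda>p. ennreal (g (f p))"]) simp
  have E: "(\<integral>\<^sup>+\<omega>. s g \<omega> \<partial>M) = (\<integral>\<^sup>+p. ennreal (g (f p)) \<partial>(lborel \<Otimes>\<^sub>M \<kappa>))"
    if [measurable]: "g \<in> borel_measurable borel" for g
    unfolding s_def by (rule campbell_nn[where f="\<lambda>p. ennreal (g (f p))"]) simp
  have fin: "(\<integral>\<^sup>+\<omega>. s abs \<omega> \<partial>M) < \<infinity>"
    using f E[of abs] by (simp add: integrable_iff_bounded)
  then have "AE \<omega> in M. s abs \<omega> \<noteq> \<infinity>"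
    by (intro nn_integral_PInf_AE s) auto
  then show AE: "AE \<omega> in M. integrable (count_space (\<eta> \<omega>)) (\<lambda>x. f (fst x, centred_cell \<rho> x (\<eta> \<omega>)))"
    by eventually_elim (simp add: integrable_iff_bounded s_def less_top)
  have m[measurable]: "(\<lambda>\<omega>. cell_sum f (\<eta> \<omega>)) \<in> borel_measurable M"
    unfolding cell_sum_def
    by (rule measurable_infsum_marked[OF Q eta], rule measurable_cell_functional_eta[OF fm])
  have le: "AE \<omega> in M. ennreal \<bar>cell_sum f (\<eta> \<omega>)\<bar> \<le> s abs \<omega>"
    using AE
  proof eventually_elim
    case (elim \<omega>)
    then show ?case unfolding cell_sum_def s_def infsum_eq_integral_count_space[OF elim]
      using integral_norm_bound_ennreal[OF elim] by simp
  qed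
  then show le': "(\<integral>\<^sup>+\<omega>. ennreal \<bar>cell_sum f (\<eta> \<omega>)\<bar> \<partial>M) \<le> (\<integral>\<^sup>+p. ennreal \<bar>f p\<bar> \<partial>(lborel \<Otimes>\<^sub>M \<kappa>))"
    using nn_integral_mono_AE[OF le] E[of abs] by simp
  show int: "integrable M (\<lambda>\<omega>. cell_sum f (\<eta> \<omega>))"
    using m order.strict_trans1[OF le'] f by (simp add: integrable_iff_bounded)
  have part: "integrable M (\<lambda>\<omega>. enn2real (s g \<omega>)) \<and>
      (\<integral>\<omega>. enn2real (s g \<omega>) \<partial>M) = enn2real (\<integral>\<^sup>+p. ennreal (g (f p)) \<partial>(lborel \<Otimes>\<^sub>M \<kappa>))"
    if [measurable]: "g \<in> borel_measurable borel" and g: "\<And>x. g x \<le> \<bar>x\<bar>" for g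
  proof -
    have "s g \<omega> \<le> s abs \<omega>" for \<omega>
      unfolding s_def by (intro nn_integral_mono ennreal_leI g)
    then have "(\<integral>\<^sup>+\<omega>. s g \<omega> \<partial>M) \<le> (\<integral>\<^sup>+\<omega>. s abs \<omega> \<partial>M)" by (intro nn_integral_mono)
    with fin have fin': "(\<integral>\<^sup>+\<omega>. s g \<omega> \<partial>M) < \<infinity>" by simp
    then have "AE \<omega> in M. s g \<omega> \<noteq> \<infinity>" by (intro nn_integral_PInf_AE) auto
    then have "(\<integral>\<^sup>+\<omega>. ennreal (enn2real (s g \<omega>)) \<partial>M) = (\<integral>\<^sup>+\<omega>. s g \<omega> \<partial>M)"
      by (intro nn_integral_cong_AE) (auto simp: less_top)
    then show ?thesis using fin' E[OF that(1)]
      by (auto simp: integrable_iff_bounded integral_eq_nn_integral)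
  qed
  have "AE \<omega> in M. cell_sum f (\<eta> \<omega>) = enn2real (s (\<lambda>x. x) \<omega>) - enn2real (s uminus \<omega>)"
    using AE
  proof eventually_elim
    case (elim \<omega>)
    then show ?case unfolding cell_sum_def s_def infsum_eq_integral_count_space[OF elim]
      by (rule real_lebesgue_integral_def)
  qed
  then have "(\<integral>\<omega>. cell_sum f (\<eta> \<omega>) \<partial>M) = (\<integral>\<omega>. enn2real (s (\<lambda>x. x) \<omega>) - enn2real (s uminus \<omega>) \<partial>M)"
    by (intro integral_cong_AE) auto
  also have "\<dots> = (\<integral>\<omega>. enn2real (s (\<lambda>x. x) \<omega>) \<partial>M) - (\<integral>\<omega>. enn2real (s uminus \<omega>) \<partial>M)"
    using part[of "\<lambda>x. x"] part[of uminus] by (intro Bochner_Integration.integral_diff) auto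
  also have "\<dots> = (\<integral>p. f p \<partial>(lborel \<Otimes>\<^sub>M \<kappa>))"
    unfolding real_lebesgue_integral_def[OF f] using part[of "\<lambda>x. x"] part[of uminus] by auto
  finally show "(\<integral>\<omega>. cell_sum f (\<eta> \<omega>) \<partial>M) = (\<integral>p. f p \<partial>(lborel \<Otimes>\<^sub>M \<kappa>))" .
qed

text \<open>\<open>h\<close> sees the cell and not its position, so Fubini separates it from the
  spatial integral of the weight. A bound \<open>c\<close> on the mass of the weight that is uniform
  in the cell reduces integrability to that of \<open>h\<close>.\<close>

lemma
  fixes h :: "(real ^ 'd) set \<Rightarrow> real" and u :: "(real ^ 'd) \<times> (real ^ 'd) set \<Rightarrow> real"
  assumes h: "integrable \<kappa> h"
    and u: "u \<in> borel_measurable (borel \<Otimes>\<^sub>M closed_sets_space)"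
    and c: "0 \<le> c" "\<And>K. closed K \<Longrightarrow> (\<integral>\<^sup>+x. ennreal \<bar>u (x, K)\<bar> \<partial>lborel) \<le> ennreal c"
  shows integrable_weighted: "integrable (lborel \<Otimes>\<^sub>M \<kappa>) (\<lambda>p. h (snd p) * u p)"
    and nn_integral_weighted: "(\<integral>\<^sup>+p. ennreal \<bar>h (snd p) * u p\<bar> \<partial>(lborel \<Otimes>\<^sub>M \<kappa>))
      = (\<integral>\<^sup>+K. ennreal \<bar>h K\<bar> * (\<integral>\<^sup>+x. ennreal \<bar>u (x, K)\<bar> \<partial>lborel) \<partial>\<kappa>)"
    and integral_weighted: "(\<integral>p. h (snd p) * u p \<partial>(lborel \<Otimes>\<^sub>M \<kappa>)) = (\<integral>K. h K * (\<integral>x. u (x, K) \<partial>lborel) \<partial>\<kappa>)"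
proof -
  have [measurable]: "h \<in> borel_measurable \<kappa>" using h by auto
  have [measurable]: "u \<in> borel_measurable (lborel \<Otimes>\<^sub>M \<kappa>)" using u by measurable
  have uK[measurable]: "(\<lambda>x. u (x, K)) \<in> borel_measurable lborel" if "closed K" for K
    using measurable_Pair1[of u lborel \<kappa> borel K] that by (simp add: space_kappa)
  have "(\<integral>\<^sup>+p. ennreal \<bar>h (snd p) * u p\<bar> \<partial>(lborel \<Otimes>\<^sub>M \<kappa>))
      = (\<integral>\<^sup>+K. (\<integral>\<^sup>+x. ennreal \<bar>h K * u (x, K)\<bar> \<partial>lborel) \<partial>\<kappa>)"
    by (subst lk.nn_integral_snd[symmetric]) (simp_all add: case_prod_beta')
  also have "\<dots> = (\<integral>\<^sup>+K. ennreal \<bar>h K\<bar> * (\<integral>\<^sup>+x. ennreal \<bar>u (x, K)\<bar> \<partial>lborel) \<partial>\<kappa>)"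
  proof (rule nn_integral_cong)
    fix K assume "K \<in> space \<kappa>"
    then show "(\<integral>\<^sup>+x. ennreal \<bar>h K * u (x, K)\<bar> \<partial>lborel) = ennreal \<bar>h K\<bar> * (\<integral>\<^sup>+x. ennreal \<bar>u (x, K)\<bar> \<partial>lborel)"
      by (subst nn_integral_cmult[symmetric]) (auto simp: space_kappa abs_mult ennreal_mult)
  qed
  finally show eq: "(\<integral>\<^sup>+p. ennreal \<bar>h (snd p) * u p\<bar> \<partial>(lborel \<Otimes>\<^sub>M \<kappa>))
      = (\<integral>\<^sup>+K. ennreal \<bar>h K\<bar> * (\<integral>\<^sup>+x. ennreal \<bar>u (x, K)\<bar> \<partial>lborel) \<partial>\<kappa>)" .
  also have "\<dots> \<le> (\<integral>\<^sup>+K. ennreal \<bar>h K\<bar> * ennreal c \<partial>\<kappa>)"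
    by (intro nn_integral_mono mult_left_mono c(2)) (auto simp: space_kappa)
  also have "\<dots> = (\<integral>\<^sup>+K. ennreal \<bar>h K\<bar> \<partial>\<kappa>) * ennreal c"
    by (rule nn_integral_multc) auto
  also have "\<dots> < \<infinity>"
    using h by (auto simp: integrable_iff_bounded ennreal_mult_less_top)
  finally show int: "integrable (lborel \<Otimes>\<^sub>M \<kappa>) (\<lambda>p. h (snd p) * u p)"
    by (simp add: integrable_iff_bounded)
  then have "(\<integral>p. h (snd p) * u p \<partial>(lborel \<Otimes>\<^sub>M \<kappa>)) = (\<integral>K. (\<integral>x. h K * u (x, K) \<partial>lborel) \<partial>\<kappa>)"
    using lk.integral_snd[of "\<lambda>x K. h K * u (x, K)"] by (simp add: case_prod_beta')
  then show "(\<integral>p. h (snd p) * u p \<partial>(lborel \<Otimes>\<^sub>M \<kappa>)) = (\<integral>K. h K * (\<integral>x. u (x, K) \<partial>lborel) \<partial>\<kappa>)"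
    by simp
qed

end

section \<open>The weights of the estimators\<close>

text \<open>For a point \<open>x\<close> with centred cell \<open>K\<close>, the cell lies in the
  window iff \<open>x\<close> is in the erosion. For fixed \<open>K\<close> the weight is therefore
  the uniform density on the erosion, cut down to \<open>D\<close>. The threshold \<open>t\<close>
  is 0 or \<open>L / 2\<close>, and \<open>D\<close> is the whole space or the window; the four
  combinations are the four estimators.\<close>

definition est_weight ::
    "real \<Rightarrow> real \<Rightarrow> (real ^ 'd) set \<Rightarrow> (real ^ 'd) \<times> (real ^ 'd) set \<Rightarrow> real" where
  "est_weight L t D p =
     (if t \<le> measure lborel (erosion (window L) (snd p))
      then indicator (erosion (window L) (snd p)) (fst p) * indicator D (fst p)
        / measure lborel (erosion (window L) (snd p)) else 0)"

lemma closed_window: "closed (window L :: (real ^ 'd) set)"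
proof -
  have "window L = (\<Inter>i. {x :: real ^ 'd. \<bar>x $ i\<bar> \<le> L powr (1 / real CARD('d)) / 2})"
    by (auto simp: window_def)
  moreover have "closed {x :: real ^ 'd. \<bar>x $ i\<bar> \<le> L powr (1 / real CARD('d)) / 2}" for i
    by (intro closed_Collect_le continuous_intros)
  ultimately show ?thesis by (auto intro!: closed_INT)
qed

lemma measurable_est_weight:
  assumes [measurable]: "D \<in> sets borel"
  shows "est_weight L t D \<in> borel_measurable (borel \<Otimes>\<^sub>M closed_sets_space)"
proof -
  note [measurable] = measurable_erosion_volume[OF closed_window[of L]]
    measurable_erosion_indicator[OF closed_window[of L], where 'b=real, unfolded case_prod_beta']
  show ?thesis unfolding est_weight_def[abs_def] by measurable
qed

lemma est_weight_nonneg: "0 \<le> est_weight L t D p"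
  by (simp add: est_weight_def)

text \<open>A uniform density has mass one. The value 0 covers null erosions, where division by zero
  gives zero, and the empty cell, whose erosion is the whole space and has \<open>measure\<close> 0
  by convention.\<close>

lemma nn_integral_est_weight:
  "(\<integral>\<^sup>+x. ennreal (est_weight L 0 UNIV (x, K)) \<partial>lborel)
     = (if 0 < measure lborel (erosion (window L) K) then 1 else 0)"
proof (cases "0 < measure lborel (erosion (window L) K)")
  case True
  let ?E = "erosion (window L) K" and ?V = "measure lborel (erosion (window L) K)"
  have fin: "emeasure lborel ?E = ennreal ?V"
    using True by (metis emeasure_eq_ennreal_measure less_irrefl measure_def enn2real_top)
  have "(\<integral>\<^sup>+x. ennreal (est_weight L 0 UNIV (x, K)) \<partial>lborel) = (\<integral>\<^sup>+x. ennreal (1 / ?V) * indicator ?E x \<partial>lborel)"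
    by (rule nn_integral_cong) (auto simp: est_weight_def indicator_def)
  also have "\<dots> = ennreal (1 / ?V) * emeasure lborel ?E"
    by (intro nn_integral_cmult_indicator) (auto intro!: borel_closed closed_erosion closed_window)
  also have "\<dots> = 1" using True by (simp add: fin ennreal_mult[symmetric])
  finally show ?thesis using True by simp
next
  case False
  then have "measure lborel (erosion (window L) K) = 0" by (simp add: zero_less_measure_iff)
  then show ?thesis by (simp add: est_weight_def)
qed

lemma nn_integral_est_weight_le: "(\<integral>\<^sup>+x. ennreal \<bar>est_weight L t D (x, K)\<bar> \<partial>lborel) \<le> ennreal 1"
proof -
  have "(\<integral>\<^sup>+x. ennreal \<bar>est_weight L t D (x, K)\<bar> \<partial>lborel) \<le> (\<integral>\<^sup>+x. ennreal (est_weight L 0 UNIV (x, K)) \<partial>lborel)"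
    by (intro nn_integral_mono ennreal_leI) (auto simp: est_weight_def indicator_def)
  also have "\<dots> \<le> ennreal 1" unfolding nn_integral_est_weight by simp
  finally show ?thesis .
qed

lemma integral_est_weight:
  "(\<integral>x. est_weight L 0 UNIV (x, K) \<partial>lborel) = (if 0 < measure lborel (erosion (window L) K) then 1 else 0)"
proof -
  have [measurable]: "erosion (window L) K \<in> sets borel"
    by (intro borel_closed closed_erosion closed_window)
  have "(\<lambda>x. est_weight L 0 UNIV (x, K)) \<in> borel_measurable lborel"
    unfolding est_weight_def by simp
  then show ?thesis
    by (subst integral_eq_nn_integral) (auto simp: nn_integral_est_weight est_weight_nonneg)
qed

lemma erosion_translate:
  fixes W :: "'a::ab_group_add set"
  shows "erosion W ((\<lambda>y. y + a) ` K) = (\<lambda>x. x - a) ` erosion W K"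
proof (intro set_eqI iffI)
  fix x assume "x \<in> erosion W ((\<lambda>y. y + a) ` K)"
  then have "x + a \<in> erosion W K" by (auto simp: erosion_def algebra_simps)
  then show "x \<in> (\<lambda>x. x - a) ` erosion W K" by (intro image_eqI[of _ _ "x + a"]) auto
qed (auto simp: erosion_def algebra_simps)

lemma measure_erosion_translate:
  fixes W :: "'a::euclidean_space set"
  assumes W: "closed W"
  shows "measure lborel (erosion W ((\<lambda>y. y + a) ` K)) = measure lborel (erosion W K)"
proof -
  have "measure lebesgue (erosion W ((\<lambda>y. y + a) ` K)) = measure lebesgue (erosion W K)"
    unfolding erosion_translate by (rule measure_translation_subtract)
  then show ?thesis using closed_erosion[OF W, THEN borel_closed] by (simp add: measure_completion)
qed

text \<open>Translation invariance of \<open>h\<close> and of volume lets both be evaluated at the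
  centred cell. Points outside \<open>D\<close> receive weight zero, so the sum may run over all of
  \<open>A\<close>, the form that Campbell's formula requires.\<close>

lemma infsum_est_eq:
  fixes h :: "(real ^ 'd) set \<Rightarrow> real" and D :: "(real ^ 'd) set"
  assumes w: "weight_function \<mu> \<rho>" and A: "A \<in> configurations (UNIV \<times> {0..\<mu>})"
    and inv: "\<And>K x. closed K \<Longrightarrow> h ((\<lambda>y. y + x) ` K) = h K"
  shows "(\<Sum>\<^sub>\<infinity>x \<in> A \<inter> (D \<times> {0..\<mu>}). if cell \<rho> x A \<subseteq> window L
          \<and> t \<le> measure lborel (erosion (window L) (cell \<rho> x A))
        then h (cell \<rho> x A) / measure lborel (erosion (window L) (cell \<rho> x A)) else 0)
    = (\<Sum>\<^sub>\<infinity>x\<in>A. h (centred_cell \<rho> x A) * est_weight L t D (fst x, centred_cell \<rho> x A))"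
proof (rule infsum_cong_neutral)
  fix x assume "x \<in> A - A \<inter> D \<times> {0..\<mu>}"
  then have "fst x \<notin> D" using config_subset[OF A] by (cases x) auto
  then show "h (centred_cell \<rho> x A) * est_weight L t D (fst x, centred_cell \<rho> x A) = 0"
    by (simp add: est_weight_def)
next
  fix x assume "x \<in> A \<inter> (D \<times> {0..\<mu>}) \<inter> A"
  then have x: "x \<in> UNIV \<times> {0..\<mu>}" "fst x \<in> D" by auto
  let ?K = "centred_cell \<rho> x A"
  have cl: "closed (cell \<rho> x A)" by (rule closed_cell[OF w x(1) config_subset[OF A]])
  have eq: "cell \<rho> x A = (\<lambda>y. y + fst x) ` ?K" by (simp add: centred_cell_def image_image)
  have "closed ?K"
    using closed_translation_subtract[OF cl, of "fst x"] by (simp add: centred_cell_def)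
  from inv[OF this, of "fst x"] have h: "h (cell \<rho> x A) = h ?K" by (simp only: eq)
  have V: "measure lborel (erosion (window L) (cell \<rho> x A)) = measure lborel (erosion (window L) ?K)"
    by (simp only: eq measure_erosion_translate[OF closed_window])
  have "cell \<rho> x A \<subseteq> window L \<longleftrightarrow> fst x \<in> erosion (window L) ?K"
    unfolding erosion_def mem_Collect_eq by (simp only: eq)
  then show "(if cell \<rho> x A \<subseteq> window L \<and> t \<le> measure lborel (erosion (window L) (cell \<rho> x A))
        then h (cell \<rho> x A) / measure lborel (erosion (window L) (cell \<rho> x A)) else 0)
      = h ?K * est_weight L t D (fst x, ?K)"
    unfolding h V est_weight_def using x(2) by (simp add: indicator_def)
qed auto

context typical_cell
begin

lemma estimator_eq_cell_sum:
  fixes h :: "(real ^ 'd) set \<Rightarrow> real"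
  assumes inv: "\<And>K x. closed K \<Longrightarrow> h ((\<lambda>y. y + x) ` K) = h K" and w: "\<omega> \<in> space M"
  shows "H_est \<rho> h L (\<eta> \<omega>) (\<eta> \<omega>) = cell_sum (\<lambda>p. h (snd p) * est_weight L 0 UNIV p) (\<eta> \<omega>)"
    and "H_est \<rho> h L (\<eta> \<omega> \<inter> marked_window \<mu> L) (\<eta> \<omega>)
      = cell_sum (\<lambda>p. h (snd p) * est_weight L 0 (window L) p) (\<eta> \<omega>)"
    and "H_hat_est \<rho> h L (\<eta> \<omega>) (\<eta> \<omega>) = cell_sum (\<lambda>p. h (snd p) * est_weight L (L / 2) UNIV p) (\<eta> \<omega>)"
    and "H_hat_est \<rho> h L (\<eta> \<omega> \<inter> marked_window \<mu> L) (\<eta> \<omega>)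
      = cell_sum (\<lambda>p. h (snd p) * est_weight L (L / 2) (window L) p) (\<eta> \<omega>)"
proof -
  have A: "\<eta> \<omega> \<inter> (UNIV \<times> {0..\<mu>}) = \<eta> \<omega>" using config_subset[OF eta_conf[OF w]] by auto
  note e = infsum_est_eq[OF weight eta_conf[OF w] inv]
  show "H_est \<rho> h L (\<eta> \<omega>) (\<eta> \<omega>) = cell_sum (\<lambda>p. h (snd p) * est_weight L 0 UNIV p) (\<eta> \<omega>)"
    using e[where D=UNIV and L=L and t=0] unfolding A by (simp add: H_est_def cell_sum_def)
  show "H_est \<rho> h L (\<eta> \<omega> \<inter> marked_window \<mu> L) (\<eta> \<omega>)
      = cell_sum (\<lambda>p. h (snd p) * est_weight L 0 (window L) p) (\<eta> \<omega>)"
    using e[where D="window L" and L=L and t=0] by (simp add: H_est_def cell_sum_def marked_window_def)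
  show "H_hat_est \<rho> h L (\<eta> \<omega>) (\<eta> \<omega>) = cell_sum (\<lambda>p. h (snd p) * est_weight L (L / 2) UNIV p) (\<eta> \<omega>)"
    using e[where D=UNIV and L=L and t="L/2"] unfolding A by (simp add: H_hat_est_def cell_sum_def)
  show "H_hat_est \<rho> h L (\<eta> \<omega> \<inter> marked_window \<mu> L) (\<eta> \<omega>)
      = cell_sum (\<lambda>p. h (snd p) * est_weight L (L / 2) (window L) p) (\<eta> \<omega>)"
    using e[where D="window L" and L=L and t="L/2"] by (simp add: H_hat_est_def cell_sum_def marked_window_def)
qed

lemma integrable_estimator:
  assumes "integrable \<kappa> h" "D \<in> sets borel"
  shows "integrable (lborel \<Otimes>\<^sub>M \<kappa>) (\<lambda>p. h (snd p) * est_weight L t D p)"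
  using assms by (intro integrable_weighted[where c=1] measurable_est_weight nn_integral_est_weight_le) auto

text \<open>The inner integral of the weight is the indicator that the erosion has positive volume.
  The expectation is therefore the mean of \<open>h\<close> over these cells, and equals the full
  mean when the other cells contribute nothing.\<close>

lemma unbiased:
  fixes h :: "(real ^ 'd) set \<Rightarrow> real"
  assumes h: "integrable \<kappa> h" and inv: "\<And>K x. closed K \<Longrightarrow> h ((\<lambda>y. y + x) ` K) = h K"
  shows "integrable M (\<lambda>\<omega>. H_est \<rho> h L (\<eta> \<omega>) (\<eta> \<omega>))"
    and "(\<integral>\<omega>. H_est \<rho> h L (\<eta> \<omega>) (\<eta> \<omega>) \<partial>M)
      = (\<integral>K. (if 0 < measure lborel (erosion (window L) K) then h K else 0) \<partial>\<kappa>)"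
proof -
  note int = integrable_estimator[OF h, where D=UNIV and L=L and t=0, simplified]
  show "integrable M (\<lambda>\<omega>. H_est \<rho> h L (\<eta> \<omega>) (\<eta> \<omega>))"
    using integrable_cell_sum[OF int]
    by (rule Bochner_Integration.integrable_cong[THEN iffD1, OF refl, rotated]) (simp add: estimator_eq_cell_sum[OF inv])
  have "(\<integral>\<omega>. H_est \<rho> h L (\<eta> \<omega>) (\<eta> \<omega>) \<partial>M) = (\<integral>\<omega>. cell_sum (\<lambda>p. h (snd p) * est_weight L 0 UNIV p) (\<eta> \<omega>) \<partial>M)"
    by (rule Bochner_Integration.integral_cong) (simp_all add: estimator_eq_cell_sum[OF inv])
  also have "\<dots> = (\<integral>K. h K * (\<integral>x. est_weight L 0 UNIV (x, K) \<partial>lborel) \<partial>\<kappa>)"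
    unfolding integral_cell_sum[OF int]
    by (rule integral_weighted[OF h, where c=1])
      (auto intro: measurable_est_weight order_trans[OF nn_integral_est_weight_le])
  also have "\<dots> = (\<integral>K. (if 0 < measure lborel (erosion (window L) K) then h K else 0) \<partial>\<kappa>)"
    by (rule Bochner_Integration.integral_cong) (auto simp: integral_est_weight)
  finally show "(\<integral>\<omega>. H_est \<rho> h L (\<eta> \<omega>) (\<eta> \<omega>) \<partial>M)
      = (\<integral>K. (if 0 < measure lborel (erosion (window L) K) then h K else 0) \<partial>\<kappa>)" .
qed

end

section \<open>Averages over windows\<close>

lemma emeasure_window:
  assumes "0 < L"
  shows "emeasure lborel (window L :: (real ^ 'd) set) = ennreal L"
proof -
  define s where "s = L powr (1 / real CARD('d))"
  have s: "0 < s" using assms by (simp add: s_def)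
  have eq: "window L = cbox (\<chi> i. - s / 2) (\<chi> i. s / 2 :: real ^ 'd)"
  proof (rule set_eqI)
    fix x :: "real ^ 'd"
    have "\<bar>x $ i\<bar> \<le> s / 2 \<longleftrightarrow> - s / 2 \<le> x $ i \<and> x $ i \<le> s / 2" for i by linarith
    then show "x \<in> window L \<longleftrightarrow> x \<in> cbox (\<chi> i. - s / 2) (\<chi> i. s / 2)"
      by (simp only: window_def mem_box_cart s_def[symmetric] mem_Collect_eq vec_lambda_beta)
  qed
  have "(\<chi> i. 0) \<in> cbox (\<chi> i. - s / 2) (\<chi> i. s / 2 :: real ^ 'd)"
    using s by (simp add: mem_box_cart)
  then have ne: "cbox (\<chi> i. - s / 2) (\<chi> i. s / 2 :: real ^ 'd) \<noteq> {}" by blast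
  have "measure lborel (window L :: (real ^ 'd) set) = (\<Prod>i\<in>(UNIV :: 'd set). s)"
    unfolding eq content_cbox_cart[OF ne] by simp
  also have "\<dots> = L" using assms by (simp add: s_def powr_realpow[symmetric] powr_powr)
  finally show ?thesis
    using emeasure_eq_ennreal_measure[of lborel "window L :: (real ^ 'd) set"]
      emeasure_lborel_cbox_finite[of "\<chi> i. - s / 2" "\<chi> i. s / 2 :: real ^ 'd"]
    by (simp add: eq less_top)
qed

abbreviation window_law :: "real \<Rightarrow> (real ^ 'd) measure" where
  "window_law L \<equiv> uniform_measure lborel (window L)"

lemma window_borel[measurable]: "window L \<in> sets borel"
  by (rule borel_closed[OF closed_window])

lemma prob_space_window_law: "0 < L \<Longrightarrow> prob_space (window_law L :: (real ^ 'd) measure)"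
  by (rule prob_space_uniform_measure) (simp_all add: emeasure_window)

text \<open>The proportion of the window within a fixed distance of a point is of order
  \<open>1 / L\<close> uniformly in the point. This is the origin of the rate in the variance
  bound.\<close>

lemma window_law_cball_le:
  assumes "0 < L" "0 \<le> R"
  shows "emeasure (window_law L) (cball (z :: real ^ 'd) R) \<le> ennreal (measure lborel (cball (0 :: real ^ 'd) R) / L)"
proof -
  have "emeasure (window_law L) (cball z R) = emeasure lborel (window L \<inter> cball z R) / ennreal L"
    using assms by (subst emeasure_uniform_measure) (auto simp: emeasure_window)
  also have "\<dots> \<le> emeasure lborel (cball z R) / ennreal L"
    by (intro divide_right_mono_ennreal emeasure_mono) auto
  also have "\<dots> = ennreal (measure lborel (cball (0 :: real ^ 'd) R) / L)"
    using assms by (simp add: emeasure_cball content_cball divide_ennreal unit_ball_vol_nonneg)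
  finally show ?thesis .
qed

lemma tendsto_0_ennrealI:
  fixes F :: "'b \<Rightarrow> ennreal"
  assumes "\<And>e::real. 0 < e \<Longrightarrow> eventually (\<lambda>x. F x \<le> ennreal e) A"
  shows "(F \<longlongrightarrow> 0) A"
proof (rule order_tendstoI)
  fix a :: ennreal assume "0 < a"
  then obtain b where b: "0 < b" "b < a" using dense by blast
  then obtain e where "b = ennreal e" "0 \<le> e" by (cases b) auto
  with b have "0 < e" by auto
  then show "eventually (\<lambda>x. F x < a) A"
    using assms[of e] b \<open>b = ennreal e\<close> by (auto elim!: eventually_mono)
qed auto

lemma eventually_le_of_tendsto_0:
  fixes F :: "'b \<Rightarrow> ennreal"
  assumes "(F \<longlongrightarrow> 0) A" "0 < (e::real)"
  shows "eventually (\<lambda>x. F x \<le> ennreal e) A"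
  using order_tendstoD(2)[OF assms(1), of "ennreal e"] assms(2)
  by (auto elim!: eventually_mono intro: less_imp_le)

text \<open>Joint measurability serves Fubini over the window; invariance under every single
  \<open>T z\<close> makes window means contractions in L^1 that preserve the expectation.\<close>

locale measurable_flow = prob_space N
  for N :: "'a measure" +
  fixes T :: "real ^ 'd \<Rightarrow> 'a \<Rightarrow> 'a"
  assumes T: "(\<lambda>(z, a). T z a) \<in> borel \<Otimes>\<^sub>M N \<rightarrow>\<^sub>M N"
    and inv: "\<And>z. distr N N (T z) = N"
begin

definition window_mean :: "real \<Rightarrow> ('a \<Rightarrow> real) \<Rightarrow> 'a \<Rightarrow> real" where
  "window_mean L f a = (\<integral>z. f (T z a) \<partial>window_law L)"

definition deviation :: "('a \<Rightarrow> real) \<Rightarrow> real \<Rightarrow> ennreal" where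
  "deviation f L = (\<integral>\<^sup>+a. ennreal \<bar>window_mean L f a - expectation f\<bar> \<partial>N)"

lemma T_z[measurable]: "T z \<in> N \<rightarrow>\<^sub>M N"
  using measurable_compose[OF measurable_Pair1' T, of z] by simp

lemma measurable_T_pair:
  assumes "f \<in> N \<rightarrow>\<^sub>M R"
  shows "(\<lambda>(a, z). f (T z a)) \<in> N \<Otimes>\<^sub>M window_law L \<rightarrow>\<^sub>M R"
proof -
  have "(\<lambda>p. (\<lambda>(z, a). T z a) (snd p, fst p)) \<in> N \<Otimes>\<^sub>M window_law L \<rightarrow>\<^sub>M N"
    by (rule measurable_compose[OF _ T]) measurable
  then show ?thesis using assms by (simp add: case_prod_beta')
qed

lemma nn_integral_T:
  assumes "f \<in> borel_measurable N"
  shows "(\<integral>\<^sup>+a. f (T z a) \<partial>N) = (\<integral>\<^sup>+a. (f a :: ennreal) \<partial>N)"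
  using nn_integral_distr[OF T_z[of z], of f] assms by (simp add: inv)

lemma nn_integral_T_window:
  assumes L: "0 < L" and f: "f \<in> borel_measurable N"
  shows "(\<integral>\<^sup>+a. (\<integral>\<^sup>+z. f (T z a) \<partial>window_law L) \<partial>N) = (\<integral>\<^sup>+a. (f a :: ennreal) \<partial>N)"
proof -
  interpret U: prob_space "window_law L :: (real ^ 'd) measure" by (rule prob_space_window_law[OF L])
  interpret NU: pair_sigma_finite N "window_law L :: (real ^ 'd) measure" ..
  have "(\<integral>\<^sup>+a. (\<integral>\<^sup>+z. f (T z a) \<partial>window_law L) \<partial>N) = (\<integral>\<^sup>+z. (\<integral>\<^sup>+a. f (T z a) \<partial>N) \<partial>window_law L)"
    using NU.Fubini'[OF measurable_T_pair[OF f]] by simp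
  then show ?thesis using f L by (simp add: nn_integral_T emeasure_window divide_ennreal)
qed

lemma integrable_T_pair:
  assumes L: "0 < L" and f: "integrable N f"
  shows "integrable (N \<Otimes>\<^sub>M window_law L) (\<lambda>(a, z). f (T z a) :: real)"
proof -
  interpret U: prob_space "window_law L :: (real ^ 'd) measure" by (rule prob_space_window_law[OF L])
  interpret NU: pair_sigma_finite N "window_law L :: (real ^ 'd) measure" ..
  have fm[measurable]: "f \<in> borel_measurable N" using f by auto
  have "(\<integral>\<^sup>+p. ennreal (norm ((\<lambda>(a, z). f (T z a)) p)) \<partial>(N \<Otimes>\<^sub>M window_law L))
     = (\<integral>\<^sup>+a. (\<integral>\<^sup>+z. ennreal \<bar>f (T z a)\<bar> \<partial>window_law L) \<partial>N)"
    using measurable_T_pair[of "\<lambda>a. ennreal \<bar>f a\<bar>" borel L]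
    by (subst U.nn_integral_fst[symmetric]) (simp_all add: case_prod_beta')
  also have "\<dots> = (\<integral>\<^sup>+a. ennreal \<bar>f a\<bar> \<partial>N)"
    by (rule nn_integral_T_window[OF L]) simp
  also have "\<dots> < \<infinity>" using f by (simp add: integrable_iff_bounded)
  finally show ?thesis using measurable_T_pair[OF fm, of L] by (simp add: integrable_iff_bounded)
qed

lemma
  assumes L: "0 < L" and f: "integrable N f"
  shows AE_integrable_T: "AE a in N. integrable (window_law L) (\<lambda>z. f (T z a))"
    and integrable_window_mean: "integrable N (window_mean L f)"
    and integral_window_mean: "expectation (window_mean L f) = expectation f"
proof -
  interpret U: prob_space "window_law L :: (real ^ 'd) measure" by (rule prob_space_window_law[OF L])
  interpret NU: pair_sigma_finite N "window_law L :: (real ^ 'd) measure" ..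
  note int = integrable_T_pair[OF L f]
  show "AE a in N. integrable (window_law L) (\<lambda>z. f (T z a))"
    using NU.AE_integrable_fst[OF int] by simp
  show i: "integrable N (window_mean L f)"
    using NU.integrable_fst[OF int] by (simp add: window_mean_def[abs_def])
  have "expectation (window_mean L f) = (\<integral>z. (\<integral>a. f (T z a) \<partial>N) \<partial>window_law L)"
    using NU.Fubini_integral[OF int] by (simp add: window_mean_def[abs_def])
  also have "(\<lambda>z. \<integral>a. f (T z a) \<partial>N) = (\<lambda>z. expectation f)"
    using integral_distr[OF T_z borel_measurable_integrable[OF f]] by (simp add: inv)
  finally show "expectation (window_mean L f) = expectation f" using U.prob_space by simp
qed

text \<open>Replacing \<open>f\<close> by \<open>g\<close> changes the window mean and the
  expectation each by at most the L^1 distance of the two, the former by Fubini and invariance;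
  hence the factor 2. The bound is uniform in \<open>L\<close>.\<close>

lemma deviation_le:
  assumes L: "0 < L" and f: "integrable N f" and g: "integrable N g"
  shows "deviation f L \<le> deviation g L + 2 * (\<integral>\<^sup>+a. ennreal \<bar>f a - g a\<bar> \<partial>N)"
proof -
  note [measurable] = borel_measurable_integrable[OF f] borel_measurable_integrable[OF g]
    borel_measurable_integrable[OF integrable_window_mean[OF L f]]
    borel_measurable_integrable[OF integrable_window_mean[OF L g]]
  have fg: "integrable N (\<lambda>a. f a - g a)" using f g by simp
  let ?d = "\<integral>\<^sup>+a. ennreal \<bar>f a - g a\<bar> \<partial>N"
  have Um: "(\<lambda>a. \<integral>\<^sup>+z. ennreal \<bar>f (T z a) - g (T z a)\<bar> \<partial>window_law L) \<in> borel_measurable N"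
  proof -
    interpret U: prob_space "window_law L :: (real ^ 'd) measure" by (rule prob_space_window_law[OF L])
    show ?thesis
      using U.borel_measurable_nn_integral_fst[OF measurable_T_pair[of "\<lambda>a. ennreal \<bar>f a - g a\<bar>" borel]]
      by simp
  qed
  have "AE a in N. ennreal \<bar>window_mean L f a - expectation f\<bar> \<le>
      ennreal \<bar>window_mean L g a - expectation g\<bar> + ((\<integral>\<^sup>+z. ennreal \<bar>f (T z a) - g (T z a)\<bar> \<partial>window_law L) + ?d)"
    using AE_integrable_T[OF L f] AE_integrable_T[OF L g]
  proof eventually_elim
    case (elim a)
    have fg': "integrable (window_law L) (\<lambda>z. f (T z a) - g (T z a))" using elim by simp
    have "window_mean L f a - window_mean L g a = (\<integral>z. f (T z a) - g (T z a) \<partial>window_law L)"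
      using elim by (simp add: window_mean_def)
    then have 1: "ennreal \<bar>window_mean L f a - window_mean L g a\<bar>
        \<le> (\<integral>\<^sup>+z. ennreal \<bar>f (T z a) - g (T z a)\<bar> \<partial>window_law L)"
      using integral_norm_bound_ennreal[OF fg'] by simp
    have 2: "ennreal \<bar>expectation f - expectation g\<bar> \<le> ?d"
      using integral_norm_bound_ennreal[OF fg] f g by simp
    have "\<bar>window_mean L f a - expectation f\<bar> \<le> \<bar>window_mean L g a - expectation g\<bar>
       + (\<bar>window_mean L f a - window_mean L g a\<bar> + \<bar>expectation f - expectation g\<bar>)" by linarith
    then have "ennreal \<bar>window_mean L f a - expectation f\<bar> \<le> ennreal \<bar>window_mean L g a - expectation g\<bar>
       + (ennreal \<bar>window_mean L f a - window_mean L g a\<bar> + ennreal \<bar>expectation f - expectation g\<bar>)"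
      by (simp add: ennreal_plus[symmetric] ennreal_leI del: ennreal_plus)
    also have "\<dots> \<le> ennreal \<bar>window_mean L g a - expectation g\<bar>
       + ((\<integral>\<^sup>+z. ennreal \<bar>f (T z a) - g (T z a)\<bar> \<partial>window_law L) + ?d)"
      by (intro add_left_mono add_mono 1 2)
    finally show ?case .
  qed
  then have "deviation f L \<le> (\<integral>\<^sup>+a. ennreal \<bar>window_mean L g a - expectation g\<bar>
     + ((\<integral>\<^sup>+z. ennreal \<bar>f (T z a) - g (T z a)\<bar> \<partial>window_law L) + ?d) \<partial>N)"
    unfolding deviation_def by (rule nn_integral_mono_AE)
  also have "\<dots> = deviation g L + ((\<integral>\<^sup>+a. (\<integral>\<^sup>+z. ennreal \<bar>f (T z a) - g (T z a)\<bar> \<partial>window_law L) \<partial>N) + ?d)"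
    using Um by (simp add: nn_integral_add deviation_def emeasure_space_1)
  also have "(\<integral>\<^sup>+a. (\<integral>\<^sup>+z. ennreal \<bar>f (T z a) - g (T z a)\<bar> \<partial>window_law L) \<partial>N) = ?d"
    by (rule nn_integral_T_window[OF L, where f="\<lambda>a. ennreal \<bar>f a - g a\<bar>"]) simp
  finally show ?thesis by (simp add: mult_2)
qed

definition mean_ergodic :: "('a \<Rightarrow> real) \<Rightarrow> bool" where
  "mean_ergodic f \<longleftrightarrow> (deviation f \<longlongrightarrow> 0) at_top"

text \<open>Because the bound for exchanging functions is uniform in \<open>L\<close>, mean ergodic
  functions are closed in L^1: one third of the error is left to \<open>g\<close>, two thirds to the
  exchange.\<close>

lemma mean_ergodic_approx:
  assumes f: "integrable N f"
    and g: "\<And>e::real. 0 < e \<Longrightarrow> \<exists>g. integrable N g \<and> mean_ergodic g \<and> (\<integral>\<^sup>+a. ennreal \<bar>f a - g a\<bar> \<partial>N) \<le> ennreal e"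
  shows "mean_ergodic f"
  unfolding mean_ergodic_def
proof (rule tendsto_0_ennrealI)
  fix e :: real assume e: "0 < e"
  then have e3: "0 < e / 3" by simp
  obtain g where g: "integrable N g" "mean_ergodic g" "(\<integral>\<^sup>+a. ennreal \<bar>f a - g a\<bar> \<partial>N) \<le> ennreal (e / 3)"
    using g[OF e3] by blast
  from eventually_le_of_tendsto_0[OF g(2)[unfolded mean_ergodic_def] e3] eventually_gt_at_top[of 0]
  show "eventually (\<lambda>L. deviation f L \<le> ennreal e) at_top"
  proof eventually_elim
    case (elim L)
    have "deviation f L \<le> deviation g L + 2 * (\<integral>\<^sup>+a. ennreal \<bar>f a - g a\<bar> \<partial>N)"
      by (rule deviation_le[OF elim(2) f g(1)])
    also have "\<dots> \<le> ennreal (e / 3) + 2 * ennreal (e / 3)"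
      by (intro add_mono elim mult_left_mono g) auto
    also have "\<dots> = ennreal (e / 3 + (e / 3 + e / 3))"
      using less_imp_le[OF e3] by (simp only: mult_2 ennreal_plus add_nonneg_nonneg)
    also have "\<dots> = ennreal e" by simp
    finally show ?case .
  qed
qed

lemma mean_ergodic_add:
  assumes f: "integrable N f" "mean_ergodic f" and g: "integrable N g" "mean_ergodic g"
  shows "mean_ergodic (\<lambda>a. f a + g a)"
  unfolding mean_ergodic_def
proof (rule tendsto_0_ennrealI)
  fix e :: real assume e: "0 < e"
  then have e2: "0 < e / 2" by simp
  from eventually_le_of_tendsto_0[OF f(2)[unfolded mean_ergodic_def] e2]
    eventually_le_of_tendsto_0[OF g(2)[unfolded mean_ergodic_def] e2] eventually_gt_at_top[of 0]
  show "eventually (\<lambda>L. deviation (\<lambda>a. f a + g a) L \<le> ennreal e) at_top"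
  proof eventually_elim
    case (elim L)
    note [measurable] = borel_measurable_integrable[OF integrable_window_mean[OF elim(3) f(1)]]
      borel_measurable_integrable[OF integrable_window_mean[OF elim(3) g(1)]]
    have "AE a in N. ennreal \<bar>window_mean L (\<lambda>a. f a + g a) a - expectation (\<lambda>a. f a + g a)\<bar>
      \<le> ennreal \<bar>window_mean L f a - expectation f\<bar> + ennreal \<bar>window_mean L g a - expectation g\<bar>"
      using AE_integrable_T[OF elim(3) f(1)] AE_integrable_T[OF elim(3) g(1)]
    proof eventually_elim
      case (elim a)
      have "\<bar>window_mean L (\<lambda>a. f a + g a) a - expectation (\<lambda>a. f a + g a)\<bar>
        \<le> \<bar>window_mean L f a - expectation f\<bar> + \<bar>window_mean L g a - expectation g\<bar>"
        using elim f(1) g(1) by (simp add: window_mean_def)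
      from ennreal_leI[OF this] show ?case by (simp only: ennreal_plus abs_ge_zero)
    qed
    then have "deviation (\<lambda>a. f a + g a) L \<le> deviation f L + deviation g L"
      unfolding deviation_def by (subst nn_integral_add[symmetric]) (auto intro: nn_integral_mono_AE)
    also have "\<dots> \<le> ennreal (e / 2) + ennreal (e / 2)" by (intro add_mono elim)
    also have "\<dots> = ennreal (e / 2 + e / 2)"
      using less_imp_le[OF e2] by (simp only: ennreal_plus)
    also have "\<dots> = ennreal e" by simp
    finally show ?case .
  qed
qed

lemma mean_ergodic_scale:
  assumes f: "integrable N f" "mean_ergodic f"
  shows "mean_ergodic (\<lambda>a. c * f a)"
  unfolding mean_ergodic_def
proof (rule tendsto_0_ennrealI)
  fix e :: real assume e: "0 < e"
  \<comment> \<open>The summand 1 keeps the quotient meaningful for \<open>c = 0\<close>.\<close>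
  then have e': "0 < e / (1 + \<bar>c\<bar>)" by simp
  from eventually_le_of_tendsto_0[OF f(2)[unfolded mean_ergodic_def] e'] eventually_gt_at_top[of 0]
  show "eventually (\<lambda>L. deviation (\<lambda>a. c * f a) L \<le> ennreal e) at_top"
  proof eventually_elim
    case (elim L)
    note [measurable] = borel_measurable_integrable[OF integrable_window_mean[OF elim(2) f(1)]]
    have "deviation (\<lambda>a. c * f a) L = (\<integral>\<^sup>+a. ennreal \<bar>c\<bar> * ennreal \<bar>window_mean L f a - expectation f\<bar> \<partial>N)"
      unfolding deviation_def window_mean_def
      by (intro nn_integral_cong) (simp add: ennreal_mult[symmetric] abs_mult[symmetric] right_diff_distrib)
    also have "\<dots> = ennreal \<bar>c\<bar> * deviation f L"
      unfolding deviation_def by (rule nn_integral_cmult) simp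
    also have "\<dots> \<le> ennreal \<bar>c\<bar> * ennreal (e / (1 + \<bar>c\<bar>))" by (intro mult_left_mono elim) auto
    also have "\<dots> \<le> ennreal e"
      using e by (simp add: ennreal_mult[symmetric] field_simps ennreal_leI)
    finally show ?case .
  qed
qed

lemma mean_ergodic_const: "mean_ergodic (\<lambda>a. c)"
  unfolding mean_ergodic_def
proof (rule tendsto_0_ennrealI)
  fix e :: real assume "0 < e"
  show "eventually (\<lambda>L. deviation (\<lambda>a. c) L \<le> ennreal e) at_top"
    using eventually_gt_at_top[of 0]
  proof eventually_elim
    case (elim L)
    interpret U: prob_space "window_law L :: (real ^ 'd) measure" by (rule prob_space_window_law[OF elim])
    have "U.prob UNIV = 1" using U.prob_space by simp
    then show ?case by (simp add: deviation_def window_mean_def prob_space)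
  qed
qed

lemma mean_ergodic_cong:
  assumes "integrable N f" "\<And>a. a \<in> space N \<Longrightarrow> f a = g a" "mean_ergodic g"
  shows "mean_ergodic f"
proof (rule mean_ergodic_approx[OF assms(1)])
  fix e :: real assume "0 < e"
  have "integrable N g" using assms(1,2) by (simp cong: Bochner_Integration.integrable_cong)
  moreover have "(\<integral>\<^sup>+a. ennreal \<bar>f a - g a\<bar> \<partial>N) = 0"
    using assms(2) by (simp cong: nn_integral_cong)
  ultimately show "\<exists>g. integrable N g \<and> mean_ergodic g \<and> (\<integral>\<^sup>+a. ennreal \<bar>f a - g a\<bar> \<partial>N) \<le> ennreal e"
    using assms(3) by auto
qed

text \<open>For a mixing event the correlations vanish beyond a finite range, so that the variance of the
  window mean is of the order \<open>1 / L\<close>.\<close>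

lemma mean_ergodic_mixing_event:
  assumes V: "V \<in> sets N"
    and mix: "\<And>z w. R < norm (z - w) \<Longrightarrow> prob {a \<in> space N. T z a \<in> V \<and> T w a \<in> V} = (prob V)\<^sup>2"
  shows "mean_ergodic (indicator V)"
  unfolding mean_ergodic_def
proof (rule tendsto_0_ennrealI)
  fix e :: real assume e: "0 < e"
  \<comment> \<open>The range \<open>R\<close> may be negative, whereas the volume bound for balls
    asks for a nonnegative radius.\<close>
  define R' where "R' = max R 0"
  define C where "C = measure lborel (cball (0 :: real ^ 'd) R')"
  have C: "0 \<le> C" by (simp add: C_def)
  let ?p = "prob V" and ?f = "indicator V :: 'a \<Rightarrow> real"
  have f: "integrable N ?f" using V by (simp add: integrable_real_indicator emeasure_eq_measure)
  have Ef: "expectation ?f = ?p" using V by simp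
  \<comment> \<open>From \<open>4 * C / e\<^sup>2\<close> on, the variance bound
    \<open>C / L\<close> is at most \<open>e\<^sup>2 / 4\<close>; the added 1 makes \<open>L\<close>
    positive even if the quotient vanishes.\<close>
  show "eventually (\<lambda>L. deviation ?f L \<le> ennreal e) at_top"
    using eventually_ge_at_top[of "4 * C / e\<^sup>2 + 1"]
  proof eventually_elim
    case (elim L)
    have L: "0 < L" using elim C e by (smt (verit) divide_nonneg_nonneg zero_le_power2)
    interpret U: prob_space "window_law L :: (real ^ 'd) measure" by (rule prob_space_window_law[OF L])
    interpret UU: pair_prob_space "window_law L :: (real ^ 'd) measure" "window_law L :: (real ^ 'd) measure" ..
    let ?UU = "window_law L \<Otimes>\<^sub>M window_law L :: ((real ^ 'd) \<times> (real ^ 'd)) measure"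
    interpret NUU: pair_sigma_finite N ?UU ..
    let ?X = "window_mean L ?f"
    note Xi = integrable_window_mean[OF L f]
    note [measurable] = borel_measurable_integrable[OF Xi]
    have Tm: "(\<lambda>z. indicator V (T z a) :: real) \<in> borel_measurable (window_law L)" if "a \<in> space N" for a
    proof -
      have "(\<lambda>z. T z a) \<in> borel \<rightarrow>\<^sub>M N" using measurable_compose[OF measurable_Pair2'[OF that] T] by simp
      from measurable_compose[OF this borel_measurable_indicator[OF V]] show ?thesis
        by (simp cong: measurable_cong_sets)
    qed
    have Tm': "(\<lambda>z. ennreal (indicator V (T z a))) \<in> borel_measurable (window_law L)" if "a \<in> space N" for a
      using Tm[OF that] by measurable
    have X: "ennreal (?X a) = (\<integral>\<^sup>+z. indicator V (T z a) \<partial>window_law L)" if "a \<in> space N" for a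
    proof -
      have "ennreal (?X a) = (\<integral>\<^sup>+z. ennreal (indicator V (T z a)) \<partial>window_law L)"
        unfolding window_mean_def
        using Tm[OF that] by (intro nn_integral_eq_integral[symmetric] U.integrable_const_bound[where B=1]) auto
      then show ?thesis by (simp add: ennreal_indicator)
    qed
    have X01: "0 \<le> ?X a" "?X a \<le> 1" if "a \<in> space N" for a
    proof -
      show "0 \<le> ?X a" unfolding window_mean_def by (rule integral_nonneg_AE) auto
      have "ennreal (?X a) \<le> (\<integral>\<^sup>+z. 1 \<partial>(window_law L :: (real ^ 'd) measure))" unfolding X[OF that]
        by (rule nn_integral_mono) (auto simp: indicator_def)
      then show "?X a \<le> 1" using L by (simp add: emeasure_window divide_ennreal)
    qed
    have X2i: "integrable N (\<lambda>a. (?X a)\<^sup>2)"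
      using X01 by (intro integrable_const_bound[where B=1] AE_I2) (auto simp: power_le_one)
    have "ennreal (\<integral>a. (?X a)\<^sup>2 \<partial>N) = (\<integral>\<^sup>+a. ennreal ((?X a)\<^sup>2) \<partial>N)"
      by (rule nn_integral_eq_integral[symmetric, OF X2i]) auto
    \<comment> \<open>The square of the mean over one shift is the mean over two independent shifts,
      which turns the second moment into probabilities of joint events.\<close>
    also have "\<dots> = (\<integral>\<^sup>+a. (\<integral>\<^sup>+p. indicator V (T (fst p) a) * indicator V (T (snd p) a) \<partial>?UU) \<partial>N)"
    proof (rule nn_integral_cong)
      fix a assume a: "a \<in> space N"
      have [measurable]: "(\<lambda>z. indicator V (T z a) :: ennreal) \<in> borel_measurable (window_law L)"
        using Tm'[OF a] by (simp add: ennreal_indicator)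
      have "ennreal ((?X a)\<^sup>2) = ennreal (?X a) * ennreal (?X a)"
        using X01(1)[OF a] by (simp add: power2_eq_square ennreal_mult)
      also have "\<dots> = (\<integral>\<^sup>+z. (\<integral>\<^sup>+w. indicator V (T z a) * indicator V (T w a) \<partial>window_law L) \<partial>window_law L)"
        unfolding X[OF a] by (simp add: nn_integral_cmult nn_integral_multc)
      also have "\<dots> = (\<integral>\<^sup>+p. indicator V (T (fst p) a) * indicator V (T (snd p) a) \<partial>?UU)"
        by (subst U.nn_integral_fst[symmetric]) simp_all
      finally show "ennreal ((?X a)\<^sup>2) = (\<integral>\<^sup>+p. indicator V (T (fst p) a) * indicator V (T (snd p) a) \<partial>?UU)" .
    qed
    also have "\<dots> = (\<integral>\<^sup>+p. (\<integral>\<^sup>+a. indicator V (T (fst p) a) * indicator V (T (snd p) a) \<partial>N) \<partial>?UU)"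
    proof (rule NUU.Fubini'[symmetric])
      have [measurable]: "(\<lambda>p. T (f (snd p)) (fst p)) \<in> N \<Otimes>\<^sub>M ?UU \<rightarrow>\<^sub>M N"
        if [measurable]: "f \<in> ?UU \<rightarrow>\<^sub>M borel" for f
        using measurable_compose[OF _ T, of "\<lambda>p. (f (snd p), fst p)" "N \<Otimes>\<^sub>M ?UU"] by simp
      show "(\<lambda>(a, p). indicator V (T (fst p) a) * indicator V (T (snd p) a) :: ennreal) \<in> borel_measurable (N \<Otimes>\<^sub>M ?UU)"
        using V by (simp add: case_prod_beta')
    qed
    \<comment> \<open>Distant pairs of shifts contribute exactly the square of the probability; for
      the others the trivial bound 1 is enough, since they are rare.\<close>
    also have "\<dots> \<le> (\<integral>\<^sup>+p. ennreal (?p\<^sup>2) + indicator (cball (fst p) R') (snd p) \<partial>?UU)"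
    proof (rule nn_integral_mono)
      fix p :: "(real ^ 'd) \<times> (real ^ 'd)"
      have E: "{a \<in> space N. T (fst p) a \<in> V \<and> T (snd p) a \<in> V} \<in> sets N"
        using V by measurable
      have "(\<integral>\<^sup>+a. indicator V (T (fst p) a) * indicator V (T (snd p) a) \<partial>N)
         = (\<integral>\<^sup>+a. indicator {a \<in> space N. T (fst p) a \<in> V \<and> T (snd p) a \<in> V} a \<partial>N)"
        by (rule nn_integral_cong) (auto simp: indicator_def)
      also have "\<dots> = ennreal (prob {a \<in> space N. T (fst p) a \<in> V \<and> T (snd p) a \<in> V})"
        using E by (simp add: emeasure_eq_measure)
      also have "\<dots> \<le> ennreal (?p\<^sup>2) + indicator (cball (fst p) R') (snd p)"
      proof (cases "snd p \<in> cball (fst p) R'")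
        case True
        then show ?thesis by (simp add: add_increasing)
      next
        case False
        then have "R < norm (fst p - snd p)" by (simp add: R'_def dist_norm)
        then show ?thesis by (simp add: mix)
      qed
      finally show "(\<integral>\<^sup>+a. indicator V (T (fst p) a) * indicator V (T (snd p) a) \<partial>N)
         \<le> ennreal (?p\<^sup>2) + indicator (cball (fst p) R') (snd p)" .
    qed
    also have "\<dots> = ennreal (?p\<^sup>2) + (\<integral>\<^sup>+p. indicator (cball (fst p) R') (snd p) \<partial>?UU)"
    proof (subst nn_integral_add)
      show "(\<lambda>p. indicator (cball (fst p) R') (snd p) :: ennreal) \<in> borel_measurable ?UU"
      proof -
        have "{p \<in> space ?UU. dist (fst p) (snd p) \<le> R'} \<in> sets ?UU" by measurable
        then have "indicator {p \<in> space ?UU. dist (fst p) (snd p) \<le> R'} \<in> borel_measurable ?UU" by simp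
        then show ?thesis
          by (rule measurable_cong[THEN iffD1, rotated]) (auto simp: indicator_def space_pair_measure)
      qed
    qed (simp_all add: UU.emeasure_space_1)
    also have "(\<integral>\<^sup>+p. indicator (cball (fst p) R') (snd p) \<partial>?UU) \<le> ennreal (C / L)"
    proof -
      have "{p \<in> space ?UU. dist (fst p) (snd p) \<le> R'} \<in> sets ?UU" by measurable
      then have m: "indicator {p \<in> space ?UU. dist (fst p) (snd p) \<le> R'} \<in> borel_measurable ?UU" by simp
      have m: "(\<lambda>p. indicator (cball (fst p) R') (snd p) :: ennreal) \<in> borel_measurable ?UU"
        by (rule measurable_cong[THEN iffD1, rotated, OF m]) (auto simp: indicator_def space_pair_measure)
      have "(\<integral>\<^sup>+p. indicator (cball (fst p) R') (snd p) \<partial>?UU)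
         = (\<integral>\<^sup>+z. emeasure (window_law L) (cball z R') \<partial>(window_law L :: (real ^ 'd) measure))"
        by (subst U.nn_integral_fst[OF m, symmetric]) simp
      also have "\<dots> \<le> (\<integral>\<^sup>+z. ennreal (C / L) \<partial>(window_law L :: (real ^ 'd) measure))"
        unfolding C_def by (intro nn_integral_mono window_law_cball_le L) (simp add: R'_def)
      finally show ?thesis using L by (simp add: emeasure_window divide_ennreal)
    qed
    finally have "ennreal (\<integral>a. (?X a)\<^sup>2 \<partial>N) \<le> ennreal (?p\<^sup>2) + ennreal (C / L)"
      by (simp add: add_left_mono)
    then have second: "(\<integral>a. (?X a)\<^sup>2 \<partial>N) \<le> ?p\<^sup>2 + C / L"
      using C L by (simp add: ennreal_plus[symmetric] del: ennreal_plus)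
    have var: "(\<integral>a. (?X a - ?p)\<^sup>2 \<partial>N) \<le> C / L"
    proof -
      have "(\<integral>a. (?X a - ?p)\<^sup>2 \<partial>N) = (\<integral>a. (?X a)\<^sup>2 - 2 * ?p * ?X a + ?p\<^sup>2 \<partial>N)"
        by (rule Bochner_Integration.integral_cong) (simp_all add: power2_diff)
      also have "\<dots> = (\<integral>a. (?X a)\<^sup>2 \<partial>N) - 2 * ?p * expectation ?X + ?p\<^sup>2"
        using X2i Xi by (simp add: prob_space)
      also have "\<dots> = (\<integral>a. (?X a)\<^sup>2 \<partial>N) - ?p\<^sup>2"
        using integral_window_mean[OF L f] Ef by (simp add: power2_eq_square)
      finally show ?thesis using second by simp
    qed
    have di: "integrable N (\<lambda>a. (?X a - ?p)\<^sup>2)"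
      using X2i Xi by (simp add: power2_diff)
    \<comment> \<open>The elementary inequality
      \<open>\<bar>x\<bar> \<le> e / 2 + x\<^sup>2 / (e / 2)\<close> passes from the variance to the
      L^1 norm with half of the error to spare.\<close>
    have "expectation (\<lambda>a. \<bar>?X a - ?p\<bar>) \<le> expectation (\<lambda>a. e / 2 + (?X a - ?p)\<^sup>2 / (e / 2))"
    proof (rule integral_mono)
      fix a
      have "0 \<le> (\<bar>?X a - ?p\<bar> - e / 2)\<^sup>2 + (e / 2) * \<bar>?X a - ?p\<bar>" using e by simp
      then have "\<bar>?X a - ?p\<bar> * (e / 2) \<le> (e / 2)\<^sup>2 + (?X a - ?p)\<^sup>2"
        by (simp add: power2_eq_square algebra_simps abs_mult_self_eq)
      then show "\<bar>?X a - ?p\<bar> \<le> e / 2 + (?X a - ?p)\<^sup>2 / (e / 2)"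
        using e by (simp add: field_simps power2_eq_square)
    qed (use di Xi in auto)
    also have "\<dots> = e / 2 + (\<integral>a. (?X a - ?p)\<^sup>2 \<partial>N) / (e / 2)"
      using di by (simp add: prob_space)
    also have "\<dots> \<le> e / 2 + (C / L) / (e / 2)"
      using var e by (intro add_left_mono divide_right_mono) auto
    also have "\<dots> \<le> e"
    proof -
      have "4 * C / e\<^sup>2 \<le> L" using elim by simp
      then have "4 * C \<le> L * e\<^sup>2" using e by (simp add: field_simps)
      then have "C / L \<le> e\<^sup>2 / 4" using L by (simp add: field_simps)
      then have "(C / L) / (e / 2) \<le> (e\<^sup>2 / 4) / (e / 2)" using e by (intro divide_right_mono) auto
      also have "\<dots> = e / 2" using e by (simp add: power2_eq_square)
      finally show ?thesis by simp
    qed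
    finally have "expectation (\<lambda>a. \<bar>?X a - ?p\<bar>) \<le> e" .
    moreover have "deviation ?f L = ennreal (expectation (\<lambda>a. \<bar>?X a - ?p\<bar>))"
      unfolding deviation_def Ef by (rule nn_integral_eq_integral) (use Xi in auto)
    ultimately show ?case by (simp add: ennreal_leI)
  qed
qed

text \<open>Mixing is required on the generator only. What passes on to complements, disjoint unions
  and limits is mean ergodicity, being linear and closed in L^1; intersection stability lets
  Dynkin's induction, which asks for disjoint unions only, reach all measurable sets. Integrable
  functions follow by approximation with simple ones.\<close>

lemma mean_ergodic_integrable:
  assumes gen: "sets N = sigma_sets (space N) G" "G \<subseteq> Pow (space N)" "Int_stable G"
    and mix: "\<And>V. V \<in> G \<Longrightarrow>
      \<exists>R. \<forall>z w. R < norm (z - w) \<longrightarrow> prob {a \<in> space N. T z a \<in> V \<and> T w a \<in> V} = (prob V)\<^sup>2"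
    and f: "integrable N f"
  shows "mean_ergodic f"
proof -
  have indi: "integrable N (indicator E :: 'a \<Rightarrow> real)" if "E \<in> sets N" for E
    using that by (simp add: integrable_real_indicator emeasure_eq_measure)
  have ind: "mean_ergodic (indicator E)" if "E \<in> sets N" for E
  proof -
    have "E \<in> sigma_sets (space N) G" using that gen by simp
    with gen(3,2) show ?thesis
    proof (induct rule: sigma_sets_induct_disjoint)
      case (basic V)
      then obtain R where "\<And>z w. R < norm (z - w) \<Longrightarrow> prob {a \<in> space N. T z a \<in> V \<and> T w a \<in> V} = (prob V)\<^sup>2"
        using mix by blast
      moreover have "V \<in> sets N" using basic gen by auto
      ultimately show ?case by (intro mean_ergodic_mixing_event)
    next
      case empty
      have "(indicator {} :: 'a \<Rightarrow> real) = (\<lambda>a. 0)" by (auto simp: fun_eq_iff)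
      then show ?case using mean_ergodic_const by simp
    next
      case (compl E)
      then have E: "E \<in> sets N" using gen by simp
      have "mean_ergodic (\<lambda>a. 1 + (-1) * indicator E a)"
        by (intro mean_ergodic_add mean_ergodic_const mean_ergodic_scale compl)
          (use indi[OF E] in auto)
      then show ?case
        using E by (intro mean_ergodic_cong[OF indi]) (auto simp: indicator_def)
    next
      case (union E)
      then have E: "range E \<subseteq> sets N" using gen by simp
      then have Ei: "E i \<in> sets N" for i by auto
      have fin: "mean_ergodic (\<lambda>a. \<Sum>i<n. indicator (E i) a)" for n
      proof (induct n)
        case (Suc n)
        have "mean_ergodic (\<lambda>a. (\<Sum>i<n. indicator (E i) a) + indicator (E n) a)"
          by (intro mean_ergodic_add Suc union) (use indi[OF Ei] in auto)
        then show ?case by simp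
      qed (simp add: mean_ergodic_const)
      have "(\<lambda>n. prob (\<Union>i<n. E i)) \<longlonglongrightarrow> prob (\<Union>n. \<Union>i<n. E i)"
        using Ei by (intro finite_Lim_measure_incseq) (fastforce simp: incseq_def)+
      also have "(\<Union>n. \<Union>i<n. E i) = (\<Union>i. E i)" by auto
      finally have lim: "(\<lambda>n. prob (\<Union>i<n. E i)) \<longlonglongrightarrow> prob (\<Union>i. E i)" .
      show ?case
      proof (rule mean_ergodic_approx[OF indi])
        show "(\<Union>i. E i) \<in> sets N" using E by auto
        fix e :: real assume e: "0 < e"
        from order_tendstoD(1)[OF lim, of "prob (\<Union>i. E i) - e"] e
        obtain n where n: "prob (\<Union>i. E i) - e < prob (\<Union>i<n. E i)"
          by (auto simp: eventually_sequentially)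
        have eq: "(\<Sum>i<n. indicator (E i) a) = (indicator (\<Union>i<n. E i) a :: real)" for a
          using union(1) by (subst indicator_UN_disjoint) (auto simp: disjoint_family_on_def)
        have "(\<integral>\<^sup>+a. ennreal \<bar>indicator (\<Union>i. E i) a - (\<Sum>i<n. indicator (E i) a)\<bar> \<partial>N)
          = (\<integral>\<^sup>+a. indicator ((\<Union>i. E i) - (\<Union>i<n. E i)) a \<partial>N)"
          unfolding eq by (rule nn_integral_cong) (auto simp: indicator_def)
        also have "\<dots> = emeasure N ((\<Union>i. E i) - (\<Union>i<n. E i))"
          using Ei by (intro nn_integral_indicator) auto
        also have "\<dots> = ennreal (prob (\<Union>i. E i) - prob (\<Union>i<n. E i))"
          unfolding emeasure_eq_measure using Ei by (subst finite_measure_Diff) auto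
        also have "\<dots> \<le> ennreal e" using n by (intro ennreal_leI) simp
        finally have "(\<integral>\<^sup>+a. ennreal \<bar>indicator (\<Union>i. E i) a - (\<Sum>i<n. indicator (E i) a)\<bar> \<partial>N) \<le> ennreal e" .
        then show "\<exists>g. integrable N g \<and> mean_ergodic g
            \<and> (\<integral>\<^sup>+a. ennreal \<bar>indicator (\<Union>i. E i) a - g a\<bar> \<partial>N) \<le> ennreal e"
          using fin[of n] indi[OF Ei] by (intro exI[of _ "\<lambda>a. \<Sum>i<n. indicator (E i) a"]) auto
      qed
    qed
  qed
  from f show ?thesis
  proof (induct rule: integrable_induct)
    case (base A c)
    have "mean_ergodic (\<lambda>x. c * indicator A x)"
      by (intro mean_ergodic_scale ind indi base)
    then show ?case by (simp add: mult.commute)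
  next
    case (add f g) then show ?case by (intro mean_ergodic_add)
  next
    case (lim f s)
    have "(\<lambda>i. \<integral>a. \<bar>f a - s i a\<bar> \<partial>N) \<longlonglongrightarrow> (\<integral>a. 0 \<partial>N)"
    proof (rule integral_dominated_convergence)
      \<comment> \<open>The approximating simple functions are bounded by twice
        \<open>\<bar>f\<bar>\<close>, hence the factor 3 for the difference.\<close>
      show "integrable N (\<lambda>a. 3 * \<bar>f a\<bar>)" using lim(5) by simp
      show "AE a in N. (\<lambda>i. \<bar>f a - s i a\<bar>) \<longlonglongrightarrow> 0"
      proof (rule AE_I2)
        fix a assume "a \<in> space N"
        from tendsto_rabs[OF tendsto_diff[OF tendsto_const[of "f a"] lim(3)[OF this]]]
        show "(\<lambda>i. \<bar>f a - s i a\<bar>) \<longlonglongrightarrow> 0" by simp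
      qed
      show "AE a in N. norm \<bar>f a - s i a\<bar> \<le> 3 * \<bar>f a\<bar>" for i
      proof (rule AE_I2)
        fix a assume "a \<in> space N"
        from lim(4)[OF this, of i] show "norm \<bar>f a - s i a\<bar> \<le> 3 * \<bar>f a\<bar>" by simp
      qed
    qed (use lim in auto)
    then have *: "(\<lambda>i. \<integral>a. \<bar>f a - s i a\<bar> \<partial>N) \<longlonglongrightarrow> 0" by simp
    show ?case
    proof (rule mean_ergodic_approx[OF lim(5)])
      fix e :: real assume "0 < e"
      from order_tendstoD(2)[OF * this] obtain i where "(\<integral>a. \<bar>f a - s i a\<bar> \<partial>N) < e"
        by (auto simp: eventually_sequentially)
      moreover have "(\<integral>\<^sup>+a. ennreal \<bar>f a - s i a\<bar> \<partial>N) = ennreal (\<integral>a. \<bar>f a - s i a\<bar> \<partial>N)"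
        using lim(1,5) by (intro nn_integral_eq_integral) auto
      ultimately have "(\<integral>\<^sup>+a. ennreal \<bar>f a - s i a\<bar> \<partial>N) \<le> ennreal e" by (simp add: ennreal_leI)
      then show "\<exists>g. integrable N g \<and> mean_ergodic g \<and> (\<integral>\<^sup>+a. ennreal \<bar>f a - g a\<bar> \<partial>N) \<le> ennreal e"
        using lim(1,2) by blast
    qed
  qed
qed

end

section \<open>Marked Poisson processes\<close>

lemma config_space_cong: "sets S = sets S' \<Longrightarrow> config_space S = config_space S'"
  using sets_eq_imp_space_eq[of S S'] by (simp add: config_space_def)

lemma sets_lborel_marked:
  "sets (lborel \<Otimes>\<^sub>M Q :: ('a::euclidean_space \<times> 'b) measure) = sets (borel \<Otimes>\<^sub>M Q)"
  by (intro sets_pair_measure_cong) auto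

lemma ennreal_add_right_eqD:
  fixes x y z :: ennreal
  assumes "x + y = z + y" "y \<noteq> \<top>"
  shows "x = z"
proof -
  have c: "(u + y) - y = u" for u
    by (rule ennreal_add_diff_cancel_right) (use assms(2) in simp)
  show ?thesis using c[of x] c[of z] unfolding assms(1) by (rule trans[OF sym])
qed

text \<open>The term \<open>n = 0\<close> vanishes; in the others the factor \<open>n\<close>
  cancels against the factorial, and shifting the index leaves \<open>l\<close> times the
  exponential series.\<close>

lemma suminf_poisson_mean:
  "(\<Sum>n. ennreal (real n * (l ^ n / fact n * exp (- l)))) = ennreal l" if "0 \<le> l"
proof -
  have "(\<lambda>n. l ^ n / fact n) sums exp l"
    using exp_converges[of l] by (simp add: divide_inverse mult.commute)
  then have "(\<lambda>n. (l * exp (- l)) * (l ^ n / fact n)) sums ((l * exp (- l)) * exp l)"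
    by (rule sums_mult)
  moreover have "(l * exp (- l)) * exp l = l" by (simp add: exp_minus)
  moreover have "(l * exp (- l)) * (l ^ n / fact n) = real (Suc n) * (l ^ Suc n / fact (Suc n) * exp (- l))" for n
    by (simp add: fact_Suc del: of_nat_Suc)
  ultimately have "(\<lambda>n. real (Suc n) * (l ^ Suc n / fact (Suc n) * exp (- l))) sums l" by (simp only:)
  then have "(\<lambda>n. real n * (l ^ n / fact n * exp (- l))) sums l"
    using sums_Suc_iff[of "\<lambda>n. real n * (l ^ n / fact n * exp (- l))" l] by simp
  then show ?thesis using that by (intro suminf_ennreal_eq) auto
qed

lemma nn_integral_of_nat_card:
  fixes c :: "'w \<Rightarrow> nat"
  assumes "prob_space M" and c: "c \<in> M \<rightarrow>\<^sub>M count_space UNIV" and l: "0 \<le> l"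
    and p: "\<And>n. measure M {\<omega> \<in> space M. c \<omega> = n} = l ^ n / fact n * exp (- l)"
  shows "(\<integral>\<^sup>+\<omega>. of_nat (c \<omega>) \<partial>M) = ennreal l"
proof -
  interpret prob_space M by fact
  note [measurable] = c
  have m: "{\<omega> \<in> space M. c \<omega> = n} \<in> sets M" for n by measurable
  have "(\<integral>\<^sup>+\<omega>. of_nat (c \<omega>) \<partial>M) = (\<integral>\<^sup>+\<omega>. (\<Sum>n. of_nat n * indicator {\<omega> \<in> space M. c \<omega> = n} \<omega>) \<partial>M)"
  proof (rule nn_integral_cong)
    fix \<omega> assume "\<omega> \<in> space M"
    then have "(\<Sum>n. of_nat n * indicator {\<omega> \<in> space M. c \<omega> = n} \<omega>)
        = (\<Sum>n\<in>{c \<omega>}. of_nat n * indicator {\<omega> \<in> space M. c \<omega> = n} \<omega> :: ennreal)"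
      by (intro suminf_finite) (auto simp: indicator_def)
    then show "of_nat (c \<omega>) = (\<Sum>n. of_nat n * indicator {\<omega> \<in> space M. c \<omega> = n} \<omega> :: ennreal)"
      using \<open>\<omega> \<in> space M\<close> by simp
  qed
  also have "\<dots> = (\<Sum>n. of_nat n * emeasure M {\<omega> \<in> space M. c \<omega> = n})"
    using m by (subst nn_integral_suminf) (auto simp: nn_integral_cmult_indicator)
  also have "\<dots> = (\<Sum>n. ennreal (real n * (l ^ n / fact n * exp (- l))))"
  proof (rule suminf_cong)
    fix n
    show "of_nat n * emeasure M {\<omega> \<in> space M. c \<omega> = n} = ennreal (real n * (l ^ n / fact n * exp (- l)))"
      unfolding emeasure_eq_measure p ennreal_of_nat_eq_real_of_nat
      by (rule ennreal_mult[symmetric]) (use l in auto)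
  qed
  also have "\<dots> = ennreal l" by (rule suminf_poisson_mean[OF l])
  finally show ?thesis .
qed

text \<open>Uniqueness of measures on the pi-system of void events: the law of a simple point
  process is determined by its void probabilities, as in Renyi's theorem. The whole space is itself
  a void event, that of the empty region.\<close>

lemma measure_config_space_eqI:
  fixes Q :: "real measure" and N N' :: "('a::euclidean_space \<times> real) set measure"
  assumes Q: "mark_law \<mu> Q"
    and N: "finite_measure N" "sets N = sets (config_space (borel \<Otimes>\<^sub>M Q))"
    and N': "sets N' = sets (config_space (borel \<Otimes>\<^sub>M Q))"
    and eq: "\<And>V. V \<in> sets (borel \<Otimes>\<^sub>M Q) \<Longrightarrow> bounded V \<Longrightarrow> emeasure N (void (borel \<Otimes>\<^sub>M Q) V) = emeasure N' (void (borel \<Otimes>\<^sub>M Q) V)"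
  shows "N = N'"
proof -
  let ?S = "borel \<Otimes>\<^sub>M Q :: ('a \<times> real) measure"
  let ?C = "configurations (space ?S)"
  have C: "?C = void ?S {}" by (auto simp: void_def)
  show ?thesis
  proof (rule measure_eqI_generator_eq[OF Int_stable_voids voids_subset, where A="\<lambda>_. ?C"])
    show "emeasure N X = emeasure N' X" if "X \<in> voids ?S" for X
      using that eq by (auto simp: voids_def)
    show "sets N = sigma_sets ?C (voids ?S)" "sets N' = sigma_sets ?C (voids ?S)"
      unfolding N(2) N' by (rule sets_config_space_voids[OF open_in_marked[OF Q]], assumption)+
    show "range (\<lambda>_::nat. ?C) \<subseteq> voids ?S"
      unfolding C voids_def by (auto intro!: exI[of _ "{}"])
    show "emeasure N ?C \<noteq> \<infinity>" using finite_measure.emeasure_finite[OF N(1)] by simp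
  qed auto
qed

section \<open>The law of a marked Poisson process\<close>

locale poisson_marked = prob_space M
  for M :: "'w measure" +
  fixes \<mu> :: real and Q :: "real measure" and \<eta> :: "'w \<Rightarrow> ('a::euclidean_space \<times> real) set"
  assumes Q: "mark_law \<mu> Q" and poisson: "poisson_process M (lborel \<Otimes>\<^sub>M Q) \<eta>"
begin

abbreviation S :: "('a \<times> real) measure" where "S \<equiv> borel \<Otimes>\<^sub>M Q"
abbreviation \<Lambda> :: "('a \<times> real) measure" where "\<Lambda> \<equiv> lborel \<Otimes>\<^sub>M Q"

definition N :: "('a \<times> real) set measure" where
  "N = distr M (config_space S) \<eta>"

sublocale Q: prob_space Q using Q by (simp add: mark_law_def)

sublocale lQ: pair_sigma_finite lborel Q ..

lemma eta[measurable]: "\<eta> \<in> M \<rightarrow>\<^sub>M config_space S"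
  using poisson config_space_cong[OF sets_lborel_marked[of Q, where 'a='a]] by (simp add: poisson_process_def)

sublocale N: prob_space N unfolding N_def by (rule prob_space_distr[OF eta])

lemma sets_N[measurable_cong]: "sets N = sets (config_space S)" by (simp add: N_def)

lemma space_S: "space S = UNIV \<times> {0..\<mu>}" by (rule space_marked[OF Q])

lemma space_N: "space N = configurations (UNIV \<times> {0..\<mu>})"
  using sets_eq_imp_space_eq[OF sets_N] by (simp only: space_config_space space_S)

text \<open>The marks carry mass one in total, so a bounded region has at most the volume of a ball
  in space; a set that is not measurable has \<open>emeasure\<close> 0.\<close>

lemma emeasure_bounded_finite:
  assumes "bounded V"
  shows "emeasure \<Lambda> V \<noteq> \<infinity>"
proof (cases "V \<in> sets \<Lambda>")
  case True
  obtain r where r: "\<And>p. p \<in> V \<Longrightarrow> norm p \<le> r" using assms by (auto simp: bounded_iff)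
  have "V \<subseteq> cball 0 r \<times> space Q"
  proof
    fix p assume p: "p \<in> V"
    then have "p \<in> space \<Lambda>" using sets.sets_into_space[OF True] by blast
    moreover have "norm (fst p) \<le> r" using r[OF p] norm_fst_le[of "fst p" "snd p"] by simp
    ultimately show "p \<in> cball 0 r \<times> space Q" by (cases p) (simp add: space_pair_measure)
  qed
  then have "emeasure \<Lambda> V \<le> emeasure \<Lambda> (cball 0 r \<times> space Q)"
    by (intro emeasure_mono) auto
  also have "\<dots> = emeasure lborel (cball (0::'a) r)"
    by (subst Q.emeasure_pair_measure_Times) (auto simp: Q.emeasure_space_1)
  also have "\<dots> < \<infinity>" using emeasure_lborel_cball_finite[of "0::'a" r] by (simp add: less_top)
  finally show ?thesis by simp
qed (simp add: emeasure_notin_sets)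

lemma emeasure_bounded: "bounded V \<Longrightarrow> emeasure \<Lambda> V = ennreal (measure \<Lambda> V)"
  by (rule emeasure_eq_ennreal_measure) (use emeasure_bounded_finite in simp)

lemma measurable_count:
  assumes "V \<in> sets S" "bounded V"
  shows "(\<lambda>\<omega>. card (\<eta> \<omega> \<inter> V)) \<in> M \<rightarrow>\<^sub>M count_space UNIV"
  by (rule measurable_card_config[OF eta assms])

lemma prob_count:
  assumes "V \<in> sets S" "bounded V"
  shows "measure M {\<omega> \<in> space M. card (\<eta> \<omega> \<inter> V) = n} = measure \<Lambda> V ^ n / fact n * exp (- measure \<Lambda> V)"
  using assms poisson by (simp add: poisson_process_def sets_lborel_marked)

lemma count_eq_0_iff:
  "\<omega> \<in> space M \<Longrightarrow> bounded V \<Longrightarrow> card (\<eta> \<omega> \<inter> V) = 0 \<longleftrightarrow> \<eta> \<omega> \<in> void S V"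
  using measurable_space[OF eta] config_finite[of "\<eta> \<omega>" "space S" V]
  by (auto simp: void_def space_config_space)

lemma prob_void:
  assumes V: "V \<in> sets S" "bounded V"
  shows "measure N (void S V) = exp (- measure \<Lambda> V)"
proof -
  have "measure N (void S V) = measure M {\<omega> \<in> space M. card (\<eta> \<omega> \<inter> V) = 0}"
    unfolding N_def using V count_eq_0_iff
    by (subst measure_distr) (auto simp: void_in_config_space intro!: arg_cong[where f="measure M"])
  then show ?thesis using prob_count[OF V, of 0] by simp
qed

lemma config_shift_vimage: "config_shift z V = (\<lambda>p. p + (- z, 0)) -` V"
proof (intro set_eqI iffI)
  fix p assume "p \<in> (\<lambda>p. p + (- z, 0)) -` V"
  then show "p \<in> config_shift z V"
    unfolding config_shift_def by (intro image_eqI[of _ _ "p + (- z, 0)"]) (auto simp: prod_eq_iff)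
qed (auto simp: config_shift_def)

lemma measurable_shift: "(\<lambda>p. p + (z, 0)) \<in> S \<rightarrow>\<^sub>M S"
proof -
  have "(\<lambda>p. (fst p + z, snd p)) \<in> S \<rightarrow>\<^sub>M S" by measurable
  then show ?thesis by (simp add: plus_prod_def)
qed

lemma config_shift_in_S:
  assumes "V \<in> sets S"
  shows "config_shift z V \<in> sets S"
proof -
  have "(\<lambda>p. p + (- z, 0)) -` V \<inter> space S = config_shift z V"
    using sets.sets_into_space[OF assms] by (auto simp: config_shift_vimage space_S)
  then show ?thesis using measurable_sets[OF measurable_shift assms, of "- z"] by simp
qed

lemma bounded_config_shift: "bounded V \<Longrightarrow> bounded (config_shift z V)"
  using bounded_translation[of V "(z, 0)"] by (simp add: config_shift_def add.commute)

lemma measure_config_shift: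
  assumes V: "V \<in> sets S"
  shows "measure \<Lambda> (config_shift z V) = measure \<Lambda> V"
proof -
  have d: "distr lborel borel ((+) (- z)) = lborel" by (rule lborel_distr_plus)
  have "distr Q Q (\<lambda>m. m) = Q" by (rule distr_id)
  then have "\<Lambda> = distr lborel borel ((+) (- z)) \<Otimes>\<^sub>M distr Q Q (\<lambda>m. m)" by (simp add: d)
  also have "\<dots> = distr (lborel \<Otimes>\<^sub>M Q) (borel \<Otimes>\<^sub>M Q) (\<lambda>(x, m). (- z + x, m))"
    by (rule pair_measure_distr) (auto simp: distr_id Q.sigma_finite_measure_axioms)
  finally have "measure \<Lambda> V = measure (distr \<Lambda> S (\<lambda>(x, m). (- z + x, m))) V" by simp
  also have "\<dots> = measure \<Lambda> ((\<lambda>(x, m). (- z + x, m)) -` V \<inter> space \<Lambda>)"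
    by (rule measure_distr) (use V in auto)
  also have "(\<lambda>(x, m). (- z + x, m)) -` V \<inter> space \<Lambda> = config_shift z V"
    using sets.sets_into_space[OF V] space_S
    by (auto simp: config_shift_vimage space_pair_measure add.commute)
  finally show ?thesis by simp
qed

lemma config_shift_in_void_iff:
  assumes A: "A \<in> configurations (UNIV \<times> {0..\<mu>})"
  shows "config_shift z A \<in> void S V \<longleftrightarrow> A \<in> void S (config_shift (- z) V)"
proof -
  have "config_shift z A \<inter> V = {} \<longleftrightarrow> A \<inter> config_shift (- z) V = {}"
  proof -
    have "config_shift (- z) V = (\<lambda>p. p + (z, 0)) -` V" using config_shift_vimage[of "- z" V] by simp
    moreover have "config_shift z A \<inter> V = {} \<longleftrightarrow> (\<forall>p\<in>A. p + (z, 0) \<notin> V)"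
      by (auto simp: config_shift_def)
    ultimately show ?thesis by auto
  qed
  then show ?thesis
    using A config_shift_configurations[OF A] by (simp add: void_def space_S)
qed

lemma void_conf: "A \<in> void S V \<Longrightarrow> A \<in> configurations (UNIV \<times> {0..\<mu>})"
  by (simp add: void_def space_S)

lemma void_Un: "void S (V \<union> W) = void S V \<inter> void S W"
  by (auto simp: void_def)

lemma measurable_config_shift_N:
  "(\<lambda>(z, A). config_shift z A) \<in> borel \<Otimes>\<^sub>M N \<rightarrow>\<^sub>M N"
  using measurable_config_shift[OF Q, where 'a='a]
  by (simp cong: measurable_cong_sets sets_pair_measure_cong add: sets_N)

lemma config_shift_z[measurable]: "config_shift z \<in> N \<rightarrow>\<^sub>M N"
  using measurable_compose[OF measurable_Pair1' measurable_config_shift_N, of z] by simp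

text \<open>The intensity measure is invariant under spatial shifts. Hence the void probabilities
  agree, and they determine the law.\<close>

lemma distr_config_shift: "distr N N (config_shift z) = N"
proof (rule measure_config_space_eqI[OF Q])
  show "finite_measure (distr N N (config_shift z))"
    using N.prob_space_distr[OF config_shift_z] prob_space.finite_measure by blast
  fix V assume V: "V \<in> sets S" "bounded V"
  have "emeasure (distr N N (config_shift z)) (void S V) = emeasure N (config_shift z -` void S V \<inter> space N)"
    using V by (intro emeasure_distr) (auto simp: void_in_config_space sets_N)
  also have "config_shift z -` void S V \<inter> space N = void S (config_shift (- z) V)"
  proof (rule set_eqI)
    fix A
    show "A \<in> config_shift z -` void S V \<inter> space N \<longleftrightarrow> A \<in> void S (config_shift (- z) V)"
      by (cases "A \<in> configurations (UNIV \<times> {0..\<mu>})")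
        (auto simp: space_N config_shift_in_void_iff dest: void_conf)
  qed
  also have "emeasure N \<dots> = emeasure N (void S V)"
    using V by (simp add: N.emeasure_eq_measure prob_void config_shift_in_S bounded_config_shift measure_config_shift)
  finally show "emeasure (distr N N (config_shift z)) (void S V) = emeasure N (void S V)" .
qed (simp_all add: sets_N)

text \<open>The two shifted events say that the translates of \<open>V\<close> by \<open>- z\<close>
  and \<open>- w\<close> are empty. If \<open>V\<close> lies in the ball of radius \<open>r\<close>,
  these are disjoint once \<open>z\<close> and \<open>w\<close> are more than \<open>2 * r\<close>
  apart; intensities then add, and the exponential turns the sum into a product.\<close>

lemma mixing_void:
  assumes V: "V \<in> sets S" "bounded V"
  shows "\<exists>R. \<forall>z w. R < norm (z - w) \<longrightarrow>
    measure N {A \<in> space N. config_shift z A \<in> void S V \<and> config_shift w A \<in> void S V} = (measure N (void S V))\<^sup>2"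
proof -
  obtain r where r: "\<And>p. p \<in> V \<Longrightarrow> norm p \<le> r" using V by (auto simp: bounded_iff)
  have "measure N {A \<in> space N. config_shift z A \<in> void S V \<and> config_shift w A \<in> void S V} = (measure N (void S V))\<^sup>2"
    if "2 * r < norm (z - w)" for z w
  proof -
    let ?Z = "config_shift (- z) V" and ?W = "config_shift (- w) V"
    have ZW: "?Z \<in> sets S" "?W \<in> sets S" "bounded ?Z" "bounded ?W"
      using V by (auto intro: config_shift_in_S bounded_config_shift)
    have "?Z \<inter> ?W = {}"
    proof (rule ccontr)
      assume "?Z \<inter> ?W \<noteq> {}"
      then obtain p where "p + (z, 0) \<in> V" "p + (w, 0) \<in> V" by (auto simp: config_shift_vimage)
      then have "norm ((p + (z, 0)) - (p + (w, 0))) \<le> r + r"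
        by (intro order_trans[OF norm_triangle_ineq4] add_mono r)
      then show False using that by (simp add: norm_Pair)
    qed
    then have "emeasure \<Lambda> (?Z \<union> ?W) = emeasure \<Lambda> ?Z + emeasure \<Lambda> ?W"
      using ZW by (intro plus_emeasure[symmetric]) (auto simp: sets_lborel_marked)
    then have "measure \<Lambda> (?Z \<union> ?W) = 2 * measure \<Lambda> V"
      using V ZW by (simp add: emeasure_bounded measure_config_shift ennreal_plus[symmetric] del: ennreal_plus)
    moreover have "{A \<in> space N. config_shift z A \<in> void S V \<and> config_shift w A \<in> void S V} = void S (?Z \<union> ?W)"
    proof (rule set_eqI)
      fix A
      show "A \<in> {A \<in> space N. config_shift z A \<in> void S V \<and> config_shift w A \<in> void S V}
        \<longleftrightarrow> A \<in> void S (?Z \<union> ?W)"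
        by (cases "A \<in> configurations (UNIV \<times> {0..\<mu>})")
          (auto simp: space_N config_shift_in_void_iff void_Un dest: void_conf)
    qed
    ultimately show ?thesis
      using V ZW by (simp add: prob_void exp_double[symmetric] exp_of_nat_mult[symmetric] power2_eq_square mult_exp_exp)
  qed
  then show ?thesis by blast
qed

text \<open>Counts in disjoint regions are independent, emptiness of \<open>V\<close> is a condition
  on its count, and the mean count in \<open>B\<close> is its intensity. This is the case of the
  Mecke formula that serves as its generator.\<close>

lemma nn_integral_count_void:
  assumes B: "B \<in> sets S" "bounded B" and V: "V \<in> sets S" "bounded V" and BV: "B \<inter> V = {}"
  shows "(\<integral>\<^sup>+A. of_nat (card (A \<inter> B)) * indicator (void S V) A \<partial>N) = emeasure \<Lambda> B * emeasure N (void S V)"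
proof -
  define C where "C i = (if i = 0 then B else V)" for i :: nat
  \<comment> \<open>Index 0 carries the count in \<open>B\<close> itself, index 1 the indicator that
    the count in \<open>V\<close> is zero.\<close>
  define g where "g i n = (if i = 0 then of_nat n else if n = 0 then 1 else 0 :: ennreal)" for i n :: nat
  have ind: "indep_vars (\<lambda>_. count_space UNIV) (\<lambda>i \<omega>. card (\<eta> \<omega> \<inter> C i)) {..<2}"
  proof -
    have "\<forall>i<2. C i \<in> sets \<Lambda> \<and> bounded (C i)" using B V by (simp add: C_def sets_lborel_marked)
    moreover have "disjoint_family_on C {..<2}"
      using BV by (auto simp: disjoint_family_on_def C_def)
    ultimately show ?thesis using poisson unfolding poisson_process_def by blast
  qed
  have "indep_vars (\<lambda>_. borel) (\<lambda>i \<omega>. g i (card (\<eta> \<omega> \<inter> C i))) {..<2}"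
    using indep_vars_compose2[OF ind, of g "\<lambda>_. borel"] by simp
  then have "(\<integral>\<^sup>+\<omega>. (\<Prod>i<2. g i (card (\<eta> \<omega> \<inter> C i))) \<partial>M) = (\<Prod>i<2. \<integral>\<^sup>+\<omega>. g i (card (\<eta> \<omega> \<inter> C i)) \<partial>M)"
    by (intro indep_vars_nn_integral) auto
  then have eq: "(\<integral>\<^sup>+\<omega>. of_nat (card (\<eta> \<omega> \<inter> B)) * g 1 (card (\<eta> \<omega> \<inter> V)) \<partial>M)
      = (\<integral>\<^sup>+\<omega>. of_nat (card (\<eta> \<omega> \<inter> B)) \<partial>M) * (\<integral>\<^sup>+\<omega>. g 1 (card (\<eta> \<omega> \<inter> V)) \<partial>M)"
    by (simp add: numeral_2_eq_2 C_def g_def)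
  have g1: "g 1 (card (\<eta> \<omega> \<inter> V)) = indicator (void S V) (\<eta> \<omega>)" if "\<omega> \<in> space M" for \<omega>
    using count_eq_0_iff[OF that V(2)] by (simp add: g_def indicator_def)
  have m: "void S V \<in> sets (config_space S)" by (rule void_in_config_space[OF V])
  have [measurable]: "(\<lambda>A. card (A \<inter> B)) \<in> config_space S \<rightarrow>\<^sub>M count_space UNIV"
    by (rule measurable_card_config[OF measurable_ident_sets[OF refl] B])
  have "(\<integral>\<^sup>+A. of_nat (card (A \<inter> B)) * indicator (void S V) A \<partial>N)
      = (\<integral>\<^sup>+\<omega>. of_nat (card (\<eta> \<omega> \<inter> B)) * indicator (void S V) (\<eta> \<omega>) \<partial>M)"
    unfolding N_def using m by (subst nn_integral_distr) auto
  also have "\<dots> = (\<integral>\<^sup>+\<omega>. of_nat (card (\<eta> \<omega> \<inter> B)) \<partial>M) * (\<integral>\<^sup>+\<omega>. indicator (void S V) (\<eta> \<omega>) \<partial>M)"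
    using eq g1 by (simp cong: nn_integral_cong)
  also have "(\<integral>\<^sup>+\<omega>. of_nat (card (\<eta> \<omega> \<inter> B)) \<partial>M) = emeasure \<Lambda> B"
    unfolding emeasure_bounded[OF B(2)]
    by (rule nn_integral_of_nat_card[OF prob_space_axioms measurable_count[OF B]]) (auto simp: prob_count[OF B])
  also have "(\<integral>\<^sup>+\<omega>. indicator (void S V) (\<eta> \<omega>) \<partial>M) = (\<integral>\<^sup>+A. indicator (void S V) A \<partial>N)"
    unfolding N_def using m by (subst nn_integral_distr) auto
  also have "\<dots> = emeasure N (void S V)" using m by (simp add: sets_N)
  finally show ?thesis .
qed

section \<open>The Mecke formula\<close>

lemma measurable_insert: "(\<lambda>(x, A). insert x A) \<in> S \<Otimes>\<^sub>M config_space S \<rightarrow>\<^sub>M config_space S"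
proof (rule measurable_config_marked[OF Q])
  fix V :: "('a \<times> real) set" assume V: "V \<in> sets S" "bounded V"
  have "{t \<in> space (S \<Otimes>\<^sub>M config_space S). (case t of (x, A) \<Rightarrow> insert x A) \<inter> V = {}} = (space S - V) \<times> void S V"
    by (auto simp: void_def space_pair_measure space_config_space)
  also have "\<dots> \<in> sets (S \<Otimes>\<^sub>M config_space S)"
    using V void_in_config_space[OF V] by (intro pair_measureI) auto
  finally show "{t \<in> space (S \<Otimes>\<^sub>M config_space S). (case t of (x, A) \<Rightarrow> insert x A) \<inter> V = {}} \<in> sets (S \<Otimes>\<^sub>M config_space S)" .
qed (auto simp: space_pair_measure space_config_space configurations_def Int_insert_left)

text \<open>Rectangles whose second factor is a void event already generate the product
  \<sigma>-algebra. On these the Mecke formula is a statement about two disjoint regions.\<close>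

lemma sets_pair_voids:
  "sets (S \<Otimes>\<^sub>M config_space S) = sigma_sets (space S \<times> configurations (space S)) {a \<times> b | a b. a \<in> sets S \<and> b \<in> voids S}"
  (is "_ = sigma_sets ?O ?G")
proof
  let ?C = "configurations (space S)"
  have GO: "?G \<subseteq> Pow ?O"
    using voids_subset[of S] sets.sets_into_space[of _ S] by blast
  interpret G: sigma_algebra ?O "sigma_sets ?O ?G" by (rule sigma_algebra_sigma_sets[OF GO])
  have voidsI: "?C \<in> voids S" by (auto simp: voids_def void_def intro!: exI[of _ "{}"])
  have b: "space S \<times> b \<in> sigma_sets ?O ?G" if "b \<in> sigma_sets ?C (voids S)" for b
    using that
  proof induct
    case (Basic a) then show ?case by (intro sigma_sets.Basic) blast
  next
    case (Compl a)
    have "space S \<times> (?C - a) = ?O - space S \<times> a" by auto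
    then show ?case using Compl by (simp add: G.compl_sets)
  next
    case (Union a)
    have "space S \<times> (\<Union>i. a i) = (\<Union>i. space S \<times> a i)" by auto
    then show ?case using Union G.countable_nat_UN[of "\<lambda>i. space S \<times> a i"] by auto
  qed (simp add: sigma_sets.Empty)
  have "a \<times> b \<in> sigma_sets ?O ?G" if "a \<in> sets S" "b \<in> sets (config_space S)" for a b
  proof -
    have "b \<in> sigma_sets ?C (voids S)"
      using that(2) sets_config_space_voids[of S, OF open_in_marked[OF Q]] by simp
    then have "space S \<times> b \<in> sigma_sets ?O ?G" by (rule b)
    moreover have "a \<times> ?C \<in> sigma_sets ?O ?G"
      using that(1) voidsI by (intro sigma_sets.Basic) blast
    moreover have "b \<subseteq> ?C" using sets.sets_into_space[OF that(2)] by (simp add: space_config_space)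
    then have "a \<times> b = (space S \<times> b) \<inter> (a \<times> ?C)" using sets.sets_into_space[OF that(1)] by auto
    ultimately show ?thesis by (simp only: G.Int)
  qed
  then show "sets (S \<Otimes>\<^sub>M config_space S) \<subseteq> sigma_sets ?O ?G"
    unfolding sets_pair_measure[of S "config_space S"] space_config_space by (intro G.sigma_sets_subset) auto
  show "sigma_sets ?O ?G \<subseteq> sets (S \<Otimes>\<^sub>M config_space S)"
  proof -
    have "space (S \<Otimes>\<^sub>M config_space S) = ?O"
      by (simp only: space_pair_measure[of S "config_space S"] space_config_space)
    moreover have "?G \<subseteq> sets (S \<Otimes>\<^sub>M config_space S)"
      using void_in_config_space by (auto simp: voids_def intro!: pair_measureI)
    ultimately show ?thesis using sets.sigma_sets_subset[of ?G "S \<Otimes>\<^sub>M config_space S"] by simp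
  qed
qed

lemma Int_stable_pair_voids: "Int_stable {a \<times> b | a b. a \<in> sets S \<and> b \<in> voids S}"
proof (rule Int_stableI)
  fix X Y assume "X \<in> {a \<times> b | a b. a \<in> sets S \<and> b \<in> voids S}" "Y \<in> {a \<times> b | a b. a \<in> sets S \<and> b \<in> voids S}"
  then obtain a b c d where *: "X = a \<times> b" "Y = c \<times> d" "a \<in> sets S" "c \<in> sets S" "b \<in> voids S" "d \<in> voids S" by blast
  then have "X \<inter> Y = (a \<inter> c) \<times> (b \<inter> d)" by auto
  moreover have "b \<inter> d \<in> voids S" using * Int_stable_voids[of S] by (auto simp: Int_stable_def)
  ultimately show "X \<inter> Y \<in> {a \<times> b | a b. a \<in> sets S \<and> b \<in> voids S}" using * by blast
qed

text \<open>The Mecke formula: on the generator \<open>a \<times> void S V\<close> it only involves the points of \<open>B \<inter> a\<close>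
  outside \<open>V\<close>, whose number is independent of the event that \<open>V\<close> is empty.\<close>

lemma mecke:
  assumes B: "B \<in> sets S" "bounded B" and E: "E \<in> sets (S \<Otimes>\<^sub>M config_space S)"
  shows "(\<integral>\<^sup>+A. (\<integral>\<^sup>+x. indicator B x * indicator E (x, A) \<partial>count_space A) \<partial>N)
    = (\<integral>\<^sup>+x. indicator B x * (\<integral>\<^sup>+A. indicator E (x, insert x A) \<partial>N) \<partial>\<Lambda>)"
proof -
  let ?O = "space S \<times> configurations (space S)"
  let ?l = "\<lambda>E A. \<integral>\<^sup>+x. indicator B x * indicator E (x, A) \<partial>count_space A :: ennreal"
  let ?r = "\<lambda>E x. indicator B x * (\<integral>\<^sup>+A. indicator E (x, insert x A) \<partial>N) :: ennreal"
  note [measurable] = B(1)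
  have lm[measurable]: "?l E \<in> borel_measurable N" if [measurable]: "E \<in> sets (S \<Otimes>\<^sub>M config_space S)" for E
  proof -
    have "?l E \<in> borel_measurable (config_space S)"
      by (rule measurable_nn_integral_marked[OF Q measurable_ident_sets[OF refl]]) (simp add: case_prod_beta')
    then show ?thesis by (simp cong: measurable_cong_sets add: sets_N)
  qed
  have Em: "(\<lambda>(x, A). indicator E (x, insert x A) :: ennreal) \<in> borel_measurable (\<Lambda> \<Otimes>\<^sub>M N)"
    if E: "E \<in> sets (S \<Otimes>\<^sub>M config_space S)" for E
  proof -
    have "(\<lambda>p. (fst p, (\<lambda>(x, A). insert x A) p)) \<in> S \<Otimes>\<^sub>M config_space S \<rightarrow>\<^sub>M S \<Otimes>\<^sub>M config_space S"
      using measurable_insert by (intro measurable_Pair) auto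
    from measurable_compose[OF this borel_measurable_indicator[OF E, where 'b=ennreal]]
    show ?thesis
      by (simp cong: measurable_cong_sets sets_pair_measure_cong add: sets_N sets_lborel_marked case_prod_beta')
  qed
  have rm[measurable]: "?r E \<in> borel_measurable \<Lambda>" if "E \<in> sets (S \<Otimes>\<^sub>M config_space S)" for E
  proof -
    have "indicator B \<in> borel_measurable \<Lambda>" using B(1) by (simp add: sets_lborel_marked)
    then show ?thesis
      using N.borel_measurable_nn_integral[OF Em[OF that]] by (intro borel_measurable_times_ennreal) auto
  qed
  have Em1: "(\<lambda>A. indicator E (x, insert x A) :: ennreal) \<in> borel_measurable N"
    if "E \<in> sets (S \<Otimes>\<^sub>M config_space S)" "x \<in> space S" for E x
    using measurable_Pair2[OF Em[OF that(1)], of x] that(2) sets_eq_imp_space_eq[OF sets_lborel_marked[of Q, where 'a='a]] by simp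
  have gen: "integral\<^sup>N N (?l (a \<times> void S V)) = integral\<^sup>N \<Lambda> (?r (a \<times> void S V))"
    if a: "a \<in> sets S" and V: "V \<in> sets S" "bounded V" for a V
  proof -
    \<comment> \<open>On the event that \<open>V\<close> is empty, removing \<open>V\<close> from
      the region does not change the sum, and it makes the region disjoint from
      \<open>V\<close>.\<close>
    let ?B = "B \<inter> a - V"
    have B': "?B \<in> sets S" "bounded ?B" using a V B by (auto intro: bounded_subset)
    have "integral\<^sup>N N (?l (a \<times> void S V)) = (\<integral>\<^sup>+A. of_nat (card (A \<inter> ?B)) * indicator (void S V) A \<partial>N)"
    proof (rule nn_integral_cong)
      fix A assume "A \<in> space N"
      then have A: "A \<in> configurations (UNIV \<times> {0..\<mu>})" by (simp add: space_N)
      have "?l (a \<times> void S V) A = (\<integral>\<^sup>+x. indicator ?B x * indicator (void S V) A \<partial>count_space A)"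
        by (rule nn_integral_cong) (auto simp: indicator_def void_def)
      also have "\<dots> = (\<Sum>x\<in>A \<inter> ?B. indicator (void S V) A)"
        by (rule nn_integral_count_space_indicator_bounded[OF A B'(2)])
      finally show "?l (a \<times> void S V) A = of_nat (card (A \<inter> ?B)) * indicator (void S V) A" by simp
    qed
    also have "\<dots> = emeasure \<Lambda> ?B * emeasure N (void S V)"
      by (rule nn_integral_count_void[OF B' V]) auto
    also have "\<dots> = (\<integral>\<^sup>+x. emeasure N (void S V) * indicator ?B x \<partial>\<Lambda>)"
      using B' by (subst nn_integral_cmult_indicator) (auto simp: sets_lborel_marked mult.commute)
    also have "\<dots> = integral\<^sup>N \<Lambda> (?r (a \<times> void S V))"
    proof (rule nn_integral_cong)
      fix x assume x: "x \<in> space \<Lambda>"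
      \<comment> \<open>Inserting \<open>x\<close> keeps \<open>V\<close> empty exactly when
        \<open>x\<close> is outside \<open>V\<close>.\<close>
      have "(\<integral>\<^sup>+A. indicator (a \<times> void S V) (x, insert x A) \<partial>N)
          = (\<integral>\<^sup>+A. indicator (a - V) x * indicator (void S V) A \<partial>N)"
      proof (rule nn_integral_cong)
        fix A assume "A \<in> space N"
        then have "insert x A \<in> configurations (space S)" "A \<in> configurations (space S)"
          using x by (auto simp: space_N space_S space_pair_measure mark_law_space[OF Q] configurations_def Int_insert_left)
        then show "indicator (a \<times> void S V) (x, insert x A) = indicator (a - V) x * (indicator (void S V) A :: ennreal)"
          by (auto simp: indicator_def void_def)
      qed
      also have "\<dots> = indicator (a - V) x * emeasure N (void S V)"
        using void_in_config_space[OF V] by (simp add: nn_integral_cmult sets_N)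
      finally show "emeasure N (void S V) * indicator ?B x = ?r (a \<times> void S V) x"
        by (auto simp: indicator_def)
    qed
    finally show ?thesis .
  qed
  have OV: "?O = space S \<times> void S {}" by (auto simp: void_def)
  have total: "integral\<^sup>N N (?l ?O) = integral\<^sup>N \<Lambda> (?r ?O)"
    unfolding OV by (rule gen) auto
  \<comment> \<open>The total mass is at most the intensity of the bounded set \<open>B\<close>.
    This finiteness permits the cancellation in the step to complements.\<close>
  have rO: "integral\<^sup>N \<Lambda> (?r ?O) \<noteq> \<infinity>"
  proof -
    have "integral\<^sup>N \<Lambda> (?r ?O) \<le> (\<integral>\<^sup>+x. indicator B x \<partial>\<Lambda>)"
    proof (rule nn_integral_mono)
      fix x
      have "(\<integral>\<^sup>+A. indicator ?O (x, insert x A) \<partial>N) \<le> (\<integral>\<^sup>+A. 1 \<partial>N)"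
        by (rule nn_integral_mono) (auto simp: indicator_def)
      then show "?r ?O x \<le> indicator B x"
        by (auto simp: indicator_def N.emeasure_space_1)
    qed
    also have "\<dots> = emeasure \<Lambda> B" using B(1) by (simp add: sets_lborel_marked)
    finally show ?thesis using emeasure_bounded_finite[OF B(2)] by (auto simp: top_unique)
  qed
  have "{a \<times> b | a b. a \<in> sets S \<and> b \<in> voids S} \<subseteq> Pow ?O"
    using voids_subset[of S] sets.sets_into_space[of _ S] by blast
  from Int_stable_pair_voids this E[unfolded sets_pair_voids] show ?thesis
  proof (induct rule: sigma_sets_induct_disjoint)
    case (basic E)
    then show ?case using gen by (auto simp: voids_def)
  next
    case empty show ?case by simp
  next
    case (compl E)
    then have Es: "E \<in> sets (S \<Otimes>\<^sub>M config_space S)" by (simp only: sets_pair_voids)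
    have Os: "?O \<in> sets (S \<Otimes>\<^sub>M config_space S)"
      using sets.top[of "S \<Otimes>\<^sub>M config_space S"] by (simp add: space_pair_measure space_config_space)
    have Cs: "?O - E \<in> sets (S \<Otimes>\<^sub>M config_space S)" using Es Os by auto
    have EO: "E \<subseteq> ?O" using sets.sets_into_space[OF Es] by (simp add: space_pair_measure space_config_space)
    have sp: "indicator (?O - E) p + indicator E p = (indicator ?O p :: ennreal)" for p
      using EO by (auto simp: indicator_def)
    have l: "integral\<^sup>N N (?l (?O - E)) + integral\<^sup>N N (?l E) = integral\<^sup>N N (?l ?O)"
      using lm[OF Cs] lm[OF Es] 
      by (simp add: nn_integral_add[symmetric] distrib_left[symmetric] sp)
    have r: "integral\<^sup>N \<Lambda> (?r (?O - E)) + integral\<^sup>N \<Lambda> (?r E) = integral\<^sup>N \<Lambda> (?r ?O)"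
    proof -
      have "integral\<^sup>N \<Lambda> (?r (?O - E)) + integral\<^sup>N \<Lambda> (?r E) = (\<integral>\<^sup>+x. ?r (?O - E) x + ?r E x \<partial>\<Lambda>)"
        using rm[OF Cs] rm[OF Es] by (intro nn_integral_add[symmetric])
      also have "\<dots> = integral\<^sup>N \<Lambda> (?r ?O)"
      proof (rule nn_integral_cong)
        fix x assume "x \<in> space \<Lambda>"
        then have x: "x \<in> space S" by (simp add: space_pair_measure)
        show "?r (?O - E) x + ?r E x = ?r ?O x"
          using Em1[OF Cs x] Em1[OF Es x]
          by (simp add: nn_integral_add[symmetric] distrib_left[symmetric] sp)
      qed
      finally show ?thesis .
    qed
    have "integral\<^sup>N N (?l (?O - E)) + integral\<^sup>N N (?l E) = integral\<^sup>N \<Lambda> (?r (?O - E)) + integral\<^sup>N N (?l E)"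
      using l r total compl by simp
    moreover have "integral\<^sup>N N (?l E) \<noteq> \<top>"
      using rO unfolding l[symmetric] total[symmetric] by simp
    ultimately show ?case by (rule ennreal_add_right_eqD)
  next
    case (union E)
    then have Es: "E i \<in> sets (S \<Otimes>\<^sub>M config_space S)" for i by (auto simp only: sets_pair_voids)
    have u: "indicator (\<Union>i. E i) p = (\<Sum>i. indicator (E i) p :: ennreal)" for p
      using suminf_indicator[OF union(1), of p] by simp
    have "integral\<^sup>N N (?l (\<Union>i. E i)) = (\<integral>\<^sup>+A. (\<Sum>i. ?l (E i) A) \<partial>N)"
      by (rule nn_integral_cong) (simp add: u nn_integral_suminf[symmetric])
    also have "\<dots> = (\<Sum>i. integral\<^sup>N N (?l (E i)))" using lm[OF Es] by (intro nn_integral_suminf)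
    also have "\<dots> = (\<Sum>i. integral\<^sup>N \<Lambda> (?r (E i)))" using union by simp
    also have "\<dots> = (\<integral>\<^sup>+x. (\<Sum>i. ?r (E i) x) \<partial>\<Lambda>)"
      using rm[OF Es] by (intro nn_integral_suminf[symmetric])
    also have "\<dots> = integral\<^sup>N \<Lambda> (?r (\<Union>i. E i))"
    proof (rule nn_integral_cong)
      fix x assume "x \<in> space \<Lambda>"
      then have x: "x \<in> space S" by (simp add: space_pair_measure)
      show "(\<Sum>i. ?r (E i) x) = ?r (\<Union>i. E i) x"
        using Em1[OF Es x] by (simp add: u nn_integral_suminf)
    qed
    finally show ?case .
  qed
qed

end

section \<open>Comparison of weights\<close>

lemma powr_at_top:
  assumes "0 < (a::real)"
  shows "filterlim (\<lambda>x. x powr a) at_top at_top"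
proof -
  have "filterlim (\<lambda>x::real. exp (a * ln x)) at_top at_top"
    using assms by (intro filterlim_compose[OF exp_at_top]
      filterlim_tendsto_pos_mult_at_top[OF tendsto_const _ ln_at_top])
  moreover have "eventually (\<lambda>x::real. exp (a * ln x) = x powr a) at_top"
    using eventually_gt_at_top[of 0] by eventually_elim (simp add: powr_def)
  ultimately show ?thesis by (subst (asm) filterlim_cong[OF refl refl])
qed

text \<open>The volume of the window after every face has moved inwards by \<open>r\<close>.
  Parametrising by volume makes the smaller cube a \<open>window\<close> again.\<close>

definition inner_volume :: "nat \<Rightarrow> real \<Rightarrow> real \<Rightarrow> real" where
  "inner_volume d r L = (L powr (1 / real d) - 2 * r) ^ d"

lemma inner_volume_tendsto:
  assumes d: "0 < d"
  shows "((\<lambda>L. inner_volume d r L / L) \<longlongrightarrow> 1) at_top"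
proof -
  have s: "filterlim (\<lambda>L::real. L powr (1 / real d)) at_top at_top"
    using d by (intro powr_at_top) auto
  have "((\<lambda>L. (1 - 2 * r / (L powr (1 / real d))) ^ d) \<longlongrightarrow> (1 - 0) ^ d) at_top"
    by (intro tendsto_intros tendsto_divide_0[OF tendsto_const] filterlim_mono[OF s at_top_le_at_infinity order_refl])
  moreover have "eventually (\<lambda>L. (1 - 2 * r / (L powr (1 / real d))) ^ d = inner_volume d r L / L) at_top"
    using eventually_gt_at_top[of 0]
  proof eventually_elim
    case (elim L)
    define s where "s = L powr (1 / real d)"
    have "s > 0" using elim by (simp add: s_def)
    have sd: "s ^ d = L" using elim d by (simp add: s_def powr_realpow[symmetric] powr_powr)
    have "1 - 2 * r / s = (s - 2 * r) / s" using \<open>s > 0\<close> by (simp add: field_simps)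
    then show ?case by (simp add: inner_volume_def s_def[symmetric] power_divide sd)
  qed
  ultimately show ?thesis by (simp add: tendsto_cong)
qed

text \<open>The first hypothesis makes the side length of the smaller cube positive, so that the
  root recovers it from its power.\<close>

lemma window_inner_volume:
  fixes x :: "real ^ 'd"
  assumes "2 * r < L powr (1 / real CARD('d))" and "x \<in> window (inner_volume CARD('d) r L)"
  shows "\<bar>x $ i\<bar> \<le> L powr (1 / real CARD('d)) / 2 - r"
proof -
  define s where "s = L powr (1 / real CARD('d)) - 2 * r"
  have "s > 0" using assms(1) by (simp add: s_def)
  then have "inner_volume CARD('d) r L powr (1 / real CARD('d)) = s"
    by (simp add: inner_volume_def s_def[symmetric] powr_realpow[symmetric] powr_powr)
  then have "\<bar>x $ i\<bar> \<le> s / 2" using assms(2) by (simp add: window_def)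
  then show ?thesis by (simp add: s_def)
qed

text \<open>Two densities with mass at most one that both exceed \<open>1 / L\<close> on a set of volume \<open>l\<close> share
  the mass \<open>l / L\<close>.\<close>

lemma nn_integral_diff_densities_le:
  fixes u v :: "real ^ 'd \<Rightarrow> real"
  assumes [measurable]: "u \<in> borel_measurable borel" "v \<in> borel_measurable borel"
    and nn: "\<And>x. 0 \<le> u x" "\<And>x. 0 \<le> v x"
    and u: "(\<integral>\<^sup>+x. ennreal (u x) \<partial>lborel) \<le> 1" and v: "(\<integral>\<^sup>+x. ennreal (v x) \<partial>lborel) \<le> 1"
    and l: "0 < l" "0 < L"
    and lower: "\<And>x. x \<in> window l \<Longrightarrow> 1 / L \<le> u x \<and> 1 / L \<le> v x"
  shows "(\<integral>\<^sup>+x. ennreal \<bar>u x - v x\<bar> \<partial>lborel) \<le> ennreal (2 * (1 - l / L))"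
proof -
  let ?d = "\<integral>\<^sup>+x. ennreal \<bar>u x - v x\<bar> \<partial>lborel"
  have i: "(\<integral>\<^sup>+x. ennreal (2 / L) * indicator (window l) (x :: real ^ 'd) \<partial>lborel) = ennreal (2 * l / L)"
    using l by (subst nn_integral_cmult_indicator) (auto simp: emeasure_window ennreal_mult[symmetric])
  have "?d + ennreal (2 * l / L) = (\<integral>\<^sup>+x. ennreal \<bar>u x - v x\<bar> + ennreal (2 / L) * indicator (window l) x \<partial>lborel)"
    by (subst nn_integral_add) (simp_all add: i)
  also have "\<dots> \<le> (\<integral>\<^sup>+x. ennreal (u x) + ennreal (v x) \<partial>lborel)"
  proof (rule nn_integral_mono)
    fix x
    \<comment> \<open>The sum \<open>u x + v x\<close> is \<open>\<bar>u x - v x\<bar>\<close> plus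
      twice the minimum of the two, and on the smaller window this minimum is at least
      \<open>1 / L\<close>.\<close>
    have *: "\<bar>u x - v x\<bar> + 2 / L * indicator (window l) x \<le> u x + v x"
      using lower[of x] nn[of x] by (cases "x \<in> window l") (auto simp: indicator_def)
    have "ennreal (\<bar>u x - v x\<bar> + 2 / L * indicator (window l) x)
      = ennreal \<bar>u x - v x\<bar> + ennreal (2 / L) * indicator (window l) x"
      using l by (subst ennreal_plus) (auto simp: indicator_def)
    with ennreal_leI[OF *] show "ennreal \<bar>u x - v x\<bar> + ennreal (2 / L) * indicator (window l) x \<le> ennreal (u x) + ennreal (v x)"
      using nn[of x] by simp
  qed
  also have "\<dots> = (\<integral>\<^sup>+x. ennreal (u x) \<partial>lborel) + (\<integral>\<^sup>+x. ennreal (v x) \<partial>lborel)"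
    by (rule nn_integral_add) auto
  also have "\<dots> \<le> 1 + 1" by (intro add_mono u v)
  finally have le: "?d + ennreal (2 * l / L) \<le> ennreal 2" by simp
  then have "?d \<noteq> \<top>" by (auto simp: top_unique)
  then obtain d where d: "?d = ennreal d" "0 \<le> d" by (cases ?d) auto
  have "0 \<le> 2 * l / L" using l by simp
  with d(2) have "ennreal d + ennreal (2 * l / L) = ennreal (d + 2 * l / L)" by (rule ennreal_plus[symmetric])
  with le have "ennreal (d + 2 * l / L) \<le> ennreal 2" by (simp only: d(1))
  then have "d + 2 * l / L \<le> 2" by (rule ennreal_le_iff[THEN iffD1, rotated]) simp
  then show ?thesis unfolding d(1) by (intro ennreal_leI) (simp add: algebra_simps)
qed

definition unit_cube :: "(real ^ 'd) set" where "unit_cube = cbox 0 1"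

lemma unit_cube_borel[measurable]: "unit_cube \<in> sets borel"
  by (simp add: unit_cube_def)

lemma emeasure_unit_cube: "emeasure lborel (unit_cube :: (real ^ 'd) set) = 1"
proof -
  have "0 \<in> (unit_cube :: (real ^ 'd) set)" by (simp add: unit_cube_def mem_box_cart)
  then have "measure lborel (unit_cube :: (real ^ 'd) set) = 1"
    unfolding unit_cube_def by (subst content_cbox_cart) auto
  then show ?thesis
    using emeasure_eq_ennreal_measure[of lborel "unit_cube :: (real ^ 'd) set"]
      emeasure_lborel_cbox_finite[of 0 "1 :: real ^ 'd"]
    by (simp add: unit_cube_def less_top)
qed

text \<open>The weight that the point \<open>x\<close> receives in the average over \<open>z\<close> in the window of the sums over the
  points in the cubes \<open>unit_cube - z\<close>.\<close>

definition smooth_weight :: "real \<Rightarrow> real ^ 'd \<Rightarrow> real" where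
  "smooth_weight L x = measure (window_law L) {z. x + z \<in> unit_cube}"

lemma translate_unit_cube_borel: "{z. x + z \<in> unit_cube} \<in> sets borel"
  by measurable

lemma ennreal_smooth_weight:
  assumes "0 < L"
  shows "ennreal (smooth_weight L x) = (\<integral>\<^sup>+z. indicator unit_cube (x + z) \<partial>window_law L)"
proof -
  interpret U: prob_space "window_law L :: (real ^ 'd) measure" by (rule prob_space_window_law[OF assms])
  have "(\<integral>\<^sup>+z. indicator unit_cube (x + z) \<partial>window_law L) = (\<integral>\<^sup>+z. indicator {z. x + z \<in> unit_cube} z \<partial>window_law L)"
    by (rule nn_integral_cong) (simp add: indicator_def)
  also have "\<dots> = emeasure (window_law L) {z. x + z \<in> unit_cube}"
    by (rule nn_integral_indicator) (use translate_unit_cube_borel[of x] in simp)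
  finally show ?thesis by (simp only: smooth_weight_def U.emeasure_eq_measure)
qed

lemma smooth_weight_nonneg: "0 \<le> smooth_weight L x"
  by (simp add: smooth_weight_def)

text \<open>By Fubini the mass is the average over \<open>z\<close> of the volumes of translated
  unit cubes, each of which is one.\<close>

lemma
  assumes L: "0 < L"
  shows measurable_smooth_weight: "smooth_weight L \<in> borel_measurable (borel :: (real ^ 'd) measure)"
    and nn_integral_smooth_weight: "(\<integral>\<^sup>+x. ennreal (smooth_weight L (x :: real ^ 'd)) \<partial>lborel) = 1"
proof -
  interpret U: prob_space "window_law L :: (real ^ 'd) measure" by (rule prob_space_window_law[OF L])
  interpret lU: pair_sigma_finite lborel "window_law L :: (real ^ 'd) measure" ..
  have m: "(\<lambda>(x, z). indicator unit_cube (x + z) :: ennreal) \<in> borel_measurable (lborel \<Otimes>\<^sub>M (window_law L :: (real ^ 'd) measure))"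
    by measurable
  have "(\<lambda>x. \<integral>\<^sup>+z. indicator unit_cube (x + z) \<partial>window_law L) \<in> borel_measurable (lborel :: (real ^ 'd) measure)"
    using U.borel_measurable_nn_integral_fst[OF m] by simp
  then have "(\<lambda>x. enn2real (ennreal (smooth_weight L x))) \<in> borel_measurable (lborel :: (real ^ 'd) measure)"
    unfolding ennreal_smooth_weight[OF L] by measurable
  then show "smooth_weight L \<in> borel_measurable (borel :: (real ^ 'd) measure)"
    by (simp add: smooth_weight_nonneg)
  have "(\<integral>\<^sup>+x. ennreal (smooth_weight L (x :: real ^ 'd)) \<partial>lborel)
      = (\<integral>\<^sup>+z. (\<integral>\<^sup>+x. indicator unit_cube (x + z) \<partial>lborel) \<partial>(window_law L :: (real ^ 'd) measure))"
    unfolding ennreal_smooth_weight[OF L] using lU.Fubini'[OF m] by simp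
  also have "\<dots> = (\<integral>\<^sup>+z. 1 \<partial>(window_law L :: (real ^ 'd) measure))"
  proof (rule nn_integral_cong)
    fix z :: "real ^ 'd"
    have "(\<integral>\<^sup>+x. indicator unit_cube (x + z) \<partial>lborel) = (\<integral>\<^sup>+x. indicator unit_cube x \<partial>distr lborel borel ((+) z))"
      by (subst nn_integral_distr) (auto simp: add.commute)
    also have "\<dots> = emeasure lborel (unit_cube :: (real ^ 'd) set)"
      unfolding lborel_distr_plus by simp
    finally show "(\<integral>\<^sup>+x. indicator unit_cube (x + z) \<partial>lborel) = (1 :: ennreal)" by (simp add: emeasure_unit_cube)
  qed
  also have "\<dots> = 1" using L by (simp add: emeasure_window divide_ennreal)
  finally show "(\<integral>\<^sup>+x. ennreal (smooth_weight L (x :: real ^ 'd)) \<partial>lborel) = 1" .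
qed

lemma smooth_weight_ge:
  fixes x :: "real ^ 'd"
  assumes L: "0 < L" and sub: "{z. x + z \<in> unit_cube} \<subseteq> window L"
  shows "1 / L \<le> smooth_weight L x"
proof -
  interpret U: prob_space "window_law L :: (real ^ 'd) measure" by (rule prob_space_window_law[OF L])
  have b: "{z. x + z \<in> unit_cube} \<in> sets lborel" using translate_unit_cube_borel[of x] by simp
  have "emeasure lborel {z. x + z \<in> unit_cube} = emeasure (distr lborel borel ((+) x)) unit_cube"
    using b by (subst emeasure_distr) (auto simp: vimage_def)
  then have e: "emeasure lborel {z. x + z \<in> unit_cube} = 1"
    by (simp only: lborel_distr_plus emeasure_unit_cube)
  have "emeasure (window_law L) {z. x + z \<in> unit_cube} = emeasure lborel (window L \<inter> {z. x + z \<in> unit_cube}) / ennreal L"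
    using L b by (subst emeasure_uniform_measure) (auto simp: emeasure_window)
  also have "window L \<inter> {z. x + z \<in> unit_cube} = {z. x + z \<in> unit_cube}" using sub by auto
  finally have "ennreal (smooth_weight L x) = 1 / ennreal L" by (simp only: smooth_weight_def U.emeasure_eq_measure e)
  also have "\<dots> = ennreal (1 / L)" using L divide_ennreal[of 1 L] by simp
  finally show ?thesis using L smooth_weight_nonneg[of L x] by (simp add: ennreal_inj)
qed

text \<open>Both weights have mass at most one. The bound is uniform in \<open>L\<close> and
  \<open>K\<close> and yields the dominating function for the later passage to the limit.\<close>

lemma nn_integral_weight_diff_le:
  fixes K :: "(real ^ 'd) set"
  assumes L: "0 < L" and D: "D \<in> sets borel" and K: "closed K"
  shows "(\<integral>\<^sup>+x. ennreal \<bar>est_weight L t D (x, K) - smooth_weight L x\<bar> \<partial>lborel) \<le> 2"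
proof -
  note [measurable] = measurable_smooth_weight[OF L, where 'd='d]
  have [measurable]: "(\<lambda>x. est_weight L t D (x, K)) \<in> borel_measurable lborel"
    using measurable_Pair1[OF measurable_est_weight[OF D, of L t], of K] K by (simp add: space_closed_sets_space)
  have "(\<integral>\<^sup>+x. ennreal \<bar>est_weight L t D (x, K) - smooth_weight L x\<bar> \<partial>lborel)
      \<le> (\<integral>\<^sup>+x. ennreal \<bar>est_weight L t D (x, K)\<bar> + ennreal (smooth_weight L x) \<partial>lborel)"
  proof (rule nn_integral_mono)
    fix x :: "real ^ 'd"
    have "\<bar>est_weight L t D (x, K) - smooth_weight L x\<bar> \<le> \<bar>est_weight L t D (x, K)\<bar> + smooth_weight L x"
      using smooth_weight_nonneg[of L x] by simp
    from ennreal_leI[OF this] show "ennreal \<bar>est_weight L t D (x, K) - smooth_weight L x\<bar>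
        \<le> ennreal \<bar>est_weight L t D (x, K)\<bar> + ennreal (smooth_weight L x)"
      by (simp add: smooth_weight_nonneg)
  qed
  also have "\<dots> = (\<integral>\<^sup>+x. ennreal \<bar>est_weight L t D (x, K)\<bar> \<partial>lborel) + 1"
    by (subst nn_integral_add) (auto simp: nn_integral_smooth_weight[OF L])
  also have "\<dots> \<le> 1 + 1" using nn_integral_est_weight_le[of L t D K] by (intro add_right_mono) simp
  finally show ?thesis by simp
qed

text \<open>For \<open>x\<close> in the inner window the moved cell and the translated cube both
  stay in the window. Since the erosion has volume at most \<open>L\<close>, either weight is then
  at least \<open>1 / L\<close>, and the estimate for densities bounds the distance by
  \<open>2 * (1 - l L / L)\<close>, which tends to zero.\<close>

lemma est_weight_close_smooth_weight:
  fixes K :: "(real ^ 'd) set"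
  assumes K: "bounded K" "K \<noteq> {}" 
    and D: "\<And>L. D L \<in> sets borel" "\<And>L. window L \<subseteq> D L" and t: "\<And>L. 0 < L \<Longrightarrow> t L \<le> L / 2"
  shows "((\<lambda>L. \<integral>\<^sup>+x. ennreal \<bar>est_weight L (t L) (D L) (x, K) - smooth_weight L x\<bar> \<partial>lborel) \<longlongrightarrow> 0) at_top"
proof -
  obtain b where b: "\<And>x. x \<in> K \<Longrightarrow> norm x \<le> b" using K by (auto simp: bounded_iff)
  \<comment> \<open>The margin must absorb the cell, whose points have norm at most
    \<open>b\<close>, and the side length 1 of the unit cube.\<close>
  define r where "r = max b 1"
  define s where "s L = L powr (1 / real CARD('d))" for L
  define l where "l = inner_volume CARD('d) r"
  have lim: "((\<lambda>L. l L / L) \<longlongrightarrow> 1) at_top" unfolding l_def by (rule inner_volume_tendsto) simp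
  have s_top: "filterlim s at_top at_top" unfolding s_def by (intro powr_at_top) auto
  \<comment> \<open>Once the inner window has more than half the volume, so does the erosion that
    contains it, and the threshold \<open>t L\<close> is met.\<close>
  have half: "eventually (\<lambda>L. 1 / 2 < l L / L) at_top" by (rule order_tendstoD(1)[OF lim]) simp
  have ev: "eventually (\<lambda>L. (\<integral>\<^sup>+x. ennreal \<bar>est_weight L (t L) (D L) (x, K) - smooth_weight L x\<bar> \<partial>lborel)
      \<le> ennreal (2 * (1 - l L / L))) at_top"
    using eventually_gt_at_top[of 0] filterlim_at_top_dense[THEN iffD1, OF s_top, rule_format, of "2 * r"]
      half
  proof (eventually_elim, goal_cases)
    case (1 L)
    then have L: "0 < L" and sr: "2 * r < s L" and l2: "L / 2 < l L" by (auto simp: field_simps)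
    then have l0: "0 < l L" by simp
    have in_x: "\<bar>x $ i\<bar> \<le> s L / 2 - r" if "x \<in> window (l L)" for x :: "real ^ 'd" and i
      using window_inner_volume[OF sr[unfolded s_def] that[unfolded l_def]] by (simp add: s_def)
    let ?E = "erosion (window L) K"
    have lE: "window (l L) \<subseteq> ?E"
    proof
      fix x :: "real ^ 'd" assume x: "x \<in> window (l L)"
      have "y + x \<in> window L" if "y \<in> K" for y
      proof -
        have "\<bar>(y + x) $ i\<bar> \<le> s L / 2" for i
        proof -
          have "\<bar>y $ i\<bar> \<le> r" using component_le_norm_cart[of y i] b[OF that] by (simp add: r_def)
          then show ?thesis using in_x[OF x, of i] unfolding vector_add_component by linarith
        qed
        then show ?thesis by (simp add: window_def s_def)
      qed
      then show "x \<in> ?E" by (auto simp: erosion_def)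
    qed
    have Eb: "?E \<in> sets lborel" using closed_erosion[OF closed_window[of L], of K] by simp
    \<comment> \<open>A single point of \<open>K\<close> confines the erosion to a translate of the
      window, so its volume is at most \<open>L\<close>; for empty \<open>K\<close> this would
      fail.\<close>
    obtain k where k: "k \<in> K" using K by blast
    have "(+) k \<in> lborel \<rightarrow>\<^sub>M borel" by measurable
    from measurable_sets[OF this window_borel[of L]]
    have "emeasure lborel ?E \<le> emeasure lborel ((+) k -` window L \<inter> space lborel)"
      using k by (intro emeasure_mono) (auto simp: erosion_def)
    also have "\<dots> = emeasure (distr lborel borel ((+) k)) (window L)"
      by (rule emeasure_distr[symmetric]) auto
    also have "\<dots> = ennreal L" unfolding lborel_distr_plus by (rule emeasure_window[OF L])
    finally have EL: "emeasure lborel ?E \<le> ennreal L" .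
    then have Efin: "emeasure lborel ?E = ennreal (measure lborel ?E)"
      by (intro emeasure_eq_ennreal_measure) (auto simp: top_unique)
    have VL: "measure lborel ?E \<le> L" using EL L unfolding Efin by simp
    have "ennreal (l L) \<le> emeasure lborel ?E"
      unfolding emeasure_window[OF l0, where 'd='d, symmetric] by (rule emeasure_mono[OF lE Eb])
    then have lV: "l L \<le> measure lborel ?E" unfolding Efin by simp
    show ?case
    proof (rule nn_integral_diff_densities_le)
      show "(\<lambda>x. est_weight L (t L) (D L) (x, K)) \<in> borel_measurable borel"
        using Eb D(1)[of L] unfolding est_weight_def fst_conv snd_conv
        by (cases "t L \<le> measure lborel ?E") simp_all
      show "smooth_weight L \<in> borel_measurable (borel :: (real ^ 'd) measure)" by (rule measurable_smooth_weight[OF L])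
      show "(\<integral>\<^sup>+x. ennreal (est_weight L (t L) (D L) (x, K)) \<partial>lborel) \<le> 1"
        using nn_integral_est_weight_le[of L "t L" "D L" K] by (simp add: est_weight_nonneg)
      show "(\<integral>\<^sup>+x. ennreal (smooth_weight L (x :: real ^ 'd)) \<partial>lborel) \<le> 1"
        by (simp add: nn_integral_smooth_weight[OF L])
      fix x :: "real ^ 'd" assume x: "x \<in> window (l L)"
      have "\<bar>x $ i\<bar> \<le> s L / 2" for i
        using in_x[OF x, of i] r_def by linarith
      then have "x \<in> window L" by (simp add: window_def s_def)
      then have "est_weight L (t L) (D L) (x, K) = 1 / measure lborel ?E"
        using x lE D(2)[of L] lV l2 t[OF L] by (auto simp: est_weight_def indicator_def)
      then have 1: "1 / L \<le> est_weight L (t L) (D L) (x, K)"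
        using VL lV l0 L by (simp add: frac_le)
      have "{z. x + z \<in> unit_cube} \<subseteq> window L"
      proof
        fix z assume "z \<in> {z. x + z \<in> unit_cube}"
        then have "0 \<le> (x + z) $ i \<and> (x + z) $ i \<le> 1" for i
          by (auto simp: unit_cube_def mem_box_cart)
        then have c: "0 \<le> x $ i + z $ i \<and> x $ i + z $ i \<le> 1" for i by simp
        have "\<bar>z $ i\<bar> \<le> s L / 2" for i
          using c[of i] in_x[OF x, of i] r_def by linarith
        then show "z \<in> window L" by (simp add: window_def s_def)
      qed
      then have "1 / L \<le> smooth_weight L x" by (rule smooth_weight_ge[OF L])
      with 1 show "1 / L \<le> est_weight L (t L) (D L) (x, K) \<and> 1 / L \<le> smooth_weight L x" ..
    qed (use L l0 in \<open>auto simp: est_weight_nonneg smooth_weight_nonneg\<close>)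
  qed
  have "((\<lambda>L. ennreal (2 * (1 - l L / L))) \<longlongrightarrow> ennreal (2 * (1 - 1))) at_top"
    by (intro tendsto_intros tendsto_ennrealI lim)
  then have z: "((\<lambda>L. ennreal (2 * (1 - l L / L))) \<longlongrightarrow> 0) at_top" by simp
  show ?thesis
    by (rule tendsto_sandwich[OF _ ev tendsto_const z]) simp
qed

section \<open>Consequences of L^1 convergence\<close>

lemma asymptotically_unbiasedI:
  assumes "\<And>L. 0 < L \<Longrightarrow> integrable M (X L)" and "prob_space M"
    and "((\<lambda>L. \<integral>\<^sup>+\<omega>. ennreal \<bar>X L \<omega> - c\<bar> \<partial>M) \<longlongrightarrow> 0) at_top"
  shows "asymptotically_unbiased M X c"
  unfolding asymptotically_unbiased_def
proof (intro conjI allI impI)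
  interpret prob_space M by fact
  have "((\<lambda>L. (\<integral>\<omega>. X L \<omega> \<partial>M) - c) \<longlongrightarrow> 0) at_top"
  proof (rule tendsto_rabs_zero_cancel, rule tendsto_ennrealD)
    have le: "eventually (\<lambda>L. ennreal \<bar>(\<integral>\<omega>. X L \<omega> \<partial>M) - c\<bar> \<le> (\<integral>\<^sup>+\<omega>. ennreal \<bar>X L \<omega> - c\<bar> \<partial>M)) at_top"
      using eventually_gt_at_top[of 0]
    proof eventually_elim
      case (elim L)
      have i: "integrable M (\<lambda>\<omega>. X L \<omega> - c)" using assms(1)[OF elim] by simp
      show ?case using integral_norm_bound_ennreal[OF i] assms(1)[OF elim] by (simp add: prob_space)
    qed
    show "((\<lambda>L. ennreal \<bar>(\<integral>\<omega>. X L \<omega> \<partial>M) - c\<bar>) \<longlongrightarrow> ennreal 0) at_top"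
      using tendsto_sandwich[OF _ le tendsto_const assms(3)] by simp
  qed auto
  then show "((\<lambda>L. \<integral>\<omega>. X L \<omega> \<partial>M) \<longlongrightarrow> c) at_top" by (rule LIM_zero_cancel)
qed (use assms in auto)

text \<open>Markov's inequality: the probability of an error above \<open>e\<close> is at most
  \<open>1 / e\<close> times the L^1 distance.\<close>

lemma weakly_consistentI:
  assumes m: "\<And>L. 0 < L \<Longrightarrow> X L \<in> borel_measurable M" and "prob_space M"
    and "((\<lambda>L. \<integral>\<^sup>+\<omega>. ennreal \<bar>X L \<omega> - c\<bar> \<partial>M) \<longlongrightarrow> 0) at_top"
  shows "weakly_consistent M X c"
  unfolding weakly_consistent_def
proof (intro conjI allI impI)
  interpret prob_space M by fact
  fix e :: real assume e: "0 < e"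
  show "((\<lambda>L. measure M {\<omega> \<in> space M. e < \<bar>X L \<omega> - c\<bar>}) \<longlongrightarrow> 0) at_top"
  proof (rule tendsto_ennrealD)
    have le: "eventually (\<lambda>L. ennreal (measure M {\<omega> \<in> space M. e < \<bar>X L \<omega> - c\<bar>})
       \<le> ennreal (1 / e) * (\<integral>\<^sup>+\<omega>. ennreal \<bar>X L \<omega> - c\<bar> \<partial>M)) at_top"
      using eventually_gt_at_top[of 0]
    proof eventually_elim
      case (elim L)
      note [measurable] = m[OF elim]
      have "ennreal (measure M {\<omega> \<in> space M. e < \<bar>X L \<omega> - c\<bar>}) = (\<integral>\<^sup>+\<omega>. indicator {\<omega> \<in> space M. e < \<bar>X L \<omega> - c\<bar>} \<omega> \<partial>M)"
        by (simp add: emeasure_eq_measure)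
      also have "\<dots> \<le> (\<integral>\<^sup>+\<omega>. ennreal (1 / e) * ennreal \<bar>X L \<omega> - c\<bar> \<partial>M)"
      proof (rule nn_integral_mono)
        fix \<omega>
        have "1 \<le> (1 / e) * \<bar>X L \<omega> - c\<bar>" if "e < \<bar>X L \<omega> - c\<bar>" using that e by (simp add: field_simps)
        then show "indicator {\<omega> \<in> space M. e < \<bar>X L \<omega> - c\<bar>} \<omega> \<le> ennreal (1 / e) * ennreal \<bar>X L \<omega> - c\<bar>"
          using e by (auto simp: indicator_def ennreal_mult[symmetric] ennreal_ge_1)
      qed
      also have "\<dots> = ennreal (1 / e) * (\<integral>\<^sup>+\<omega>. ennreal \<bar>X L \<omega> - c\<bar> \<partial>M)"
        by (rule nn_integral_cmult) simp
      finally show ?case .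
    qed
    have "((\<lambda>L. ennreal (1 / e) * (\<integral>\<^sup>+\<omega>. ennreal \<bar>X L \<omega> - c\<bar> \<partial>M)) \<longlongrightarrow> ennreal (1 / e) * 0) at_top"
      by (intro ennreal_tendsto_cmult assms(3)) simp
    then have z: "((\<lambda>L. ennreal (1 / e) * (\<integral>\<^sup>+\<omega>. ennreal \<bar>X L \<omega> - c\<bar> \<partial>M)) \<longlongrightarrow> 0) at_top" by simp
    show "((\<lambda>L. ennreal (measure M {\<omega> \<in> space M. e < \<bar>X L \<omega> - c\<bar>})) \<longlongrightarrow> ennreal 0) at_top"
      using tendsto_sandwich[OF _ le tendsto_const z] by simp
  qed auto
qed (use m in auto)

section \<open>Consistency in the Poisson case\<close>

locale poisson_tessellation =
  typical_cell M \<mu> Q \<rho> \<eta> \<kappa> + poisson_marked M \<mu> Q \<eta>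
  for M :: "'w measure" and \<mu> :: real and Q :: "real measure"
    and \<rho> :: "real ^ 'd \<Rightarrow> (real ^ 'd) \<times> real \<Rightarrow> real"
    and \<eta> :: "'w \<Rightarrow> ((real ^ 'd) \<times> real) set"
    and \<kappa> :: "(real ^ 'd) set measure" +
  fixes M0 :: "'w \<Rightarrow> real" and h :: "(real ^ 'd) set \<Rightarrow> real"
  assumes M0: "M0 \<in> M \<rightarrow>\<^sub>M Q" "distr M Q M0 = Q"
    and indep_M0: "indep_set (sets (vimage_algebra (space M) M0 Q))
           (sets (vimage_algebra (space M) \<eta> (config_space (borel \<Otimes>\<^sub>M Q))))"
    and h: "integrable \<kappa> h" "h {} = 0"
    and bounded_origin: "AE \<omega> in M. bounded (cell \<rho> (0, M0 \<omega>) (\<eta> \<omega>))"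
begin

section \<open>Boundedness of the typical cell\<close>

text \<open>Independence in the form of a product law lets a statement that holds almost surely for
  the random mark be read for almost every fixed mark.\<close>

lemma distr_mark_config: "distr M (Q \<Otimes>\<^sub>M config_space S) (\<lambda>\<omega>. (M0 \<omega>, \<eta> \<omega>)) = Q \<Otimes>\<^sub>M N"
proof (rule pair_measure_eqI[symmetric])
  have m: "(\<lambda>\<omega>. (M0 \<omega>, \<eta> \<omega>)) \<in> M \<rightarrow>\<^sub>M Q \<Otimes>\<^sub>M config_space S" using M0(1) eta by measurable
  show "sets (Q \<Otimes>\<^sub>M N) = sets (distr M (Q \<Otimes>\<^sub>M config_space S) (\<lambda>\<omega>. (M0 \<omega>, \<eta> \<omega>)))"
    by (simp cong: sets_pair_measure_cong add: sets_N)
  fix A B assume A: "A \<in> sets Q" and B: "B \<in> sets N"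
  let ?A = "M0 -` A \<inter> space M" and ?B = "\<eta> -` B \<inter> space M"
  have B': "B \<in> sets (config_space S)" using B by (simp add: sets_N)
  have "?A \<in> sets (vimage_algebra (space M) M0 Q)"
    "?B \<in> sets (vimage_algebra (space M) \<eta> (config_space S))"
    using A B' by (auto intro: in_vimage_algebra)
  then have "prob (?A \<inter> ?B) = prob ?A * prob ?B" by (rule indep_setD[OF indep_M0])
  then have "emeasure M (?A \<inter> ?B) = emeasure M ?A * emeasure M ?B"
    by (simp add: emeasure_eq_measure ennreal_mult)
  also have "emeasure M ?A = emeasure Q A"
    using emeasure_distr[OF M0(1) A] by (simp add: M0(2))
  also have "emeasure M ?B = emeasure N B"
    using emeasure_distr[OF eta B'] by (simp add: N_def)
  also have "?A \<inter> ?B = (\<lambda>\<omega>. (M0 \<omega>, \<eta> \<omega>)) -` (A \<times> B) \<inter> space M" by auto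
  finally show "emeasure Q A * emeasure N B
      = emeasure (distr M (Q \<Otimes>\<^sub>M config_space S) (\<lambda>\<omega>. (M0 \<omega>, \<eta> \<omega>))) (A \<times> B)"
    using A B' by (subst emeasure_distr[OF m]) auto
qed (rule Q.sigma_finite_measure_axioms N.sigma_finite_measure_axioms)+

lemma centred_cell_shift:
  assumes x: "x \<in> UNIV \<times> {0..\<mu>}" and A: "A \<in> configurations (UNIV \<times> {0..\<mu>})"
  shows "centred_cell \<rho> (x + (z, 0)) (config_shift z A) = centred_cell \<rho> x A"
proof -
  have "x + (z, 0) \<in> UNIV \<times> {0..\<mu>}" using x by (cases x) auto
  moreover have "config_shift z A \<subseteq> UNIV \<times> {0..\<mu>}"
    using config_subset[OF config_shift_configurations[OF A]] .
  moreover have "config_shift (- fst (x + (z, 0))) (config_shift z A) = config_shift (- fst x) A"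
    unfolding config_shift_def image_image by (simp add: add.assoc)
  ultimately show ?thesis
    using centred_cell_eq[OF weight, of "x + (z, 0)"] centred_cell_eq[OF weight x config_subset[OF A]] by simp
qed

text \<open>Fubini for the product law fixes the mark; stationarity of the configuration then moves
  the generating point from the origin to any \<open>a\<close>. The exceptional set of marks does
  not depend on \<open>a\<close>.\<close>

lemma AE_bounded_cell:
  "AE m in Q. \<forall>a. AE A in N. \<not> (closed (centred_cell \<rho> (a, m) A) \<and> \<not> bounded (centred_cell \<rho> (a, m) A))"
proof -
  let ?U = "{K :: (real ^ 'd) set. closed K \<and> \<not> bounded K}"
  let ?f = "\<lambda>(m, A). cell \<rho> (0, m) A"
  interpret QN: pair_sigma_finite Q N ..
  have f: "?f \<in> Q \<Otimes>\<^sub>M N \<rightarrow>\<^sub>M closed_sets_space"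
    using measurable_cell_origin[OF Q weight] by (simp cong: measurable_cong_sets sets_pair_measure_cong add: sets_N)
  have E: "{p \<in> space (Q \<Otimes>\<^sub>M N). ?f p \<notin> ?U} \<in> sets (Q \<Otimes>\<^sub>M N)"
  proof -
    have "{p \<in> space (Q \<Otimes>\<^sub>M N). ?f p \<notin> ?U} = space (Q \<Otimes>\<^sub>M N) - (?f -` ?U \<inter> space (Q \<Otimes>\<^sub>M N))" by auto
    then show ?thesis using measurable_sets[OF f sets_unbounded_closed] by auto
  qed
  have m: "(\<lambda>\<omega>. (M0 \<omega>, \<eta> \<omega>)) \<in> M \<rightarrow>\<^sub>M Q \<Otimes>\<^sub>M config_space S" using M0(1) eta by measurable
  have "AE p in distr M (Q \<Otimes>\<^sub>M config_space S) (\<lambda>\<omega>. (M0 \<omega>, \<eta> \<omega>)). ?f p \<notin> ?U"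
  proof (rule AE_distr_iff[OF m, THEN iffD2])
    show "{p \<in> space (Q \<Otimes>\<^sub>M config_space S). ?f p \<notin> ?U} \<in> sets (Q \<Otimes>\<^sub>M config_space S)"
      using E sets_pair_measure_cong[OF refl sets_N] sets_eq_imp_space_eq[OF sets_pair_measure_cong[OF refl sets_N]] by simp
    show "AE \<omega> in M. ?f (M0 \<omega>, \<eta> \<omega>) \<notin> ?U" using bounded_origin by eventually_elim simp
  qed
  then have "AE m in Q. AE A in N. ?f (m, A) \<notin> ?U"
    unfolding distr_mark_config by (rule QN.AE_pair)
  with AE_space show ?thesis
  proof eventually_elim
    case (elim m)
    show ?case
    proof
      fix a
      have fm: "(\<lambda>A. ?f (m, A)) \<in> N \<rightarrow>\<^sub>M closed_sets_space" using measurable_Pair2[OF f elim(1)] .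
      have "AE A in distr N N (config_shift (- a)). ?f (m, A) \<notin> ?U" unfolding distr_config_shift by (rule elim(2))
      then have "AE A in N. ?f (m, config_shift (- a) A) \<notin> ?U"
      proof (rule AE_distr_iff[OF config_shift_z, THEN iffD1, rotated])
        have "{A \<in> space N. ?f (m, A) \<notin> ?U} = space N - ((\<lambda>A. ?f (m, A)) -` ?U \<inter> space N)" by auto
        then show "{A \<in> space N. ?f (m, A) \<notin> ?U} \<in> sets N" using measurable_sets[OF fm sets_unbounded_closed] by auto
      qed
      with AE_space show "AE A in N. \<not> (closed (centred_cell \<rho> (a, m) A) \<and> \<not> bounded (centred_cell \<rho> (a, m) A))"
      proof eventually_elim
        case (elim A)
        have "(a, m) \<in> UNIV \<times> {0..\<mu>}" using \<open>m \<in> space Q\<close> mark_law_space[OF Q] by simp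
        moreover have "A \<subseteq> UNIV \<times> {0..\<mu>}" using elim(1) config_subset by (auto simp: space_N)
        ultimately show ?case using elim(2) centred_cell_eq[OF weight, of "(a, m)" A] by simp
      qed
    qed
  qed
qed

text \<open>Campbell's formula expresses the probability of an unbounded typical cell as the
  expected number of points in the unit cube with unbounded cell. The Mecke formula replaces such a
  point by one added at a fixed place, for which unboundedness is a null event.\<close>

lemma AE_kappa_bounded: "AE K in \<kappa>. bounded K"
proof -
  let ?U = "{K :: (real ^ 'd) set. closed K \<and> \<not> bounded K}"
  let ?C = "unit_cube :: (real ^ 'd) set"
  define B where "B = ?C \<times> {0..\<mu>}"
  define E where "E = {(x, A) \<in> space (S \<Otimes>\<^sub>M config_space S). centred_cell \<rho> x A \<in> ?U}"
  have sQ: "space Q = {0..\<mu>}" by (rule mark_law_space[OF Q])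
  have B: "B \<in> sets S" "bounded B"
  proof -
    show "B \<in> sets S" unfolding B_def sQ[symmetric] by (intro pair_measureI) auto
    show "bounded B" unfolding B_def unit_cube_def by (intro bounded_Times) auto
  qed
  have E: "E \<in> sets (S \<Otimes>\<^sub>M config_space S)"
  proof -
    have "E = (\<lambda>(x, A). centred_cell \<rho> x A) -` ?U \<inter> space (S \<Otimes>\<^sub>M config_space S)" by (auto simp: E_def)
    then show ?thesis using measurable_sets[OF measurable_centred_cell[OF Q weight] sets_unbounded_closed] by simp
  qed
  let ?f = "\<lambda>p. indicator ?C (fst p) * indicator ?U (snd p) :: ennreal"
  note [measurable] = sets_unbounded_closed
  have fm: "?f \<in> borel_measurable (borel \<Otimes>\<^sub>M closed_sets_space)" by measurable
  have "emeasure \<kappa> ?U = (\<integral>\<^sup>+x. (\<integral>\<^sup>+K. ?f (x, K) \<partial>\<kappa>) \<partial>lborel)"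
    by (simp add: nn_integral_cmult nn_integral_multc sets_kappa emeasure_unit_cube)
  also have "\<dots> = (\<integral>\<^sup>+p. ?f p \<partial>(lborel \<Otimes>\<^sub>M \<kappa>))"
    by (rule kappa.nn_integral_fst) measurable
  also have "\<dots> = (\<integral>\<^sup>+\<omega>. (\<integral>\<^sup>+x. ?f (fst x, centred_cell \<rho> x (\<eta> \<omega>)) \<partial>count_space (\<eta> \<omega>)) \<partial>M)"
    by (rule campbell_nn[OF fm, symmetric])
  also have "\<dots> = (\<integral>\<^sup>+\<omega>. (\<integral>\<^sup>+x. indicator B x * indicator E (x, \<eta> \<omega>) \<partial>count_space (\<eta> \<omega>)) \<partial>M)"
  proof (intro nn_integral_cong)
    fix \<omega> x assume w: "\<omega> \<in> space M" and "x \<in> space (count_space (\<eta> \<omega>))"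
    then have "x \<in> UNIV \<times> {0..\<mu>}" using config_subset[OF eta_conf[OF w]] by auto
    moreover have "\<eta> \<omega> \<in> configurations (UNIV \<times> {0..\<mu>})" by (rule eta_conf[OF w])
    ultimately show "?f (fst x, centred_cell \<rho> x (\<eta> \<omega>)) = indicator B x * indicator E (x, \<eta> \<omega>)"
      by (cases x) (auto simp: indicator_def B_def E_def space_pair_measure space_config_space sQ)
  qed
  also have "\<dots> = (\<integral>\<^sup>+A. (\<integral>\<^sup>+x. indicator B x * indicator E (x, A) \<partial>count_space A) \<partial>N)"
    unfolding N_def
  proof (rule nn_integral_distr[OF eta, symmetric])
    have [measurable]: "(\<lambda>(x, A). indicator B x * indicator E (x, A) :: ennreal) \<in> borel_measurable (S \<Otimes>\<^sub>M config_space S)"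
      using B(1) E by (simp add: case_prod_beta')
    have "(\<lambda>A. \<integral>\<^sup>+x. indicator B x * indicator E (x, A) \<partial>count_space A) \<in> borel_measurable (config_space S)"
      by (rule measurable_nn_integral_marked[OF Q measurable_ident_sets[OF refl]]) measurable
    then show "(\<lambda>A. \<integral>\<^sup>+x. indicator B x * indicator E (x, A) \<partial>count_space A)
        \<in> borel_measurable (distr M (config_space S) \<eta>)"
      by simp
  qed
  also have "\<dots> = (\<integral>\<^sup>+x. indicator B x * (\<integral>\<^sup>+A. indicator E (x, insert x A) \<partial>N) \<partial>\<Lambda>)"
    by (rule mecke[OF B E])
  also have "\<dots> = (\<integral>\<^sup>+x. 0 \<partial>\<Lambda>)"
  proof (rule nn_integral_cong_AE)
    define R where "R m \<longleftrightarrow> (\<forall>a. AE A in N. centred_cell \<rho> (a, m) A \<notin> ?U)" for m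
    have "AE m in Q. R m" using AE_bounded_cell unfolding R_def mem_Collect_eq .
    then obtain Z where Z: "{m \<in> space Q. \<not> R m} \<subseteq> Z" "emeasure Q Z = 0" "Z \<in> sets Q"
      by (rule AE_E)
    \<comment> \<open>The strip over the exceptional marks is null although space has infinite
      volume, since infinity times zero is zero.\<close>
    have null: "UNIV \<times> Z \<in> null_sets \<Lambda>"
      using Z(2,3) by (intro null_setsI) (auto simp: Q.emeasure_pair_measure_Times)
    have "AE x in \<Lambda>. x \<notin> UNIV \<times> Z" by (rule AE_not_in[OF null])
    with AE_space show "AE x in \<Lambda>. indicator B x * (\<integral>\<^sup>+A. indicator E (x, insert x A) \<partial>N) = 0"
    proof eventually_elim
      case (elim x)
      obtain a m where x: "x = (a, m)" by force
      with elim have m: "m \<in> space Q" "m \<notin> Z" by (auto simp: space_pair_measure)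
      then have "R m" using Z(1) by blast
      then have "AE A in N. centred_cell \<rho> (a, m) A \<notin> ?U" unfolding R_def by blast
      then have "AE A in N. indicator E (x, insert x A) = (0 :: ennreal)"
      proof eventually_elim
        case (elim A)
        \<comment> \<open>A point always satisfies the cell inequality against itself, so including
          it among the competitors changes nothing.\<close>
        have "centred_cell \<rho> x (insert x A) = centred_cell \<rho> x A"
          by (auto simp: centred_cell_def cell_def)
        then show ?case using elim by (auto simp: E_def x)
      qed
      then have "(\<integral>\<^sup>+A. indicator E (x, insert x A) \<partial>N) = (\<integral>\<^sup>+A. 0 \<partial>N)" by (rule nn_integral_cong_AE)
      then show ?case by simp
    qed
  qed
  finally have "emeasure \<kappa> ?U = 0" by simp
  then have "?U \<in> null_sets \<kappa>" by (auto simp: null_sets_def sets_kappa)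
  from AE_not_in[OF this] AE_space show ?thesis
    by eventually_elim (auto simp: space_kappa)
qed

section \<open>The unit cube sum and its window means\<close>

text \<open>The cube has volume one, so Campbell's formula gives this sum the mean of
  \<open>h\<close> under \<kappa> without normalisation.\<close>

abbreviation cube_sum :: "((real ^ 'd) \<times> real) set \<Rightarrow> real" where
  "cube_sum \<equiv> cell_sum (\<lambda>p. h (snd p) * indicator unit_cube (fst p))"

lemma h_measurable: "h \<in> borel_measurable closed_sets_space"
  using borel_measurable_integrable[OF h(1)] by (simp cong: measurable_cong_sets add: sets_kappa)

lemma cube_weight:
  "(\<lambda>p. indicator unit_cube (fst p) :: real) \<in> borel_measurable (borel \<Otimes>\<^sub>M closed_sets_space)"
  "(\<integral>\<^sup>+x. ennreal \<bar>indicator unit_cube (fst (x :: real ^ 'd, K :: (real ^ 'd) set))\<bar> \<partial>lborel) = 1"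
  "(\<integral>x. indicator unit_cube (fst (x :: real ^ 'd, K :: (real ^ 'd) set)) \<partial>lborel) = (1 :: real)"
proof -
  show "(\<lambda>p. indicator unit_cube (fst p) :: real) \<in> borel_measurable (borel \<Otimes>\<^sub>M closed_sets_space)" by measurable
  show "(\<integral>\<^sup>+x. ennreal \<bar>indicator unit_cube (fst (x :: real ^ 'd, K :: (real ^ 'd) set))\<bar> \<partial>lborel) = 1"
    by (simp add: ennreal_indicator emeasure_unit_cube)
  show "(\<integral>x. indicator unit_cube (fst (x :: real ^ 'd, K :: (real ^ 'd) set)) \<partial>lborel) = (1 :: real)"
  proof -
    have "measure lborel (unit_cube :: (real ^ 'd) set) = 1"
      by (simp only: measure_def emeasure_unit_cube enn2real_1)
    then show ?thesis by simp
  qed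
qed

lemma
  shows cube_sum_measurable: "cube_sum \<in> borel_measurable N"
    and cube_sum_integrable: "integrable N cube_sum"
    and cube_sum_expectation: "N.expectation cube_sum = (\<integral>K. h K \<partial>\<kappa>)"
proof -
  note int = integrable_weighted[OF h(1) cube_weight(1), of 1, simplified cube_weight(2), simplified]
  note [measurable] = h_measurable
  have "cube_sum \<in> borel_measurable (config_space S)"
  proof -
    have "(\<lambda>p. h (snd p) * indicator unit_cube (fst p)) \<in> borel_measurable (borel \<Otimes>\<^sub>M closed_sets_space)"
      by measurable
    from measurable_cell_functional[OF this measurable_ident_sets[OF refl]]
    show ?thesis
      unfolding cell_sum_def by (rule measurable_infsum_marked[OF Q measurable_ident_sets[OF refl]])
  qed
  then show m: "cube_sum \<in> borel_measurable N" by (simp cong: measurable_cong_sets add: sets_N)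
  have mc: "cube_sum \<in> borel_measurable (config_space S)" by fact
  show "integrable N cube_sum"
    unfolding N_def integrable_distr_eq[OF eta mc] by (rule integrable_cell_sum[OF int])
  have "N.expectation cube_sum = (\<integral>\<omega>. cube_sum (\<eta> \<omega>) \<partial>M)" unfolding N_def by (rule integral_distr[OF eta mc])
  also have "\<dots> = (\<integral>K. h K * (\<integral>x. indicator unit_cube (fst (x :: real ^ 'd, K)) \<partial>lborel) \<partial>\<kappa>)"
    unfolding integral_cell_sum[OF int]
    by (rule integral_weighted[OF h(1) cube_weight(1), of 1]) (simp_all only: cube_weight(2), simp_all)
  also have "\<dots> = (\<integral>K. h K \<partial>\<kappa>)" by (simp only: cube_weight(3) mult_1_right)
  finally show "N.expectation cube_sum = (\<integral>K. h K \<partial>\<kappa>)" .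
qed

sublocale flow: measurable_flow N config_shift
  by unfold_locales (rule measurable_config_shift_N, rule distr_config_shift)

lemma cube_sum_ergodic: "(flow.deviation cube_sum \<longlongrightarrow> 0) at_top"
proof -
  have "flow.mean_ergodic cube_sum"
  proof (rule flow.mean_ergodic_integrable[OF _ _ Int_stable_voids _ cube_sum_integrable])
    have sp: "space N = configurations (space S)" by (simp only: space_N space_S)
    show "sets N = sigma_sets (space N) (voids S)"
      unfolding sp sets_N by (rule sets_config_space_voids[OF open_in_marked[OF Q]])
    show "voids S \<subseteq> Pow (space N)" unfolding sp by (rule voids_subset)
    fix V assume "V \<in> voids S"
    then obtain W where "V = void S W" "W \<in> sets S" "bounded W" by (auto simp: voids_def)
    then show "\<exists>R. \<forall>z w. R < norm (z - w) \<longrightarrow> N.prob {A \<in> space N. config_shift z A \<in> V \<and> config_shift w A \<in> V} = (N.prob V)\<^sup>2"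
      using mixing_void by simp
  qed
  then show ?thesis by (simp add: flow.mean_ergodic_def)
qed

text \<open>Centred cells are unaffected by a shift of the whole configuration; the shift only
  changes which points fall into the cube.\<close>

lemma cube_sum_shift:
  assumes A: "A \<in> configurations (UNIV \<times> {0..\<mu>})"
  shows "cube_sum (config_shift z A) = (\<Sum>\<^sub>\<infinity>x\<in>A. h (centred_cell \<rho> x A) * indicator unit_cube (fst x + z))"
proof -
  have "cube_sum (config_shift z A) = (\<Sum>\<^sub>\<infinity>x\<in>A. h (centred_cell \<rho> (x + (z, 0)) (config_shift z A))
      * indicator unit_cube (fst (x + (z, 0))))"
    unfolding cell_sum_def
    by (subst config_shift_def, subst infsum_reindex) (auto simp: inj_on_def o_def)
  also have "\<dots> = (\<Sum>\<^sub>\<infinity>x\<in>A. h (centred_cell \<rho> x A) * indicator unit_cube (fst x + z))"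
  proof (rule infsum_cong)
    fix x assume "x \<in> A"
    then have "x \<in> UNIV \<times> {0..\<mu>}" using config_subset[OF A] by blast
    then show "h (centred_cell \<rho> (x + (z, 0)) (config_shift z A)) * indicator unit_cube (fst (x + (z, 0)))
        = h (centred_cell \<rho> x A) * indicator unit_cube (fst x + z)"
      by (simp only: centred_cell_shift[OF _ A] fst_add fst_conv)
  qed
  finally show ?thesis .
qed

text \<open>The sum over the points and the average over the shifts are exchanged; for a single
  point the average of the cube indicator is the smooth weight. The summability hypothesis is the
  integrability that Fubini asks for.\<close>

lemma window_mean_cube_sum:
  assumes L: "0 < L" and A: "A \<in> configurations (UNIV \<times> {0..\<mu>})"
    and int: "integrable (count_space A) (\<lambda>x. h (centred_cell \<rho> x A) * smooth_weight L (fst x))"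
  shows "flow.window_mean L cube_sum A = cell_sum (\<lambda>p. h (snd p) * smooth_weight L (fst p)) A"
proof -
  let ?U = "window_law L :: (real ^ 'd) measure"
  let ?f = "\<lambda>x z. h (centred_cell \<rho> x A) * indicator unit_cube (fst x + z) :: real"
  interpret U: prob_space ?U by (rule prob_space_window_law[OF L])
  have cnt: "countable A" by (rule config_countable[OF A])
  interpret C: sigma_finite_measure "count_space A" by (rule sigma_finite_measure_count_space_countable[OF cnt])
  interpret CU: pair_sigma_finite "count_space A" ?U ..
  have fm: "(\<lambda>(x, z). ?f x z) \<in> borel_measurable (count_space A \<Otimes>\<^sub>M ?U)"
    by (rule measurable_pair_measure_countable1[OF cnt]) simp
  have smooth: "(\<integral>z. ?f x z \<partial>?U) = h (centred_cell \<rho> x A) * smooth_weight L (fst x)" for x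
  proof -
    have "(\<integral>z. indicator unit_cube (fst x + z) \<partial>?U) = (\<integral>z. indicator {z. fst x + z \<in> unit_cube} z \<partial>?U :: real)"
      by (rule Bochner_Integration.integral_cong) (auto simp: indicator_def)
    also have "\<dots> = smooth_weight L (fst x)"
      using translate_unit_cube_borel[of "fst x"] by (simp add: smooth_weight_def)
    finally show ?thesis by simp
  qed
  have "(\<integral>\<^sup>+p. ennreal (norm ((\<lambda>(x, z). ?f x z) p)) \<partial>(count_space A \<Otimes>\<^sub>M ?U))
      = (\<integral>\<^sup>+x. (\<integral>\<^sup>+z. ennreal \<bar>?f x z\<bar> \<partial>?U) \<partial>count_space A)"
    using fm by (subst U.nn_integral_fst[symmetric]) (simp_all add: case_prod_beta')
  also have "\<dots> = (\<integral>\<^sup>+x. ennreal \<bar>h (centred_cell \<rho> x A) * smooth_weight L (fst x)\<bar> \<partial>count_space A)"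
  proof (rule nn_integral_cong)
    fix x
    have "(\<integral>\<^sup>+z. ennreal \<bar>?f x z\<bar> \<partial>?U) = (\<integral>\<^sup>+z. ennreal \<bar>h (centred_cell \<rho> x A)\<bar> * indicator unit_cube (fst x + z) \<partial>?U)"
      by (rule nn_integral_cong) (auto simp: indicator_def)
    also have "\<dots> = ennreal \<bar>h (centred_cell \<rho> x A)\<bar> * ennreal (smooth_weight L (fst x))"
      unfolding ennreal_smooth_weight[OF L] by (rule nn_integral_cmult) measurable
    finally show "(\<integral>\<^sup>+z. ennreal \<bar>?f x z\<bar> \<partial>?U) = ennreal \<bar>h (centred_cell \<rho> x A) * smooth_weight L (fst x)\<bar>"
      by (simp add: ennreal_mult smooth_weight_nonneg abs_mult)
  qed
  also have "\<dots> < \<infinity>" using int by (simp add: integrable_iff_bounded)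
  finally have int2: "integrable (count_space A \<Otimes>\<^sub>M ?U) (\<lambda>(x, z). ?f x z)"
    using fm by (simp add: integrable_iff_bounded)
  \<comment> \<open>For almost every shift the sum converges absolutely, so that there
    \<open>infsum\<close> agrees with the integral over the counting measure.\<close>
  have AE: "AE z in ?U. integrable (count_space A) (\<lambda>x. ?f x z)"
    using CU.AE_integrable_snd[OF int2] by simp
  have "flow.window_mean L cube_sum A = (\<integral>z. (\<integral>x. ?f x z \<partial>count_space A) \<partial>?U)"
    unfolding flow.window_mean_def
  proof (rule integral_cong_AE)
    have "A \<in> space N" using A by (simp add: space_N)
    then have "(\<lambda>z. config_shift z A) \<in> borel \<rightarrow>\<^sub>M N"
      using measurable_compose[OF measurable_Pair2' measurable_config_shift_N] by simp
    from measurable_compose[OF this cube_sum_measurable]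
    show "(\<lambda>z. cube_sum (config_shift z A)) \<in> borel_measurable ?U" by simp
    show "(\<lambda>z. \<integral>x. ?f x z \<partial>count_space A) \<in> borel_measurable ?U"
      using CU.integrable_snd[OF int2] by auto
    show "AE z in ?U. cube_sum (config_shift z A) = (\<integral>x. ?f x z \<partial>count_space A)"
      using AE by eventually_elim (simp add: cube_sum_shift[OF A] infsum_eq_integral_count_space)
  qed
  also have "\<dots> = (\<integral>x. (\<integral>z. ?f x z \<partial>?U) \<partial>count_space A)"
    by (rule CU.Fubini_integral[OF int2])
  also have "\<dots> = cell_sum (\<lambda>p. h (snd p) * smooth_weight L (fst p)) A"
    unfolding smooth cell_sum_def by (simp add: infsum_eq_integral_count_space[OF int])
  finally show ?thesis .
qed

text \<open>Triangle inequality through the window mean, which is itself a cell sum. The difference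
  of estimator and window mean is then the cell sum for the difference of the weights, controlled in
  L^1 by Campbell's formula; the remaining term is the ergodic deviation.\<close>

lemma estimator_deviation_le:
  assumes L: "0 < L" and D: "D \<in> sets borel"
  shows "(\<integral>\<^sup>+\<omega>. ennreal \<bar>cell_sum (\<lambda>p. h (snd p) * est_weight L t D p) (\<eta> \<omega>) - (\<integral>K. h K \<partial>\<kappa>)\<bar> \<partial>M)
    \<le> (\<integral>\<^sup>+K. ennreal \<bar>h K\<bar> * (\<integral>\<^sup>+x. ennreal \<bar>est_weight L t D (x, K) - smooth_weight L x\<bar> \<partial>lborel) \<partial>\<kappa>)
      + flow.deviation cube_sum L"
proof -
  let ?c = "\<integral>K. h K \<partial>\<kappa>"
  let ?u = "\<lambda>p :: (real ^ 'd) \<times> (real ^ 'd) set. est_weight L t D p - smooth_weight L (fst p)"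
  let ?X = "\<lambda>\<omega>. cell_sum (\<lambda>p. h (snd p) * est_weight L t D p) (\<eta> \<omega>)"
  let ?Y = "\<lambda>\<omega>. cell_sum (\<lambda>p. h (snd p) * smooth_weight L (fst p)) (\<eta> \<omega>)"
  let ?Z = "\<lambda>\<omega>. cell_sum (\<lambda>p. h (snd p) * ?u p) (\<eta> \<omega>)"
  note [measurable] = measurable_smooth_weight[OF L, where 'd='d] measurable_est_weight[OF D, of L t]
  have um: "?u \<in> borel_measurable (borel \<Otimes>\<^sub>M closed_sets_space)" by measurable
  have u2: "(\<integral>\<^sup>+x. ennreal \<bar>?u (x, K)\<bar> \<partial>lborel) \<le> ennreal 2" if "closed K" for K
    using nn_integral_weight_diff_le[OF L D that, of t] by simp
  have iX: "integrable (lborel \<Otimes>\<^sub>M \<kappa>) (\<lambda>p. h (snd p) * est_weight L t D p)"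
    by (rule integrable_estimator[OF h(1) D])
  have iY: "integrable ((lborel :: (real ^ 'd) measure) \<Otimes>\<^sub>M \<kappa>) (\<lambda>p. h (snd p) * smooth_weight L (fst p))"
    by (rule integrable_weighted[where u="\<lambda>p. smooth_weight L (fst p)" and c=1, OF h(1)])
      (simp_all add: smooth_weight_nonneg nn_integral_smooth_weight[OF L])
  have iZ: "integrable (lborel \<Otimes>\<^sub>M \<kappa>) (\<lambda>p. h (snd p) * ?u p)"
    by (rule integrable_weighted[OF h(1) um, of 2]) (use u2 in auto)
  have mF: "flow.window_mean L cube_sum \<in> borel_measurable N"
    using flow.integrable_window_mean[OF L cube_sum_integrable] by auto
  have mG: "(\<lambda>A. ennreal \<bar>flow.window_mean L cube_sum A - ?c\<bar>) \<in> borel_measurable (config_space S)"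
    using mF by (simp cong: measurable_cong_sets add: sets_N)
  have Dev: "flow.deviation cube_sum L = (\<integral>\<^sup>+\<omega>. ennreal \<bar>flow.window_mean L cube_sum (\<eta> \<omega>) - ?c\<bar> \<partial>M)"
    unfolding flow.deviation_def cube_sum_expectation
    using nn_integral_distr[OF eta, of "\<lambda>A. ennreal \<bar>flow.window_mean L cube_sum A - ?c\<bar>"] mG
    by (simp add: N_def)
  have mW: "(\<lambda>\<omega>. ennreal \<bar>flow.window_mean L cube_sum (\<eta> \<omega>) - ?c\<bar>) \<in> borel_measurable M"
    by (rule measurable_compose[OF eta mG])
  have "AE \<omega> in M. ennreal \<bar>?X \<omega> - ?c\<bar> \<le> ennreal \<bar>?Z \<omega>\<bar> + ennreal \<bar>flow.window_mean L cube_sum (\<eta> \<omega>) - ?c\<bar>"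
    using AE_cell_summable[OF iX] AE_cell_summable[OF iY] AE_space
  proof eventually_elim
    case (elim \<omega>)
    have "?Z \<omega> = ?X \<omega> - ?Y \<omega>"
      using elim(1,2) unfolding cell_sum_def
      by (simp add: infsum_eq_integral_count_space right_diff_distrib)
    moreover have "flow.window_mean L cube_sum (\<eta> \<omega>) = ?Y \<omega>"
      using elim(2) by (intro window_mean_cube_sum[OF L eta_conf[OF elim(3)]]) simp
    ultimately have "\<bar>?X \<omega> - ?c\<bar> \<le> \<bar>?Z \<omega>\<bar> + \<bar>flow.window_mean L cube_sum (\<eta> \<omega>) - ?c\<bar>" by simp
    from ennreal_leI[OF this] show ?case by (simp only: ennreal_plus abs_ge_zero)
  qed
  then have "(\<integral>\<^sup>+\<omega>. ennreal \<bar>?X \<omega> - ?c\<bar> \<partial>M)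
      \<le> (\<integral>\<^sup>+\<omega>. ennreal \<bar>?Z \<omega>\<bar> + ennreal \<bar>flow.window_mean L cube_sum (\<eta> \<omega>) - ?c\<bar> \<partial>M)"
    by (rule nn_integral_mono_AE)
  also have "\<dots> = (\<integral>\<^sup>+\<omega>. ennreal \<bar>?Z \<omega>\<bar> \<partial>M) + flow.deviation cube_sum L"
    unfolding Dev using borel_measurable_integrable[OF integrable_cell_sum[OF iZ]] mW
    by (intro nn_integral_add) measurable
  also have "(\<integral>\<^sup>+\<omega>. ennreal \<bar>?Z \<omega>\<bar> \<partial>M) \<le> (\<integral>\<^sup>+p. ennreal \<bar>h (snd p) * ?u p\<bar> \<partial>(lborel \<Otimes>\<^sub>M \<kappa>))"
    by (rule nn_integral_cell_sum_le[OF iZ])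
  also have "\<dots> = (\<integral>\<^sup>+K. ennreal \<bar>h K\<bar> * (\<integral>\<^sup>+x. ennreal \<bar>?u (x, K)\<bar> \<partial>lborel) \<partial>\<kappa>)"
    by (rule nn_integral_weighted[OF h(1) um, of 2]) (use u2 in auto)
  finally show ?thesis by (simp add: add_right_mono)
qed

text \<open>Dominated convergence under \<kappa>: almost every cell is bounded, and twice
  \<open>\<bar>h K\<bar>\<close> dominates. The theorem concerns sequences, so the limit over real
  \<open>L\<close> is tested along sequences tending to infinity.\<close>

lemma weights_tendsto:
  assumes D: "\<And>L. D L \<in> sets borel" "\<And>L. window L \<subseteq> D L" and t: "\<And>L. 0 < L \<Longrightarrow> t L \<le> L / 2"
  shows "((\<lambda>L. \<integral>\<^sup>+K. ennreal \<bar>h K\<bar> * (\<integral>\<^sup>+x. ennreal \<bar>est_weight L (t L) (D L) (x, K) - smooth_weight L x\<bar> \<partial>lborel) \<partial>\<kappa>)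
    \<longlongrightarrow> 0) at_top"
proof (rule tendsto_at_topI_sequentially)
  fix X :: "nat \<Rightarrow> real" assume X: "filterlim X at_top sequentially"
  let ?d = "\<lambda>L K. \<integral>\<^sup>+x. ennreal \<bar>est_weight L (t L) (D L) (x, K) - smooth_weight L x\<bar> \<partial>lborel"
  \<comment> \<open>Dropping the first \<open>n0\<close> terms leaves positive parameters only, for
    which the window law is a probability measure.\<close>
  obtain n0 where n0: "\<And>n. n0 \<le> n \<Longrightarrow> 0 < X n"
    using X unfolding filterlim_at_top_dense eventually_sequentially by blast
  have hm: "h \<in> borel_measurable \<kappa>" using h(1) by auto
  have "(\<lambda>n. \<integral>\<^sup>+K. ennreal \<bar>h K\<bar> * ?d (X (n + n0)) K \<partial>\<kappa>) \<longlonglongrightarrow> (\<integral>\<^sup>+K. 0 \<partial>\<kappa>)"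
  proof (rule nn_integral_dominated_convergence[where w="\<lambda>K. ennreal \<bar>h K\<bar> * 2"])
    fix n
    have L: "0 < X (n + n0)" by (rule n0) simp
    let ?L = "X (n + n0)"
    note [measurable] = measurable_smooth_weight[OF L, where 'd='d] measurable_est_weight[OF D(1), of ?L "t ?L" ?L] hm
    have "(\<lambda>(K, x). ennreal \<bar>est_weight ?L (t ?L) (D ?L) (x, K) - smooth_weight ?L x\<bar>)
        \<in> borel_measurable (\<kappa> \<Otimes>\<^sub>M lborel)" by measurable
    then have dm: "?d ?L \<in> borel_measurable \<kappa>" by (rule lborel.borel_measurable_nn_integral)
    then show "(\<lambda>K. ennreal \<bar>h K\<bar> * ?d ?L K) \<in> borel_measurable \<kappa>" by measurable
    show "AE K in \<kappa>. ennreal \<bar>h K\<bar> * ?d ?L K \<le> ennreal \<bar>h K\<bar> * 2"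
      by (intro AE_I2 mult_left_mono nn_integral_weight_diff_le[OF L D(1)]) (auto simp: space_kappa)
  next
    show "(\<lambda>K. ennreal \<bar>h K\<bar> * 2) \<in> borel_measurable \<kappa>" using hm by measurable
    show "(\<integral>\<^sup>+K. ennreal \<bar>h K\<bar> * 2 \<partial>\<kappa>) < \<infinity>"
      using h(1) hm by (subst nn_integral_multc) (auto simp: integrable_iff_bounded ennreal_mult_less_top)
    show "AE K in \<kappa>. (\<lambda>n. ennreal \<bar>h K\<bar> * ?d (X (n + n0)) K) \<longlonglongrightarrow> 0"
      using AE_kappa_bounded
    proof eventually_elim
      case (elim K)
      show ?case
      \<comment> \<open>For the empty cell the estimator weight is zero and does not approach the
        smooth weight; the convention \<open>h {} = 0\<close> removes this case.\<close>
      proof (cases "K = {}")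
        case True then show ?thesis by (simp add: h(2))
      next
        case False
        have "((\<lambda>L. ?d L K) \<longlongrightarrow> 0) at_top" by (rule est_weight_close_smooth_weight[OF elim False D t])
        then have "(\<lambda>n. ?d (X n) K) \<longlonglongrightarrow> 0" by (rule filterlim_compose[OF _ X])
        then have "(\<lambda>n. ?d (X (n + n0)) K) \<longlonglongrightarrow> 0" by (rule LIMSEQ_ignore_initial_segment)
        then have "(\<lambda>n. ennreal \<bar>h K\<bar> * ?d (X (n + n0)) K) \<longlonglongrightarrow> ennreal \<bar>h K\<bar> * 0"
          by (intro ennreal_tendsto_cmult) auto
        then show ?thesis by simp
      qed
    qed
  qed simp
  then have "(\<lambda>n. \<integral>\<^sup>+K. ennreal \<bar>h K\<bar> * ?d (X (n + n0)) K \<partial>\<kappa>) \<longlonglongrightarrow> 0" by simp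
  then show "(\<lambda>n. \<integral>\<^sup>+K. ennreal \<bar>h K\<bar> * ?d (X n) K \<partial>\<kappa>) \<longlonglongrightarrow> 0" by (rule LIMSEQ_offset)
qed

lemma L1_convergence:
  assumes D: "\<And>L. D L \<in> sets borel" "\<And>L. window L \<subseteq> D L" and t: "\<And>L. 0 < L \<Longrightarrow> t L \<le> L / 2"
  shows "((\<lambda>L. \<integral>\<^sup>+\<omega>. ennreal \<bar>cell_sum (\<lambda>p. h (snd p) * est_weight L (t L) (D L) p) (\<eta> \<omega>) - (\<integral>K. h K \<partial>\<kappa>)\<bar> \<partial>M)
    \<longlongrightarrow> 0) at_top"
proof (rule tendsto_sandwich[OF _ _ tendsto_const])
  show "eventually (\<lambda>L. (\<integral>\<^sup>+\<omega>. ennreal \<bar>cell_sum (\<lambda>p. h (snd p) * est_weight L (t L) (D L) p) (\<eta> \<omega>) - (\<integral>K. h K \<partial>\<kappa>)\<bar> \<partial>M)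
     \<le> (\<integral>\<^sup>+K. ennreal \<bar>h K\<bar> * (\<integral>\<^sup>+x. ennreal \<bar>est_weight L (t L) (D L) (x, K) - smooth_weight L x\<bar> \<partial>lborel) \<partial>\<kappa>)
      + flow.deviation cube_sum L) at_top"
    using eventually_gt_at_top[of 0] by eventually_elim (rule estimator_deviation_le[OF _ D(1)])
  show "((\<lambda>L. (\<integral>\<^sup>+K. ennreal \<bar>h K\<bar> * (\<integral>\<^sup>+x. ennreal \<bar>est_weight L (t L) (D L) (x, K) - smooth_weight L x\<bar> \<partial>lborel) \<partial>\<kappa>)
      + flow.deviation cube_sum L) \<longlongrightarrow> 0) at_top"
    using tendsto_add[OF weights_tendsto[OF D t] cube_sum_ergodic] by simp
qed simp

lemma estimator_consistent:
  assumes D: "\<And>L. D L \<in> sets borel" "\<And>L. window L \<subseteq> D L" and t: "\<And>L. 0 < L \<Longrightarrow> t L \<le> L / 2"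
    and X: "\<And>L \<omega>. \<omega> \<in> space M \<Longrightarrow> X L \<omega> = cell_sum (\<lambda>p. h (snd p) * est_weight L (t L) (D L) p) (\<eta> \<omega>)"
  shows "asymptotically_unbiased M X (\<integral>K. h K \<partial>\<kappa>)" and "weakly_consistent M X (\<integral>K. h K \<partial>\<kappa>)"
proof -
  have int: "integrable M (X L)" for L
    using integrable_cell_sum[OF integrable_estimator[OF h(1) D(1), of L "t L" L]]
    by (rule Bochner_Integration.integrable_cong[THEN iffD1, OF refl, rotated]) (simp add: X)
  have lim: "((\<lambda>L. \<integral>\<^sup>+\<omega>. ennreal \<bar>X L \<omega> - (\<integral>K. h K \<partial>\<kappa>)\<bar> \<partial>M) \<longlongrightarrow> 0) at_top"
    using L1_convergence[OF D t] by (simp add: X cong: nn_integral_cong)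
  show "asymptotically_unbiased M X (\<integral>K. h K \<partial>\<kappa>)"
    by (rule asymptotically_unbiasedI[OF int prob_space_axioms lim])
  show "weakly_consistent M X (\<integral>K. h K \<partial>\<kappa>)"
    using int by (intro weakly_consistentI[OF _ prob_space_axioms lim]) auto
qed

end

text \<open>Cells whose erosion is null receive weight zero, so for a fixed window the estimator
  cannot account for them. This is why part (i) gives the expectation in general and equality with
  the mean of \<open>h\<close> when almost every cell with nonzero \<open>h\<close> has an erosion
  of positive volume.\<close>

theorem theorem2p1:
  fixes \<mu> :: real
    and Q :: "real measure"
    and \<rho> :: "real ^ 'd \<Rightarrow> (real ^ 'd) \<times> real \<Rightarrow> real"
    and h :: "(real ^ 'd) set \<Rightarrow> real"
    and M\<^sub>P :: "'v measure" and P :: "'v \<Rightarrow> ((real ^ 'd) \<times> real) set"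
    and M :: "'w measure" and \<eta> :: "'w \<Rightarrow> ((real ^ 'd) \<times> real) set" and M0 :: "'w \<Rightarrow> real"
    and \<kappa>\<^sub>P \<kappa> :: "(real ^ 'd) set measure"
  assumes "0 \<le> \<mu>" and "mark_law \<mu> Q" and "weight_function \<mu> \<rho>"
    and "h \<in> borel_measurable closed_sets_space" and "h {} = 0"
    and "\<And>K x. closed K \<Longrightarrow> h ((\<lambda>y. y + x) ` K) = h K"
    \<comment> \<open>the general process\<close>
    and "prob_space M\<^sub>P" and "P \<in> M\<^sub>P \<rightarrow>\<^sub>M config_space (borel \<Otimes>\<^sub>M Q)"
    and "stationary M\<^sub>P (unmarked P)" and "unit_intensity M\<^sub>P (unmarked P)"
    and "independently_marked M\<^sub>P Q P"
    and "typical_cell_law M\<^sub>P \<rho> P \<kappa>\<^sub>P" and "integrable \<kappa>\<^sub>P h"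
    \<comment> \<open>the Poisson process\<close>
    and "prob_space M" and "poisson_process M (lborel \<Otimes>\<^sub>M Q) \<eta>"
    and "M0 \<in> M \<rightarrow>\<^sub>M Q" and "distr M Q M0 = Q"
    and "prob_space.indep_set M (sets (vimage_algebra (space M) M0 Q))
           (sets (vimage_algebra (space M) \<eta> (config_space (borel \<Otimes>\<^sub>M Q))))"
    and "typical_cell_law M \<rho> \<eta> \<kappa>" and "integrable \<kappa> h"
  shows
    "(\<forall>L>0.
        integrable M\<^sub>P (\<lambda>\<omega>. H_est \<rho> h L (P \<omega>) (P \<omega>)) \<and>
        (\<integral>\<omega>. H_est \<rho> h L (P \<omega>) (P \<omega>) \<partial>M\<^sub>P)
          = (\<integral>K. (if 0 < measure lborel (erosion (window L) K) then h K else 0) \<partial>\<kappa>\<^sub>P) \<and>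
        ((AE K in \<kappa>\<^sub>P. h K \<noteq> 0 \<longrightarrow> 0 < measure lborel (erosion (window L) K)) \<longrightarrow>
           (\<integral>\<omega>. H_est \<rho> h L (P \<omega>) (P \<omega>) \<partial>M\<^sub>P) = (\<integral>K. h K \<partial>\<kappa>\<^sub>P))) \<and>
     ((\<exists>p>1. moment_condition M \<mu> \<rho> h \<eta> p) \<and> exp_diameter_tail M \<rho> \<eta> M0 \<longrightarrow>
        asymptotically_unbiased M
          (\<lambda>L \<omega>. H_est \<rho> h L (\<eta> \<omega> \<inter> marked_window \<mu> L) (\<eta> \<omega>)) (\<integral>K. h K \<partial>\<kappa>) \<and>
        asymptotically_unbiased M
          (\<lambda>L \<omega>. H_hat_est \<rho> h L (\<eta> \<omega>) (\<eta> \<omega>)) (\<integral>K. h K \<partial>\<kappa>) \<and>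
        asymptotically_unbiased M
          (\<lambda>L \<omega>. H_hat_est \<rho> h L (\<eta> \<omega> \<inter> marked_window \<mu> L) (\<eta> \<omega>)) (\<integral>K. h K \<partial>\<kappa>)) \<and>
     ((\<exists>p>1. moment_condition M \<mu> \<rho> h \<eta> p) \<and> exp_diameter_tail M \<rho> \<eta> M0
          \<and> stabilizing M \<mu> \<rho> h \<eta> \<longrightarrow>
        weakly_consistent M
          (\<lambda>L \<omega>. H_est \<rho> h L (\<eta> \<omega>) (\<eta> \<omega>)) (\<integral>K. h K \<partial>\<kappa>) \<and>
        weakly_consistent M
          (\<lambda>L \<omega>. H_est \<rho> h L (\<eta> \<omega> \<inter> marked_window \<mu> L) (\<eta> \<omega>)) (\<integral>K. h K \<partial>\<kappa>) \<and>
        weakly_consistent M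
          (\<lambda>L \<omega>. H_hat_est \<rho> h L (\<eta> \<omega>) (\<eta> \<omega>)) (\<integral>K. h K \<partial>\<kappa>) \<and>
        weakly_consistent M
          (\<lambda>L \<omega>. H_hat_est \<rho> h L (\<eta> \<omega> \<inter> marked_window \<mu> L) (\<eta> \<omega>)) (\<integral>K. h K \<partial>\<kappa>))"
proof (intro conjI)
  interpret P: typical_cell M\<^sub>P \<mu> Q \<rho> P \<kappa>\<^sub>P
    by (rule typical_cell.intro[OF assms(7)], unfold_locales) (fact assms)+
  have inv: "\<And>K x. closed K \<Longrightarrow> h ((\<lambda>y. y + x) ` K) = h K" by (fact assms)
  show "\<forall>L>0.
        integrable M\<^sub>P (\<lambda>\<omega>. H_est \<rho> h L (P \<omega>) (P \<omega>)) \<and>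
        (\<integral>\<omega>. H_est \<rho> h L (P \<omega>) (P \<omega>) \<partial>M\<^sub>P)
          = (\<integral>K. (if 0 < measure lborel (erosion (window L) K) then h K else 0) \<partial>\<kappa>\<^sub>P) \<and>
        ((AE K in \<kappa>\<^sub>P. h K \<noteq> 0 \<longrightarrow> 0 < measure lborel (erosion (window L) K)) \<longrightarrow>
           (\<integral>\<omega>. H_est \<rho> h L (P \<omega>) (P \<omega>) \<partial>M\<^sub>P) = (\<integral>K. h K \<partial>\<kappa>\<^sub>P))"
  proof (intro allI impI conjI)
    fix L :: real
    note unb = P.unbiased[OF \<open>integrable \<kappa>\<^sub>P h\<close> inv, of L]
    show "integrable M\<^sub>P (\<lambda>\<omega>. H_est \<rho> h L (P \<omega>) (P \<omega>))" by (rule unb(1))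
    show "(\<integral>\<omega>. H_est \<rho> h L (P \<omega>) (P \<omega>) \<partial>M\<^sub>P)
        = (\<integral>K. (if 0 < measure lborel (erosion (window L) K) then h K else 0) \<partial>\<kappa>\<^sub>P)" by (rule unb(2))
    note [measurable] = measurable_erosion_volume[OF closed_window[of L, where 'd='d]] assms(4)
    assume "AE K in \<kappa>\<^sub>P. h K \<noteq> 0 \<longrightarrow> 0 < measure lborel (erosion (window L) K)"
    then have "(\<integral>K. (if 0 < measure lborel (erosion (window L) K) then h K else 0) \<partial>\<kappa>\<^sub>P) = (\<integral>K. h K \<partial>\<kappa>\<^sub>P)"
      by (intro integral_cong_AE) auto
    then show "(\<integral>\<omega>. H_est \<rho> h L (P \<omega>) (P \<omega>) \<partial>M\<^sub>P) = (\<integral>K. h K \<partial>\<kappa>\<^sub>P)" by (simp only: unb(2))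
  qed
next
  let ?c = "\<integral>K. h K \<partial>\<kappa>"
  have inv: "\<And>K x. closed K \<Longrightarrow> h ((\<lambda>y. y + x) ` K) = h K" by (fact assms)
  have *: "asymptotically_unbiased M X ?c \<and> weakly_consistent M X ?c"
    if tail: "exp_diameter_tail M \<rho> \<eta> M0"
      and X: "X \<in> {\<lambda>L \<omega>. H_est \<rho> h L (\<eta> \<omega>) (\<eta> \<omega>),
        \<lambda>L \<omega>. H_est \<rho> h L (\<eta> \<omega> \<inter> marked_window \<mu> L) (\<eta> \<omega>),
        \<lambda>L \<omega>. H_hat_est \<rho> h L (\<eta> \<omega>) (\<eta> \<omega>),
        \<lambda>L \<omega>. H_hat_est \<rho> h L (\<eta> \<omega> \<inter> marked_window \<mu> L) (\<eta> \<omega>)}" for X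
  proof -
    interpret M: prob_space M by fact
    have "\<eta> \<in> M \<rightarrow>\<^sub>M config_space (borel \<Otimes>\<^sub>M Q)"
      using \<open>poisson_process M (lborel \<Otimes>\<^sub>M Q) \<eta>\<close> config_space_cong[OF sets_lborel_marked[of Q, where 'a="real ^ 'd"]]
      by (simp add: poisson_process_def)
    moreover have "AE \<omega> in M. bounded (cell \<rho> (0, M0 \<omega>) (\<eta> \<omega>))"
    proof -
      obtain D where "AE \<omega> in M. cell \<rho> (0, M0 \<omega>) (\<eta> \<omega>) \<subseteq> cball 0 (D \<omega>)"
        using tail by (auto simp: exp_diameter_tail_def)
      then show ?thesis by eventually_elim (rule bounded_subset[OF bounded_cball])
    qed
    ultimately interpret E: poisson_tessellation M \<mu> Q \<rho> \<eta> \<kappa> M0 h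
      using assms by unfold_locales
    note e = E.estimator_eq_cell_sum[OF inv]
    note c = E.estimator_consistent
    \<comment> \<open>The threshold 0 makes the volume condition hold always, since a measure is
      nonnegative; thus all four estimators are instances with \<open>t L\<close> at most
      \<open>L / 2\<close>.\<close>
    from X show ?thesis
      by (elim insertE emptyE; intro conjI; hypsubst)
        (rule c[where D="\<lambda>L. UNIV" and t="\<lambda>L. 0"] c[where D=window and t="\<lambda>L. 0"]
          c[where D="\<lambda>L. UNIV" and t="\<lambda>L. L / 2"] c[where D=window and t="\<lambda>L. L / 2"]; simp add: e; fail)+
  qed
  show "(\<exists>p>1. moment_condition M \<mu> \<rho> h \<eta> p) \<and> exp_diameter_tail M \<rho> \<eta> M0 \<longrightarrow>
        asymptotically_unbiased M
          (\<lambda>L \<omega>. H_est \<rho> h L (\<eta> \<omega> \<inter> marked_window \<mu> L) (\<eta> \<omega>)) ?c \<and>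
        asymptotically_unbiased M
          (\<lambda>L \<omega>. H_hat_est \<rho> h L (\<eta> \<omega>) (\<eta> \<omega>)) ?c \<and>
        asymptotically_unbiased M
          (\<lambda>L \<omega>. H_hat_est \<rho> h L (\<eta> \<omega> \<inter> marked_window \<mu> L) (\<eta> \<omega>)) ?c"
    using * by simp
  show "(\<exists>p>1. moment_condition M \<mu> \<rho> h \<eta> p) \<and> exp_diameter_tail M \<rho> \<eta> M0
          \<and> stabilizing M \<mu> \<rho> h \<eta> \<longrightarrow>
        weakly_consistent M
          (\<lambda>L \<omega>. H_est \<rho> h L (\<eta> \<omega>) (\<eta> \<omega>)) ?c \<and>
        weakly_consistent M
          (\<lambda>L \<omega>. H_est \<rho> h L (\<eta> \<omega> \<inter> marked_window \<mu> L) (\<eta> \<omega>)) ?c \<and>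
        weakly_consistent M
          (\<lambda>L \<omega>. H_hat_est \<rho> h L (\<eta> \<omega>) (\<eta> \<omega>)) ?c \<and>
        weakly_consistent M
          (\<lambda>L \<omega>. H_hat_est \<rho> h L (\<eta> \<omega> \<inter> marked_window \<mu> L) (\<eta> \<omega>)) ?c"
    using * by simp
qed

end
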